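(* Let $(M,L)$ be a Finsler manifold and $g$ the Finsler metric defined by $L$. Let $\nabla$ be a regular connection on $\pi^{-1}(TM)$ such that: (a) $\nabla$ is metric: $\nabla g=0$; (b) the horizontal torsion of $\nabla$ vanishes: $Q=0$; (c) the mixed torsion $T$ of $\nabla$ satisfies $g(T(\overline{X},\overline{Y}),\overline{Z})=g(T(\overline{X},\overline{Z}),\overline{Y})$ for all $\overline{X},\overline{Y},\overline{Z}\in\mathfrak{X}(\pi(M))$. Then the nonlinear connection $\Gamma=2\beta\circ\rho-I$ associated with $\nabla$ coincides with the Barthel connection: $\Gamma=[J,G]$.
   Context: Pullback formalism. $M$ is a real $C^\infty$ manifold of finite dimension; all objects are $C^\infty$. $\pi_M:TM\to M$ is the tangent bundle, $\pi:\mathcal{T}M\to M$ its open subbundle of nonzero tangent vectors, and $\pi^{-1}(TM)\to\mathcal{T}M$ is the pullback of $TM$ by $\pi$ (fibre over $u$: pairs $(u,v)$ with $v\in T_{\pi(u)}M$). $\mathfrak{X}(\mathcal{T}M)$ denotes the vector fields on $\mathcal{T}M$, and $\mathfrak{X}(\pi(M))$ the smooth sections of $\pi^{-1}(TM)$, written with bars. The fundamental section is $\overline{\eta}(u)=(u,u)$. The bundle morphisms $\rho:T(\mathcal{T}M)\to\pi^{-1}(TM)$ and $\gamma:\pi^{-1}(TM)\to T(\mathcal{T}M)$ are $\rho(X)=(u,d\pi(X))$ for $X\in T_u(\mathcal{T}M)$ and $\gamma(u,v)=\frac{d}{dt}\big|_{t=0}(u+tv)$; the image of $\gamma$ is $\ker\rho=V(\mathcal{T}M)$,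 the vertical bundle. Put $J:=\gamma\circ\rho$. Regular connections. For a linear connection $D$ on the vector bundle $\pi^{-1}(TM)$, the connection map is $K(X)=D_X\overline{\eta}$, and the horizontal space at $u$ is $H_u(\mathcal{T}M)=\{X\in T_u(\mathcal{T}M):K(X)=0\}$. $D$ is regular if $T_u(\mathcal{T}M)=V_u(\mathcal{T}M)\oplus H_u(\mathcal{T}M)$ for all $u\in\mathcal{T}M$. Then $\rho|_{H(\mathcal{T}M)}$ is an isomorphism onto $\pi^{-1}(TM)$, and its inverse $\beta:=(\rho|_{H(\mathcal{T}M)})^{-1}$ is the horizontal map of $D$. The vector 1-form $2\beta\circ\rho-I$ on $\mathcal{T}M$ ($I$ the identity) is called the nonlinear connection associated with $D$. Torsions. $\mathbf{T}(X,Y)=D_X\rho Y-D_Y\rho X-\rho[X,Y]$ for $X,Y\in\mathfrak{X}(\mathcal{T}M)$; the horizontal torsion is $Q(\overline{X},\overline{Y})=\mathbf{T}(\beta\overline{X},\beta\overline{Y})$ and the mixed ((h)hv-) torsion is $T(\overline{X},\overline{Y})=\mathbf{T}(\gamma\overline{X},\beta\overline{Y})$. Finsler structure. $(M,L)$ is a Finsler manifold: $L:TM\to\mathbb{R}$ is continuous, $C^\infty$ and positive on $\mathcal{T}M$, positively homogeneous of degree 1 on fibres, and with $E:=\frac12L^2$ the fibrewise Hessian of $E$ on $\mathcal{T}M$ is positive definite. The Finsler metric $g$ on $\pi^{-1}(TM)$ is this Hessian, i.e. $g(\rho X,\rho Y)=\Omega(JX,Y)$ with $\Omega:=dd_JE$,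 $d_JE:=dE\circ J$. The canonical spray $G$ is the vector field with $i_G\Omega=-dE$. The Barthel connection is the vector 1-form $[J,G]$ given by $[J,G](X)=[JX,G]-J[X,G]$. *)

theory Defs
  imports "HOL-Analysis.Analysis" "HOL-Library.Function_Algebras"
begin

text \<open>Pointwise scalar multiplication, so that tangent vectors (which are real functionals on
  functions, see below) can be added and scaled.\<close>

instantiation "fun" :: (type, real_vector) real_vector
begin

definition scaleR_fun :: "real \<Rightarrow> ('a \<Rightarrow> 'b) \<Rightarrow> 'a \<Rightarrow> 'b"
  where "scaleR_fun c f = (\<lambda>x. c *\<^sub>R f x)"

instance
  by standard (simp_all add: scaleR_fun_def fun_eq_iff scaleR_add_right scaleR_add_left)

end

lemma scaleR_fun_apply [simp]: "(c *\<^sub>R f) x = c *\<^sub>R f x"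
  by (simp add: scaleR_fun_def)


section \<open>Smooth maps between open subsets of normed spaces\<close>

text \<open>Only used for open sets in finite-dimensional spaces, where this is the usual notion: all
  iterated directional derivatives exist and are continuous.\<close>

primrec Ck_on ::
  "nat \<Rightarrow> 'a::real_normed_vector set \<Rightarrow> ('a \<Rightarrow> 'b::real_normed_vector) \<Rightarrow> bool"
where
  "Ck_on 0 S f \<longleftrightarrow> continuous_on S f"
| "Ck_on (Suc k) S f \<longleftrightarrow>
     (\<forall>x\<in>S. f differentiable (at x)) \<and>
     (\<forall>v. Ck_on k S (\<lambda>x. frechet_derivative f (at x) v))"

definition smooth_on ::
  "'a::real_normed_vector set \<Rightarrow> ('a \<Rightarrow> 'b::real_normed_vector) \<Rightarrow> bool"
  where "smooth_on S f \<longleftrightarrow> (\<forall>k. Ck_on k S f)"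


section \<open>Manifolds\<close>

text \<open>A manifold is given by an atlas, a set of charts \<open>(U, \<phi>)\<close>; its underlying set and its
  topology are those determined by the atlas. Outside \<open>U\<close> the values of \<open>\<phi>\<close> are irrelevant.\<close>

type_synonym ('a, 'e) atlas = "('a set \<times> ('a \<Rightarrow> 'e)) set"

definition carrier :: "('a, 'e) atlas \<Rightarrow> 'a set"
  where "carrier A = (\<Union>(U, \<phi>)\<in>A. U)"

definition open_in_atlas :: "('a, 'e::euclidean_space) atlas \<Rightarrow> 'a set \<Rightarrow> bool"
  where "open_in_atlas A W \<longleftrightarrow> W \<subseteq> carrier A \<and> (\<forall>(U, \<phi>)\<in>A. open (\<phi> ` (U \<inter> W)))"

definition mtop :: "('a, 'e::euclidean_space) atlas \<Rightarrow> 'a topology"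
  where "mtop A = topology (open_in_atlas A)"

definition smooth_atlas :: "('a, 'e::euclidean_space) atlas \<Rightarrow> bool"
  where "smooth_atlas A \<longleftrightarrow>
    (\<forall>(U, \<phi>)\<in>A. inj_on \<phi> U \<and> open (\<phi> ` U)) \<and>
    (\<forall>(U, \<phi>)\<in>A. \<forall>(V, \<psi>)\<in>A.
        open (\<phi> ` (U \<inter> V)) \<and> smooth_on (\<phi> ` (U \<inter> V)) (\<psi> \<circ> inv_into U \<phi>))"

definition smooth_manifold :: "('a, 'e::euclidean_space) atlas \<Rightarrow> bool"
  where "smooth_manifold A \<longleftrightarrow>
    smooth_atlas A \<and> Hausdorff_space (mtop A) \<and> second_countable (mtop A)"

lemma openin_mtop:
  assumes "smooth_atlas A"
  shows "openin (mtop A) W \<longleftrightarrow> open_in_atlas A W"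
proof -
  have "istopology (open_in_atlas A)"
    unfolding istopology_def
  proof (intro conjI allI impI)
    fix S T assume S: "open_in_atlas A S" and T: "open_in_atlas A T"
    have "open (\<phi> ` (U \<inter> (S \<inter> T)))" if "(U, \<phi>) \<in> A" for U \<phi>
    proof -
      have "inj_on \<phi> U" using assms that by (auto simp: smooth_atlas_def)
      then have "\<phi> ` ((U \<inter> S) \<inter> (U \<inter> T)) = \<phi> ` (U \<inter> S) \<inter> \<phi> ` (U \<inter> T)"
        by (rule inj_on_image_Int) auto
      moreover have "U \<inter> (S \<inter> T) = (U \<inter> S) \<inter> (U \<inter> T)" by blast
      ultimately show ?thesis
        using S T that by (auto simp: open_in_atlas_def)
    qed
    with S show "open_in_atlas A (S \<inter> T)" by (auto simp: open_in_atlas_def)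
  next
    fix K assume K: "\<forall>S\<in>K. open_in_atlas A S"
    have "open (\<phi> ` (U \<inter> \<Union>K))" if "(U, \<phi>) \<in> A" for U \<phi>
    proof -
      have "\<phi> ` (U \<inter> \<Union>K) = (\<Union>S\<in>K. \<phi> ` (U \<inter> S))" by blast
      with K that show ?thesis by (force simp: open_in_atlas_def)
    qed
    with K show "open_in_atlas A (\<Union>K)" by (auto simp: open_in_atlas_def)
  qed
  then show ?thesis by (simp add: mtop_def)
qed

definition std_atlas :: "('e, 'e::euclidean_space) atlas"
  where "std_atlas = {(UNIV, id)}"

definition smooth_at ::
  "('a, 'e::euclidean_space) atlas \<Rightarrow> ('b, 'f::euclidean_space) atlas \<Rightarrow> 'a \<Rightarrow> ('a \<Rightarrow> 'b) \<Rightarrow> bool"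
  where "smooth_at A B p F \<longleftrightarrow>
    (\<exists>(U, \<phi>)\<in>A. \<exists>(V, \<psi>)\<in>B. \<exists>W. openin (mtop A) W \<and> p \<in> W \<and> W \<subseteq> U \<and> F ` W \<subseteq> V \<and>
       smooth_on (\<phi> ` W) (\<psi> \<circ> F \<circ> inv_into U \<phi>))"

abbreviation smooth_fun_at :: "('a, 'e::euclidean_space) atlas \<Rightarrow> 'a \<Rightarrow> ('a \<Rightarrow> real) \<Rightarrow> bool"
  where "smooth_fun_at A \<equiv> smooth_at A (std_atlas :: (real, real) atlas)"

definition smooth_fun :: "('a, 'e::euclidean_space) atlas \<Rightarrow> ('a \<Rightarrow> real) \<Rightarrow> bool"
  where "smooth_fun A f \<longleftrightarrow> (\<forall>p\<in>carrier A. smooth_fun_at A p f)"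


section \<open>Tangent vectors, vector fields, Lie bracket\<close>

text \<open>A tangent vector is the derivative-along-a-curve functional \<open>f \<mapsto> (f \<circ> c)'(0)\<close> on functions
  smooth near the point \<open>c(0)\<close>. Such a functional is made zero on functions not smooth near the
  point, so that it is determined by the tangent vector. It does not record the base point: the
  elements of the tangent bundle are pairs \<open>(p, v)\<close>, and the zero vector is \<open>0\<close> at every point.\<close>

type_synonym 'a tvec = "('a \<Rightarrow> real) \<Rightarrow> real"

definition velocity :: "('a, 'e::euclidean_space) atlas \<Rightarrow> (real \<Rightarrow> 'a) \<Rightarrow> 'a tvec"
  where "velocity A c = (\<lambda>f. if smooth_fun_at A (c 0) f then deriv (f \<circ> c) 0 else 0)"

definition tangent_space :: "('a, 'e::euclidean_space) atlas \<Rightarrow> 'a \<Rightarrow> 'a tvec set"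
  where "tangent_space A p = {velocity A c | c. c 0 = p \<and> smooth_at std_atlas A 0 c}"

text \<open>The differential at \<open>p\<close> of a map \<open>F\<close> into the manifold \<open>B\<close>.\<close>

definition differential ::
  "('b, 'f::euclidean_space) atlas \<Rightarrow> 'a \<Rightarrow> ('a \<Rightarrow> 'b) \<Rightarrow> 'a tvec \<Rightarrow> 'b tvec"
  where "differential B p F X = (\<lambda>f. if smooth_fun_at B (F p) f then X (f \<circ> F) else 0)"

text \<open>The components of \<open>v\<close> in the chart \<open>\<phi>\<close> are its values on the coordinate functions.\<close>

definition tangent_chart ::
  "'a set \<times> ('a \<Rightarrow> 'e) \<Rightarrow> ('a, 'e::euclidean_space) atlas \<Rightarrow>
   ('a \<times> 'a tvec) set \<times> ('a \<times> 'a tvec \<Rightarrow> 'e \<times> 'e)"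
  where "tangent_chart = (\<lambda>(U, \<phi>) A.
    ({(p, v). p \<in> U \<and> v \<in> tangent_space A p},
     \<lambda>(p, v). (\<phi> p, \<Sum>b\<in>Basis. v (\<lambda>q. \<phi> q \<bullet> b) *\<^sub>R b)))"

definition tangent_bundle ::
  "('a, 'e::euclidean_space) atlas \<Rightarrow> ('a \<times> 'a tvec, 'e \<times> 'e) atlas"
  where "tangent_bundle A = (\<lambda>c. tangent_chart c A) ` A"

definition vector_field ::
  "('a, 'e::euclidean_space) atlas \<Rightarrow> ('a \<Rightarrow> 'a tvec) \<Rightarrow> bool"
  where "vector_field A X \<longleftrightarrow>
    (\<forall>p\<in>carrier A. X p \<in> tangent_space A p \<and> smooth_at A (tangent_bundle A) p (\<lambda>q. (q, X q)))"

definition bracket ::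
  "('a, 'e::euclidean_space) atlas \<Rightarrow> ('a \<Rightarrow> 'a tvec) \<Rightarrow> ('a \<Rightarrow> 'a tvec) \<Rightarrow> 'a \<Rightarrow> 'a tvec"
  where "bracket A X Y p =
    (\<lambda>f. if smooth_fun_at A p f then X p (\<lambda>q. Y q f) - Y p (\<lambda>q. X q f) else 0)"

text \<open>The exterior derivative of a 1-form, normalised without the factor 1/2:
  \<open>d\<omega>(X,Y) = X(\<omega>(Y)) - Y(\<omega>(X)) - \<omega>([X,Y])\<close>.\<close>

definition ext_deriv ::
  "('a, 'e::euclidean_space) atlas \<Rightarrow> ('a \<Rightarrow> 'a tvec \<Rightarrow> real) \<Rightarrow>
   ('a \<Rightarrow> 'a tvec) \<Rightarrow> ('a \<Rightarrow> 'a tvec) \<Rightarrow> 'a \<Rightarrow> real"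
  where "ext_deriv A \<omega> X Y p =
    X p (\<lambda>q. \<omega> q (Y q)) - Y p (\<lambda>q. \<omega> q (X q)) - \<omega> p (bracket A X Y p)"


section \<open>The slit tangent bundle and the pullback bundle\<close>

type_synonym 'a tpt = "'a \<times> 'a tvec"

text \<open>The open submanifold of nonzero tangent vectors.\<close>

definition slit :: "('a, 'e::euclidean_space) atlas \<Rightarrow> ('a tpt, 'e \<times> 'e) atlas"
  where "slit M = (\<lambda>(U, \<phi>). ({u \<in> U. snd u \<noteq> 0}, \<phi>)) ` tangent_bundle M"

text \<open>A section \<open>u \<mapsto> (u, s u)\<close> of the pullback bundle is represented by \<open>s\<close>, where \<open>s u\<close> is a
  tangent vector of \<open>M\<close> at \<open>fst u\<close>; it is smooth iff \<open>u \<mapsto> (fst u, s u)\<close> is smooth as a map into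
  the tangent bundle of \<open>M\<close>. Its values off the slit tangent bundle are irrelevant.\<close>

definition pb_section ::
  "('a, 'e::euclidean_space) atlas \<Rightarrow> ('a tpt \<Rightarrow> 'a tvec) \<Rightarrow> bool"
  where "pb_section M s \<longleftrightarrow>
    (\<forall>u\<in>carrier (slit M). s u \<in> tangent_space M (fst u) \<and>
       smooth_at (slit M) (tangent_bundle M) u (\<lambda>w. (fst w, s w)))"

definition fundamental :: "'a tpt \<Rightarrow> 'a tvec"
  where "fundamental u = snd u"

definition rho ::
  "('a, 'e::euclidean_space) atlas \<Rightarrow> 'a tpt \<Rightarrow> 'a tpt tvec \<Rightarrow> 'a tvec"
  where "rho M u X = differential M u fst X"

definition gam ::
  "('a, 'e::euclidean_space) atlas \<Rightarrow> 'a tpt \<Rightarrow> 'a tvec \<Rightarrow> 'a tpt tvec"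
  where "gam M u v = velocity (slit M) (\<lambda>t. (fst u, snd u + t *\<^sub>R v))"

definition Jmap ::
  "('a, 'e::euclidean_space) atlas \<Rightarrow> 'a tpt \<Rightarrow> 'a tpt tvec \<Rightarrow> 'a tpt tvec"
  where "Jmap M u X = gam M u (rho M u X)"

definition vertical :: "('a, 'e::euclidean_space) atlas \<Rightarrow> 'a tpt \<Rightarrow> 'a tpt tvec set"
  where "vertical M u = {X \<in> tangent_space (slit M) u. rho M u X = 0}"


section \<open>Regular connections on the pullback bundle\<close>

text \<open>\<open>D u \<xi> Y\<close> is the covariant derivative at \<open>u\<close> of the section \<open>Y\<close> along the tangent vector \<open>\<xi>\<close>
  at \<open>u\<close>. By the Leibniz rule (for functions vanishing on the slit tangent bundle but not
  elsewhere) it does not depend on the irrelevant values of \<open>Y\<close>.\<close>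

type_synonym 'a conn = "'a tpt \<Rightarrow> 'a tpt tvec \<Rightarrow> ('a tpt \<Rightarrow> 'a tvec) \<Rightarrow> 'a tvec"

definition linear_connection :: "('a, 'e::euclidean_space) atlas \<Rightarrow> 'a conn \<Rightarrow> bool"
  where "linear_connection M D \<longleftrightarrow>
    (\<forall>u\<in>carrier (slit M). \<forall>\<xi>\<in>tangent_space (slit M) u.
       \<forall>Y. pb_section M Y \<longrightarrow> D u \<xi> Y \<in> tangent_space M (fst u)) \<and>
    (\<forall>u\<in>carrier (slit M). \<forall>\<xi>\<in>tangent_space (slit M) u. \<forall>\<zeta>\<in>tangent_space (slit M) u.
       \<forall>a b Y. pb_section M Y \<longrightarrow> D u (a *\<^sub>R \<xi> + b *\<^sub>R \<zeta>) Y = a *\<^sub>R D u \<xi> Y + b *\<^sub>R D u \<zeta> Y) \<and>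
    (\<forall>u\<in>carrier (slit M). \<forall>\<xi>\<in>tangent_space (slit M) u. \<forall>Y Z.
       pb_section M Y \<longrightarrow> pb_section M Z \<longrightarrow> D u \<xi> (\<lambda>w. Y w + Z w) = D u \<xi> Y + D u \<xi> Z) \<and>
    (\<forall>u\<in>carrier (slit M). \<forall>\<xi>\<in>tangent_space (slit M) u. \<forall>f Y.
       smooth_fun (slit M) f \<longrightarrow> pb_section M Y \<longrightarrow>
       D u \<xi> (\<lambda>w. f w *\<^sub>R Y w) = \<xi> f *\<^sub>R Y u + f u *\<^sub>R D u \<xi> Y) \<and>
    (\<forall>X Y. vector_field (slit M) X \<longrightarrow> pb_section M Y \<longrightarrow> pb_section M (\<lambda>u. D u (X u) Y))"

definition conn_map :: "'a conn \<Rightarrow> 'a tpt \<Rightarrow> 'a tpt tvec \<Rightarrow> 'a tvec"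
  where "conn_map D u X = D u X fundamental"

definition horizontal ::
  "('a, 'e::euclidean_space) atlas \<Rightarrow> 'a conn \<Rightarrow> 'a tpt \<Rightarrow> 'a tpt tvec set"
  where "horizontal M D u = {X \<in> tangent_space (slit M) u. conn_map D u X = 0}"

definition regular_connection :: "('a, 'e::euclidean_space) atlas \<Rightarrow> 'a conn \<Rightarrow> bool"
  where "regular_connection M D \<longleftrightarrow> linear_connection M D \<and>
    (\<forall>u\<in>carrier (slit M).
       (\<forall>X\<in>tangent_space (slit M) u. \<exists>Y\<in>vertical M u. \<exists>Z\<in>horizontal M D u. X = Y + Z) \<and>
       vertical M u \<inter> horizontal M D u = {0})"

definition beta ::
  "('a, 'e::euclidean_space) atlas \<Rightarrow> 'a conn \<Rightarrow> 'a tpt \<Rightarrow> 'a tvec \<Rightarrow> 'a tpt tvec"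
  where "beta M D u = inv_into (horizontal M D u) (rho M u)"

definition nonlinear_connection ::
  "('a, 'e::euclidean_space) atlas \<Rightarrow> 'a conn \<Rightarrow> 'a tpt \<Rightarrow> 'a tpt tvec \<Rightarrow> 'a tpt tvec"
  where "nonlinear_connection M D u X = 2 *\<^sub>R beta M D u (rho M u X) - X"

definition torsion ::
  "('a, 'e::euclidean_space) atlas \<Rightarrow> 'a conn \<Rightarrow>
   ('a tpt \<Rightarrow> 'a tpt tvec) \<Rightarrow> ('a tpt \<Rightarrow> 'a tpt tvec) \<Rightarrow> 'a tpt \<Rightarrow> 'a tvec"
  where "torsion M D X Y u =
    D u (X u) (\<lambda>w. rho M w (Y w)) - D u (Y u) (\<lambda>w. rho M w (X w))
    - rho M u (bracket (slit M) X Y u)"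

definition h_torsion ::
  "('a, 'e::euclidean_space) atlas \<Rightarrow> 'a conn \<Rightarrow>
   ('a tpt \<Rightarrow> 'a tvec) \<Rightarrow> ('a tpt \<Rightarrow> 'a tvec) \<Rightarrow> 'a tpt \<Rightarrow> 'a tvec"
  where "h_torsion M D X Y =
    torsion M D (\<lambda>w. beta M D w (X w)) (\<lambda>w. beta M D w (Y w))"

definition mixed_torsion ::
  "('a, 'e::euclidean_space) atlas \<Rightarrow> 'a conn \<Rightarrow>
   ('a tpt \<Rightarrow> 'a tvec) \<Rightarrow> ('a tpt \<Rightarrow> 'a tvec) \<Rightarrow> 'a tpt \<Rightarrow> 'a tvec"
  where "mixed_torsion M D X Y =
    torsion M D (\<lambda>w. gam M w (X w)) (\<lambda>w. beta M D w (Y w))"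


section \<open>Finsler structure, canonical spray, Barthel connection\<close>

definition energy :: "('a tpt \<Rightarrow> real) \<Rightarrow> 'a tpt \<Rightarrow> real"
  where "energy L u = (L u)\<^sup>2 / 2"

text \<open>The fibrewise Hessian of the energy at \<open>u\<close>.\<close>

definition finsler_metric :: "('a tpt \<Rightarrow> real) \<Rightarrow> 'a tpt \<Rightarrow> 'a tvec \<Rightarrow> 'a tvec \<Rightarrow> real"
  where "finsler_metric L u v w =
    deriv (\<lambda>s. deriv (\<lambda>t. energy L (fst u, snd u + s *\<^sub>R v + t *\<^sub>R w)) 0) 0"

definition finsler_manifold ::
  "('a, 'e::euclidean_space) atlas \<Rightarrow> ('a tpt \<Rightarrow> real) \<Rightarrow> bool"
  where "finsler_manifold M L \<longleftrightarrow> smooth_manifold M \<and>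
    continuous_map (mtop (tangent_bundle M)) euclideanreal L \<and>
    smooth_fun (slit M) L \<and>
    (\<forall>u\<in>carrier (slit M). L u > 0) \<and>
    (\<forall>(p, v)\<in>carrier (tangent_bundle M). \<forall>c>0. L (p, c *\<^sub>R v) = c * L (p, v)) \<and>
    (\<forall>u\<in>carrier (slit M). \<forall>v\<in>tangent_space M (fst u).
       v \<noteq> 0 \<longrightarrow> finsler_metric L u v v > 0)"

definition metric_connection ::
  "('a, 'e::euclidean_space) atlas \<Rightarrow> ('a tpt \<Rightarrow> real) \<Rightarrow> 'a conn \<Rightarrow> bool"
  where "metric_connection M L D \<longleftrightarrow>
    (\<forall>u\<in>carrier (slit M). \<forall>\<xi>\<in>tangent_space (slit M) u. \<forall>Y Z.
       pb_section M Y \<longrightarrow> pb_section M Z \<longrightarrow>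
       \<xi> (\<lambda>w. finsler_metric L w (Y w) (Z w)) =
         finsler_metric L u (D u \<xi> Y) (Z u) + finsler_metric L u (Y u) (D u \<xi> Z))"

text \<open>The 1-form \<open>d\<^sub>J E = dE \<circ> J\<close> and the 2-form \<open>\<Omega> = d(d\<^sub>J E)\<close>.\<close>

definition dJE ::
  "('a, 'e::euclidean_space) atlas \<Rightarrow> ('a tpt \<Rightarrow> real) \<Rightarrow> 'a tpt \<Rightarrow> 'a tpt tvec \<Rightarrow> real"
  where "dJE M L u X = Jmap M u X (energy L)"

definition Omega ::
  "('a, 'e::euclidean_space) atlas \<Rightarrow> ('a tpt \<Rightarrow> real) \<Rightarrow>
   ('a tpt \<Rightarrow> 'a tpt tvec) \<Rightarrow> ('a tpt \<Rightarrow> 'a tpt tvec) \<Rightarrow> 'a tpt \<Rightarrow> real"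
  where "Omega M L = ext_deriv (slit M) (dJE M L)"

definition canonical_spray ::
  "('a, 'e::euclidean_space) atlas \<Rightarrow> ('a tpt \<Rightarrow> real) \<Rightarrow> ('a tpt \<Rightarrow> 'a tpt tvec) \<Rightarrow> bool"
  where "canonical_spray M L G \<longleftrightarrow> vector_field (slit M) G \<and>
    (\<forall>X. vector_field (slit M) X \<longrightarrow>
      (\<forall>u\<in>carrier (slit M). Omega M L G X u = - X u (energy L)))"

definition barthel ::
  "('a, 'e::euclidean_space) atlas \<Rightarrow> ('a tpt \<Rightarrow> 'a tpt tvec) \<Rightarrow>
   ('a tpt \<Rightarrow> 'a tpt tvec) \<Rightarrow> 'a tpt \<Rightarrow> 'a tpt tvec"
  where "barthel M G X u =
    bracket (slit M) (\<lambda>w. Jmap M w (X w)) G u - Jmap M u (bracket (slit M) X G u)"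

end

theory Submission
  imports Defs
begin

text \<open>Write \<open>\<eta>\<close> for the fundamental section, \<open>K\<close> for the connection map, \<open>\<theta> = d\<^sub>J E\<close>, and \<open>\<nabla>\<^sub>X Y\<close> for the
derivative of the section \<open>Y\<close> along the fibres in the direction \<open>X\<close>, which makes sense because each
fibre of \<open>\<pi>\<close> is open in a vector space. Sections \<open>X, Y, Z\<close> give vector fields \<open>\<gamma>X, \<beta>Y\<close>, and all
computations are made with brackets of such fields. Two devices keep everything global. Every smooth
field that occurs is built from \<open>G\<close>, \<open>\<eta>\<close> and given sections. An equality \<open>v = w\<close> in a fibre is proved by
pairing both sides with the section \<open>v - w\<close>, since \<open>g\<close> is definite.

The Hessian formula \<open>\<gamma>X(\<gamma>Y E) = g(X,Y) + \<gamma>(\<nabla>\<^sub>X Y) E\<close> gives \<open>\<Omega>(\<gamma>X,Y) = g(X,\<rho>Y)\<close> (\<open>Omega_gam\<close>), and with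
Euler's relation \<open>g(\<eta>,X) = \<gamma>X E\<close> it yields \<open>\<rho>G = \<eta>\<close> (\<open>rho_spray\<close>). Consequently \<open>\<rho>[\<gamma>Z,G] = \<nabla>\<^sub>Z \<eta> = Z\<close>, so
\<open>[\<gamma>Z,G]\<close> is a smooth lift of the section \<open>Z\<close>.

The vector \<open>\<rho>[\<gamma>X,Y]\<close> depends on \<open>Y\<close> only through \<open>\<rho>Y\<close>. The mixed torsion is therefore
\<open>T(X,Y) = D\<^bsub>\<gamma>X\<^esub> Y - \<nabla>\<^sub>X Y\<close>, already before \<open>\<beta>\<close> is known to be smooth. For \<open>Y = \<eta>\<close> and a section \<open>Z\<close>, the metric
condition, the symmetry (c) and the Hessian formula leave \<open>2 g(T(X,\<eta>),Z) = 0\<close>. So \<open>D\<^bsub>\<gamma>X\<^esub> \<eta> = X\<close>, that is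
\<open>K \<circ> \<gamma> = id\<close> (\<open>conn_map_gam\<close>), and \<open>\<beta>\<rho>X = X - \<gamma>KX\<close> is smooth for every vector field \<open>X\<close>.

Since \<open>Q = 0\<close> and \<open>D\<^bsub>\<beta>X\<^esub> \<eta> = 0\<close>, one finds \<open>\<Omega>(\<beta>X,\<beta>Y) = g(\<eta>,Q(X,Y)) = 0\<close> and \<open>\<beta>X E = 0\<close>. Hence
\<open>\<Omega>(Y,\<beta>Z) = g(KY,Z)\<close> for every vector field \<open>Y\<close>, and the equation of the spray says \<open>KG = 0\<close>, that is
\<open>G = \<beta>\<eta>\<close> (\<open>spray_horizontal\<close>).

Finally \<open>L\<^sub>G \<theta> = dE\<close>, so \<open>L\<^sub>G \<Omega> = 0\<close> (\<open>lie_Omega\<close>). On the pair \<open>(\<gamma>X,\<beta>Z)\<close> this reads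
\<open>G g(X,Z) = g(K[G,\<gamma>X],Z) + g(X,\<rho>[G,\<beta>Z])\<close>, where \<open>\<rho>[G,\<beta>Z] = D\<^sub>G Z\<close> by \<open>Q = 0\<close>; comparison with \<open>D g = 0\<close> gives
\<open>K[G,\<gamma>X] = D\<^sub>G X\<close> (\<open>conn_map_bracket_spray_gam\<close>). Now all components of \<open>[J,G]\<close> on vertical and horizontal
fields are known, and they are those of \<open>2\<beta>\<rho> - I\<close>.

Charts serve to establish the facts used above: that brackets of vector fields are vector fields, that
\<open>\<rho>\<close> and \<open>\<gamma>\<close> preserve smoothness, and the Hessian formula. They all come down to the chain rule and the
symmetry of second derivatives.\<close>

section \<open>Germs of smooth maps\<close>

lemma Ck_on_cong:
  fixes f g :: "'a::real_normed_vector \<Rightarrow> 'b::real_normed_vector"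
  assumes "open S" "\<And>x. x \<in> S \<Longrightarrow> f x = g x" "Ck_on k S f"
  shows "Ck_on k S g"
  using assms(2,3)
proof (induction k arbitrary: f g)
  case 0
  then show ?case using continuous_on_cong[of S S f g] by simp
next
  case (Suc k)
  have d: "f differentiable (at x)" if "x \<in> S" for x
    using Suc.prems(2) that by simp
  have dg: "g differentiable (at x)" if x: "x \<in> S" for x
  proof -
    obtain D where "(f has_derivative D) (at x)" using d[OF x] by (auto simp: differentiable_def)
    then have "(g has_derivative D) (at x)"
      by (rule has_derivative_transform_within_open[OF _ assms(1) x Suc.prems(1)])
    then show ?thesis by (auto simp: differentiable_def)
  qed
  have e: "frechet_derivative f (at x) = frechet_derivative g (at x)" if "x \<in> S" for x
    by (rule frechet_derivative_transform_within_open[OF d[OF that] assms(1) that Suc.prems(1)])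
  have "Ck_on k S (\<lambda>x. frechet_derivative g (at x) v)" for v
    by (rule Suc.IH[of "\<lambda>x. frechet_derivative f (at x) v"]) (use Suc.prems(2) e in simp_all)
  with dg show ?case by simp
qed

lemma Ck_on_subset: "Ck_on k S f \<Longrightarrow> T \<subseteq> S \<Longrightarrow> Ck_on k T f"
  by (induction k arbitrary: f) (auto intro: continuous_on_subset)

lemma Ck_on_SucD: "Ck_on (Suc k) S f \<Longrightarrow> Ck_on k S f"
proof (induction k arbitrary: f)
  case 0
  then show ?case
    by (simp add: continuous_at_imp_continuous_on differentiable_imp_continuous_within)
next
  case (Suc k)
  then show ?case by (metis Ck_on.simps(2))
qed

lemma Ck_on_const: "Ck_on k S (\<lambda>x. c)"
  by (induction k arbitrary: c) auto

lemma Ck_on_bounded_linear: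
  assumes "bounded_linear f"
  shows "Ck_on k S f"
proof (cases k)
  case 0
  then show ?thesis by (simp add: assms linear_continuous_on)
next
  case (Suc j)
  have "frechet_derivative f (at x) = f" for x
    using assms bounded_linear_imp_has_derivative frechet_derivative_at by metis
  then show ?thesis
    using Suc assms by (simp add: Ck_on_const bounded_linear_imp_differentiable)
qed

lemma Ck_on_linear_comp:
  assumes L: "bounded_linear L" and S: "open S"
  shows "Ck_on k S f \<Longrightarrow> Ck_on k S (\<lambda>x. L (f x))"
proof (induction k arbitrary: f)
  case 0
  then show ?case by (simp add: L bounded_linear.continuous_on)
next
  case (Suc k)
  have h: "((\<lambda>x. L (f x)) has_derivative (\<lambda>v. L (frechet_derivative f (at x) v))) (at x)"
    if "x \<in> S" for x
    using Suc.prems that by (intro bounded_linear.has_derivative[OF L]) (simp add: frechet_derivative_works)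
  have e: "L (frechet_derivative f (at x) v) = frechet_derivative (\<lambda>x. L (f x)) (at x) v"
    if "x \<in> S" for x v
    using fun_cong[OF frechet_derivative_at[OF h[OF that]]] .
  have "Ck_on k S (\<lambda>x. frechet_derivative (\<lambda>x. L (f x)) (at x) v)" for v
    by (rule Ck_on_cong[OF S e Suc.IH]) (use Suc.prems in auto)
  then show ?case using differentiableI[OF h] by simp
qed

lemma Ck_on_add:
  assumes S: "open S"
  shows "Ck_on k S f \<Longrightarrow> Ck_on k S g \<Longrightarrow> Ck_on k S (\<lambda>x. f x + g x)"
proof (induction k arbitrary: f g)
  case 0
  then show ?case by (simp add: continuous_on_add)
next
  case (Suc k)
  have h: "((\<lambda>x. f x + g x) has_derivative
      (\<lambda>v. frechet_derivative f (at x) v + frechet_derivative g (at x) v)) (at x)"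
    if "x \<in> S" for x
    using Suc.prems that by (intro has_derivative_add) (auto simp: frechet_derivative_works)
  have e: "frechet_derivative f (at x) v + frechet_derivative g (at x) v
      = frechet_derivative (\<lambda>x. f x + g x) (at x) v" if "x \<in> S" for x v
    using fun_cong[OF frechet_derivative_at[OF h[OF that]]] .
  have "Ck_on k S (\<lambda>x. frechet_derivative (\<lambda>x. f x + g x) (at x) v)" for v
    by (rule Ck_on_cong[OF S e Suc.IH]) (use Suc.prems in auto)
  then show ?case using differentiableI[OF h] by simp
qed

lemma Ck_on_bilinear:
  assumes B: "bounded_bilinear prd" and S: "open S"
  shows "Ck_on k S f \<Longrightarrow> Ck_on k S g \<Longrightarrow> Ck_on k S (\<lambda>x. prd (f x) (g x))"
proof (induction k arbitrary: f g)
  case 0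
  then show ?case by (simp add: B bounded_bilinear.continuous_on)
next
  case (Suc k)
  have h: "((\<lambda>x. prd (f x) (g x)) has_derivative
      (\<lambda>v. prd (f x) (frechet_derivative g (at x) v) + prd (frechet_derivative f (at x) v) (g x))) (at x)"
    if "x \<in> S" for x
    using Suc.prems that
    by (intro bounded_bilinear.FDERIV[OF B]) (auto simp: frechet_derivative_works)
  have e: "prd (f x) (frechet_derivative g (at x) v) + prd (frechet_derivative f (at x) v) (g x)
      = frechet_derivative (\<lambda>x. prd (f x) (g x)) (at x) v" if "x \<in> S" for x v
    using fun_cong[OF frechet_derivative_at[OF h[OF that]]] .
  have "Ck_on k S (\<lambda>x. frechet_derivative (\<lambda>x. prd (f x) (g x)) (at x) v)" for v
    by (rule Ck_on_cong[OF S e Ck_on_add[OF S Suc.IH Suc.IH]])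
       (use Suc.prems Ck_on_SucD in auto)
  then show ?case using differentiableI[OF h] by simp
qed

lemma Ck_on_sum:
  assumes "open S" "\<And>i. i \<in> I \<Longrightarrow> Ck_on k S (f i)"
  shows "Ck_on k S (\<lambda>x. \<Sum>i\<in>I. f i x)"
  using assms(2) by (induction I rule: infinite_finite_induct) (auto intro: Ck_on_const Ck_on_add assms(1))

lemma linear_Basis_expansion:
  fixes f :: "'a::euclidean_space \<Rightarrow> 'b::real_vector"
  assumes "linear f"
  shows "f y = (\<Sum>b\<in>Basis. (y \<bullet> b) *\<^sub>R f b)"
proof -
  have "f y = f (\<Sum>b\<in>Basis. (y \<bullet> b) *\<^sub>R b)" by (simp add: euclidean_representation)
  also have "\<dots> = (\<Sum>b\<in>Basis. (y \<bullet> b) *\<^sub>R f b)"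
    by (simp add: linear_sum[OF assms] linear_cmul[OF assms])
  finally show ?thesis .
qed

text \<open>By the chain rule, expanded in a basis, a directional derivative of \<open>g \<circ> f\<close> is a sum of products of
derivatives of \<open>f\<close> with derivatives of \<open>g\<close> taken at \<open>f x\<close>, to which the induction hypothesis applies.\<close>

lemma Ck_on_compose:
  fixes f :: "'a::real_normed_vector \<Rightarrow> 'b::euclidean_space"
    and g :: "'b \<Rightarrow> 'c::real_normed_vector"
  assumes S: "open S" and T: "open T" and sub: "f ` S \<subseteq> T"
  shows "Ck_on k S f \<Longrightarrow> Ck_on k T g \<Longrightarrow> Ck_on k S (\<lambda>x. g (f x))"
proof (induction k arbitrary: g)
  case 0
  then show ?case using continuous_on_compose2[of T g S f] sub by simp
next
  case (Suc k)
  let ?D = "\<lambda>x v. \<Sum>b\<in>Basis. (frechet_derivative f (at x) v \<bullet> b) *\<^sub>R frechet_derivative g (at (f x)) b"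
  have h: "((\<lambda>x. g (f x)) has_derivative (\<lambda>v. ?D x v)) (at x)" if x: "x \<in> S" for x
  proof -
    have df: "(f has_derivative frechet_derivative f (at x)) (at x)"
      using Suc.prems x by (simp add: frechet_derivative_works)
    have g: "g differentiable (at (f x))" using Suc.prems x sub by auto
    then have dg: "(g has_derivative frechet_derivative g (at (f x))) (at (f x))"
      by (simp add: frechet_derivative_works)
    have "((\<lambda>x. g (f x)) has_derivative (\<lambda>v. frechet_derivative g (at (f x)) (frechet_derivative f (at x) v))) (at x)"
      using diff_chain_at[OF df dg] by (simp add: o_def)
    moreover have "(\<lambda>v. frechet_derivative g (at (f x)) (frechet_derivative f (at x) v)) = ?D x"
      by (rule ext, rule linear_Basis_expansion[OF linear_frechet_derivative[OF g]])
    ultimately show ?thesis by simp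
  qed
  have e: "?D x v = frechet_derivative (\<lambda>x. g (f x)) (at x) v" if "x \<in> S" for x v
    using fun_cong[OF frechet_derivative_at[OF h[OF that]]] .
  have c: "Ck_on k S (\<lambda>x. ?D x v)" for v
  proof (rule Ck_on_sum[OF S], rule Ck_on_bilinear[OF bounded_bilinear_scaleR S])
    fix b :: 'b
    show "Ck_on k S (\<lambda>x. frechet_derivative f (at x) v \<bullet> b)"
      by (rule Ck_on_linear_comp[OF bounded_linear_inner_left S]) (use Suc.prems in simp)
    show "Ck_on k S (\<lambda>x. frechet_derivative g (at (f x)) b)"
      by (rule Suc.IH) (use Suc.prems Ck_on_SucD in auto)
  qed
  have "Ck_on k S (\<lambda>x. frechet_derivative (\<lambda>x. g (f x)) (at x) v)" for v
    by (rule Ck_on_cong[OF S e c])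
  then show ?case using differentiableI[OF h] by simp
qed

text \<open>Local statements in charts are made about germs: then no domains have to be tracked for
chart inverses, sections or vector fields.\<close>

definition smooth_near :: "'a::real_normed_vector \<Rightarrow> ('a \<Rightarrow> 'b::real_normed_vector) \<Rightarrow> bool"
  where "smooth_near x f \<longleftrightarrow> (\<exists>S. open S \<and> x \<in> S \<and> smooth_on S f)"

lemma smooth_on_subset: "smooth_on S f \<Longrightarrow> T \<subseteq> S \<Longrightarrow> smooth_on T f"
  by (auto simp: smooth_on_def intro: Ck_on_subset)

lemma smooth_near_cong:
  assumes "eventually (\<lambda>y. f y = g y) (nhds x)" "smooth_near x f"
  shows "smooth_near x g"
proof -
  obtain S T where "open S" "x \<in> S" "smooth_on S f" "open T" "x \<in> T" "\<And>y. y \<in> T \<Longrightarrow> f y = g y"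
    using assms by (auto simp: smooth_near_def eventually_nhds)
  then have "open (S \<inter> T)" "x \<in> S \<inter> T" "smooth_on (S \<inter> T) g"
    by (auto simp: smooth_on_def intro: Ck_on_cong[of _ f] Ck_on_subset)
  then show ?thesis unfolding smooth_near_def by blast
qed

lemma smooth_near_eventually: "smooth_near x f \<Longrightarrow> eventually (\<lambda>y. smooth_near y f) (nhds x)"
  unfolding smooth_near_def eventually_nhds by blast

lemma smooth_near_binary:
  assumes "smooth_near x f" "smooth_near x g"
    and "\<And>S k. open S \<Longrightarrow> Ck_on k S f \<Longrightarrow> Ck_on k S g \<Longrightarrow> Ck_on k S h"
  shows "smooth_near x h"
proof -
  obtain S T where "open S" "x \<in> S" "smooth_on S f" "open T" "x \<in> T" "smooth_on T g"
    using assms by (auto simp: smooth_near_def)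
  then have "open (S \<inter> T)" "x \<in> S \<inter> T" "smooth_on (S \<inter> T) h"
    by (auto simp: smooth_on_def intro!: assms(3) intro: Ck_on_subset)
  then show ?thesis unfolding smooth_near_def by blast
qed

lemma smooth_near_const [simp]: "smooth_near x (\<lambda>y. c)"
  unfolding smooth_near_def smooth_on_def using Ck_on_const by blast

lemma smooth_near_bounded_linear: "bounded_linear f \<Longrightarrow> smooth_near x f"
  unfolding smooth_near_def smooth_on_def using Ck_on_bounded_linear by blast

lemma smooth_near_linear_comp:
  assumes "bounded_linear L" "smooth_near x f"
  shows "smooth_near x (\<lambda>y. L (f y))"
  by (rule smooth_near_binary[OF assms(2,2)]) (auto intro: Ck_on_linear_comp[OF assms(1)])

lemma smooth_near_add: "smooth_near x f \<Longrightarrow> smooth_near x g \<Longrightarrow> smooth_near x (\<lambda>y. f y + g y)"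
  by (erule (1) smooth_near_binary) (rule Ck_on_add)

lemma smooth_near_bilinear:
  "bounded_bilinear prd \<Longrightarrow> smooth_near x f \<Longrightarrow> smooth_near x g \<Longrightarrow> smooth_near x (\<lambda>y. prd (f y) (g y))"
  by (rule smooth_near_binary[of x f g]) (auto intro: Ck_on_bilinear)

lemmas smooth_near_scaleR = smooth_near_bilinear[OF bounded_bilinear_scaleR]

lemma smooth_near_sum:
  assumes "\<And>i. i \<in> I \<Longrightarrow> smooth_near x (f i)"
  shows "smooth_near x (\<lambda>y. \<Sum>i\<in>I. f i y)"
  using assms by (induction I rule: infinite_finite_induct) (auto intro: smooth_near_add)

lemma smooth_near_Pair:
  assumes "smooth_near x f" "smooth_near x g"
  shows "smooth_near x (\<lambda>y. (f y, g y))"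
proof -
  have a: "bounded_linear (\<lambda>a. (a, 0))" "bounded_linear (\<lambda>a. (0, a))"
    by (intro bounded_linear_Pair bounded_linear_ident bounded_linear_zero)+
  have "smooth_near x (\<lambda>y. (f y, 0) + (0, g y))"
    by (rule smooth_near_add; rule smooth_near_linear_comp) (use a assms in auto)
  then show ?thesis by simp
qed

lemma smooth_near_differentiable: "smooth_near x f \<Longrightarrow> f differentiable (at x)"
  unfolding smooth_near_def smooth_on_def by (metis Ck_on.simps(2))

lemma smooth_near_isCont: "smooth_near x f \<Longrightarrow> isCont f x"
  by (simp add: smooth_near_differentiable differentiable_imp_continuous_within)

lemma smooth_near_filterlim:
  assumes "smooth_near x f"
  shows "filterlim f (nhds (f x)) (nhds x)"
  using smooth_near_isCont[OF assms] tendsto_at_iff_tendsto_nhds[of f x] by (simp add: isCont_def)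

lemma smooth_near_compose:
  fixes f :: "'a::real_normed_vector \<Rightarrow> 'b::euclidean_space"
    and g :: "'b \<Rightarrow> 'c::real_normed_vector"
  assumes "smooth_near x f" "smooth_near (f x) g"
  shows "smooth_near x (\<lambda>y. g (f y))"
proof -
  obtain S T where S: "open S" "x \<in> S" "smooth_on S f" and T: "open T" "f x \<in> T" "smooth_on T g"
    using assms by (auto simp: smooth_near_def)
  let ?R = "f -` T \<inter> S"
  have c: "continuous_on S f" using S(3) unfolding smooth_on_def by (metis Ck_on.simps(1))
  have o: "open ?R" using continuous_open_preimage[OF c S(1) T(1)] by (simp add: Int_commute)
  have "Ck_on k ?R (\<lambda>y. g (f y))" for k
    by (rule Ck_on_compose[OF o T(1)])
       (use S(3) T(3) in \<open>auto simp: smooth_on_def intro: Ck_on_subset\<close>)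
  then show ?thesis using o S(2) T(2) unfolding smooth_near_def smooth_on_def by blast
qed

lemma smooth_near_frechet_derivative:
  "smooth_near x f \<Longrightarrow> smooth_near x (\<lambda>y. frechet_derivative f (at y) v)"
  unfolding smooth_near_def smooth_on_def by (metis Ck_on.simps(2))

lemma smooth_on_iff_smooth_near:
  assumes "open S"
  shows "smooth_on S f \<longleftrightarrow> (\<forall>x\<in>S. smooth_near x f)"
proof
  assume "smooth_on S f"
  then show "\<forall>x\<in>S. smooth_near x f" using assms by (auto simp: smooth_near_def)
next
  have "Ck_on k S f" if "\<forall>x\<in>S. smooth_near x f" for k
    using that
  proof (induction k arbitrary: f)
    case 0
    then show ?case by (simp add: continuous_at_imp_continuous_on smooth_near_isCont)
  next
    case (Suc k)
    then show ?case by (simp add: smooth_near_differentiable smooth_near_frechet_derivative)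
  qed
  then show "\<forall>x\<in>S. smooth_near x f \<Longrightarrow> smooth_on S f" by (simp add: smooth_on_def)
qed

lemma frechet_derivative_eq:
  "(f has_derivative f') (at x) \<Longrightarrow> frechet_derivative f (at x) = f'"
  using frechet_derivative_at by metis

lemma frechet_derivative_eventually_cong:
  assumes "f differentiable (at x)" "eventually (\<lambda>y. f y = g y) (nhds x)"
  shows "frechet_derivative f (at x) = frechet_derivative g (at x)"
  using assms frechet_derivative_transform_within_open unfolding eventually_nhds by metis

text \<open>In charts a section \<open>k\<close> of tangent vectors along a map \<open>h\<close> acts on a function \<open>f\<close> as
\<open>z \<mapsto> Df(h z)(k z)\<close>; expanding \<open>k z\<close> in a basis reduces this to products and compositions.\<close>

lemma smooth_near_derivative_along:
  fixes f :: "'b::euclidean_space \<Rightarrow> 'c::real_normed_vector"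
    and h k :: "'a::real_normed_vector \<Rightarrow> 'b"
  assumes h: "smooth_near x h" and k: "smooth_near x k" and f: "smooth_near (h x) f"
  shows "smooth_near x (\<lambda>z. frechet_derivative f (at (h z)) (k z))"
proof (rule smooth_near_cong)
  show "smooth_near x (\<lambda>z. \<Sum>b\<in>Basis. (k z \<bullet> b) *\<^sub>R frechet_derivative f (at (h z)) b)"
    by (intro smooth_near_sum smooth_near_scaleR smooth_near_linear_comp[OF bounded_linear_inner_left k]
        smooth_near_compose[OF h, of "\<lambda>y. frechet_derivative f (at y) _"] smooth_near_frechet_derivative f)
  have "eventually (\<lambda>z. smooth_near (h z) f) (nhds x)"
    using eventually_compose_filterlim[OF smooth_near_eventually[OF f]]
      smooth_near_isCont[OF h] by (simp add: isCont_def tendsto_at_iff_tendsto_nhds)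
  then show "\<forall>\<^sub>F z in nhds x. (\<Sum>b\<in>Basis. (k z \<bullet> b) *\<^sub>R frechet_derivative f (at (h z)) b)
      = frechet_derivative f (at (h z)) (k z)"
    by eventually_elim
       (rule linear_Basis_expansion[OF linear_frechet_derivative[OF smooth_near_differentiable], symmetric])
qed

section \<open>Second derivatives\<close>

lemma has_real_derivative_along_line:
  assumes "f differentiable (at (a + t *\<^sub>R w))"
  shows "((\<lambda>s. f (a + s *\<^sub>R w)) has_real_derivative frechet_derivative f (at (a + t *\<^sub>R w)) w) (at t)"
proof -
  have l: "((\<lambda>s. a + s *\<^sub>R w) has_derivative (\<lambda>s. s *\<^sub>R w)) (at t)"
    by (auto intro!: derivative_eq_intros)
  have d: "(f has_derivative frechet_derivative f (at (a + t *\<^sub>R w))) (at (a + t *\<^sub>R w))"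
    using assms by (simp add: frechet_derivative_works)
  have "linear (frechet_derivative f (at (a + t *\<^sub>R w)))"
    using assms by (rule linear_frechet_derivative)
  then show ?thesis
    using diff_chain_at[OF l d] by (simp add: has_field_derivative_def o_def linear_cmul mult.commute[of _ "frechet_derivative _ _ _"])
qed

lemma has_real_derivative_along_line_0:
  assumes "f differentiable (at a)"
  shows "((\<lambda>s. f (a + s *\<^sub>R w)) has_real_derivative frechet_derivative f (at a) w) (at 0)"
  using has_real_derivative_along_line[of f a 0 w] assms by simp

text \<open>The second difference is symmetric in \<open>v\<close> and \<open>w\<close>, while the mean value theorem, applied first in
direction \<open>v\<close> and then in direction \<open>w\<close>, turns it into an iterated derivative near \<open>x\<close>.\<close>

lemma second_difference_mean_value:
  fixes f :: "'a::real_normed_vector \<Rightarrow> real"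
  assumes S: "ball x d \<subseteq> S" and f: "Ck_on 2 S f"
    and h: "h > 0" and hd: "h * (norm v + norm w) < d"
  shows "\<exists>z\<in>ball x d. f (x + h *\<^sub>R v + h *\<^sub>R w) - f (x + h *\<^sub>R v) - f (x + h *\<^sub>R w) + f x
      = h * h * frechet_derivative (\<lambda>z. frechet_derivative f (at z) v) (at z) w"
proof -
  have inb: "x + s *\<^sub>R v + t *\<^sub>R w \<in> ball x d" if "0 \<le> s" "s \<le> h" "0 \<le> t" "t \<le> h" for s t
  proof -
    have "norm (s *\<^sub>R v + t *\<^sub>R w) \<le> s * norm v + t * norm w"
      using that norm_triangle_ineq[of "s *\<^sub>R v" "t *\<^sub>R w"] by simp
    also have "\<dots> \<le> h * norm v + h * norm w"
      using that by (intro add_mono mult_right_mono) auto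
    also have "\<dots> < d" using hd by (simp add: distrib_left)
    finally show ?thesis by (simp add: dist_norm norm_minus_commute algebra_simps)
  qed
  have d1: "f differentiable (at z)" if "z \<in> ball x d" for z
    using f S that by (auto simp: numeral_2_eq_2)
  have d2: "(\<lambda>z. frechet_derivative f (at z) v) differentiable (at z)" if "z \<in> ball x d" for z
    using f S that by (auto simp: numeral_2_eq_2)
  let ?p = "\<lambda>s. f ((x + h *\<^sub>R w) + s *\<^sub>R v) - f (x + s *\<^sub>R v)"
  let ?p' = "\<lambda>s. frechet_derivative f (at ((x + h *\<^sub>R w) + s *\<^sub>R v)) v - frechet_derivative f (at (x + s *\<^sub>R v)) v"
  have "(?p has_real_derivative ?p' s) (at s)" if s: "0 \<le> s" "s \<le> h" for s
  proof (intro DERIV_diff has_real_derivative_along_line d1)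
    show "x + h *\<^sub>R w + s *\<^sub>R v \<in> ball x d" using inb[of s h] s h by (simp add: algebra_simps)
    show "x + s *\<^sub>R v \<in> ball x d" using inb[of s 0] s h by simp
  qed
  then obtain s where s: "0 < s" "s < h" "?p h - ?p 0 = (h - 0) * ?p' s"
    using MVT2[OF h, of ?p ?p'] by blast
  let ?q = "\<lambda>t. frechet_derivative f (at ((x + s *\<^sub>R v) + t *\<^sub>R w)) v"
  let ?q' = "\<lambda>t. frechet_derivative (\<lambda>z. frechet_derivative f (at z) v) (at ((x + s *\<^sub>R v) + t *\<^sub>R w)) w"
  have "(?q has_real_derivative ?q' t) (at t)" if t: "0 \<le> t" "t \<le> h" for t
    by (intro has_real_derivative_along_line[of "\<lambda>z. frechet_derivative f (at z) v"] d2 inb) (use t s in auto)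
  then obtain t where t: "0 < t" "t < h" "?q h - ?q 0 = (h - 0) * ?q' t"
    using MVT2[OF h, of ?q ?q'] by blast
  have "?p' s = ?q h - ?q 0" by (simp add: add_ac)
  then have "?p h - ?p 0 = h * h * ?q' t" using s(3) t(3) by simp
  moreover have "?p h - ?p 0 = f (x + h *\<^sub>R v + h *\<^sub>R w) - f (x + h *\<^sub>R v) - f (x + h *\<^sub>R w) + f x"
    by (simp add: add_ac)
  ultimately show ?thesis using inb[of s t] s t by (intro bexI[of _ "x + s *\<^sub>R v + t *\<^sub>R w"]) auto
qed

text \<open>The second difference divided by \<open>h\<^sup>2\<close> is a value of either iterated derivative at a point close to
\<open>x\<close>; both derivatives are continuous, so they agree at \<open>x\<close>.\<close>

lemma second_derivative_symmetric:
  fixes f :: "'a::real_normed_vector \<Rightarrow> real"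
  assumes f: "smooth_near x f"
  shows "frechet_derivative (\<lambda>z. frechet_derivative f (at z) v) (at x) w
       = frechet_derivative (\<lambda>z. frechet_derivative f (at z) w) (at x) v"
proof (rule ccontr)
  define p where "p = (\<lambda>z. frechet_derivative (\<lambda>z. frechet_derivative f (at z) v) (at z) w)"
  define q where "q = (\<lambda>z. frechet_derivative (\<lambda>z. frechet_derivative f (at z) w) (at z) v)"
  assume "\<not> ?thesis"
  then have e: "\<bar>p x - q x\<bar> > 0" by (simp add: p_def q_def)
  have "isCont p x" "isCont q x"
    unfolding p_def q_def by (intro smooth_near_isCont smooth_near_frechet_derivative f)+
  then have c: "\<forall>e>0. \<exists>d>0. \<forall>z. dist z x < d \<longrightarrow> dist (p z) (p x) < e"
    "\<forall>e>0. \<exists>d>0. \<forall>z. dist z x < d \<longrightarrow> dist (q z) (q x) < e"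
    unfolding continuous_at_eps_delta by auto
  have e2: "\<bar>p x - q x\<bar> / 2 > 0" using e by simp
  obtain d1 d2 where d: "d1 > 0" "d2 > 0"
    "\<And>z. dist z x < d1 \<Longrightarrow> \<bar>p z - p x\<bar> < \<bar>p x - q x\<bar> / 2"
    "\<And>z. dist z x < d2 \<Longrightarrow> \<bar>q z - q x\<bar> < \<bar>p x - q x\<bar> / 2"
    using c(1)[rule_format, OF e2] c(2)[rule_format, OF e2] unfolding dist_real_def by blast
  obtain S where S: "open S" "x \<in> S" "smooth_on S f" using f by (auto simp: smooth_near_def)
  then obtain d0 where d0: "d0 > 0" "ball x d0 \<subseteq> S" by (meson open_contains_ball)
  define d where "d = min d0 (min d1 d2)"
  have dpos: "d > 0" and bS: "ball x d \<subseteq> S" using d0 d by (auto simp: d_def)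
  \<comment> \<open>small enough for the second difference to stay in the ball of radius \<open>d\<close>; the summand 1 excludes
    a zero denominator\<close>
  define h where "h = d / (2 * (norm v + norm w + 1))"
  have n: "norm v + norm w + 1 > 0" by (smt (verit) norm_ge_zero)
  have h: "h > 0" using dpos n by (simp add: h_def)
  have "h * (norm v + norm w) < h * (2 * (norm v + norm w + 1))"
    using h n by (intro mult_strict_left_mono) (auto simp: add_pos_nonneg)
  then have hd: "h * (norm v + norm w) < d" using n by (simp add: h_def)
  have C: "Ck_on 2 S f" using S by (simp add: smooth_on_def)
  obtain z1 where z1: "z1 \<in> ball x d"
    "f (x + h *\<^sub>R v + h *\<^sub>R w) - f (x + h *\<^sub>R v) - f (x + h *\<^sub>R w) + f x = h * h * p z1"
    using second_difference_mean_value[OF bS C h hd] unfolding p_def by blast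
  have hd': "h * (norm w + norm v) < d" using hd by (simp add: add.commute)
  obtain z2 where z2: "z2 \<in> ball x d"
    "f (x + h *\<^sub>R w + h *\<^sub>R v) - f (x + h *\<^sub>R w) - f (x + h *\<^sub>R v) + f x = h * h * q z2"
    using second_difference_mean_value[OF bS C h hd'] unfolding q_def by blast
  have "f (x + h *\<^sub>R w + h *\<^sub>R v) = f (x + h *\<^sub>R v + h *\<^sub>R w)" by (simp add: add_ac)
  then have "h * h * p z1 = h * h * q z2" using z1(2) z2(2) by linarith
  then have "p z1 = q z2" using h by simp
  moreover have "\<bar>p z1 - p x\<bar> < \<bar>p x - q x\<bar> / 2" "\<bar>q z2 - q x\<bar> < \<bar>p x - q x\<bar> / 2"
    using z1(1) z2(1) d by (auto simp: d_def dist_commute)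
  ultimately show False by (smt (verit) field_sum_of_halves)
qed

text \<open>The Leibniz rule behind both the Lie bracket and the Hessian formula: differentiating
\<open>Df(z)(k z)\<close> gives a second derivative of \<open>f\<close> plus the derivative of \<open>f\<close> along the derivative of \<open>k\<close>.\<close>

lemma derivative_of_derivative_along:
  fixes f :: "'a::euclidean_space \<Rightarrow> real"
  assumes f: "smooth_near x f" and k: "smooth_near x k"
  shows "frechet_derivative (\<lambda>z. frechet_derivative f (at z) (k z)) (at x) a
    = frechet_derivative (\<lambda>z. frechet_derivative f (at z) (k x)) (at x) a
      + frechet_derivative f (at x) (frechet_derivative k (at x) a)"
proof -
  let ?f = "\<lambda>b z. frechet_derivative f (at z) b"
  let ?k = "frechet_derivative k (at x)"
  have lf: "linear (frechet_derivative f (at z))" if "smooth_near z f" for z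
    by (intro linear_frechet_derivative smooth_near_differentiable that)
  have exp: "\<forall>\<^sub>F z in nhds x. (\<Sum>b\<in>Basis. (c \<bullet> b) *\<^sub>R ?f b z) = ?f c z" for c
    using smooth_near_eventually[OF f] by eventually_elim (rule linear_Basis_expansion[OF lf, symmetric])
  have expk: "\<forall>\<^sub>F z in nhds x. (\<Sum>b\<in>Basis. (k z \<bullet> b) *\<^sub>R ?f b z) = ?f (k z) z"
    using smooth_near_eventually[OF f] by eventually_elim (rule linear_Basis_expansion[OF lf, symmetric])
  have df: "(?f b has_derivative frechet_derivative (?f b) (at x)) (at x)" for b
    using smooth_near_differentiable[OF smooth_near_frechet_derivative[OF f]]
    by (simp add: frechet_derivative_works)
  have dk: "(k has_derivative ?k) (at x)"
    using smooth_near_differentiable[OF k] by (simp add: frechet_derivative_works)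
  have d1: "((\<lambda>z. \<Sum>b\<in>Basis. (k z \<bullet> b) *\<^sub>R ?f b z) has_derivative
     (\<lambda>a. \<Sum>b\<in>Basis. (k x \<bullet> b) *\<^sub>R frechet_derivative (?f b) (at x) a + (?k a \<bullet> b) *\<^sub>R ?f b x)) (at x)"
    by (intro has_derivative_sum has_derivative_scaleR df has_derivative_inner_left dk)
  have d2: "((\<lambda>z. \<Sum>b\<in>Basis. (c \<bullet> b) *\<^sub>R ?f b z) has_derivative
     (\<lambda>a. \<Sum>b\<in>Basis. (c \<bullet> b) *\<^sub>R frechet_derivative (?f b) (at x) a)) (at x)" for c
    by (intro has_derivative_sum has_derivative_scaleR_right df)
  have "frechet_derivative (\<lambda>z. ?f (k z) z) (at x) a
      = frechet_derivative (\<lambda>z. \<Sum>b\<in>Basis. (k z \<bullet> b) *\<^sub>R ?f b z) (at x) a"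
    using frechet_derivative_eventually_cong[OF differentiableI[OF d1] expk] by simp
  also have "\<dots> = (\<Sum>b\<in>Basis. (k x \<bullet> b) *\<^sub>R frechet_derivative (?f b) (at x) a)
      + (\<Sum>b\<in>Basis. (?k a \<bullet> b) *\<^sub>R ?f b x)"
    unfolding frechet_derivative_eq[OF d1] by (rule sum.distrib)
  also have "(\<Sum>b\<in>Basis. (?k a \<bullet> b) *\<^sub>R ?f b x) = ?f (?k a) x"
    by (rule linear_Basis_expansion[OF lf[OF f], symmetric])
  also have "(\<Sum>b\<in>Basis. (k x \<bullet> b) *\<^sub>R frechet_derivative (?f b) (at x) a)
      = frechet_derivative (\<lambda>z. \<Sum>b\<in>Basis. (k x \<bullet> b) *\<^sub>R ?f b z) (at x) a"
    unfolding frechet_derivative_eq[OF d2] ..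
  also have "\<dots> = frechet_derivative (\<lambda>z. ?f (k x) z) (at x) a"
    using frechet_derivative_eventually_cong[OF differentiableI[OF d2] exp] by simp
  finally show ?thesis .
qed

section \<open>Charts and smooth maps\<close>

lemma atlas_chart_inj: "smooth_atlas A \<Longrightarrow> (U, \<phi>) \<in> A \<Longrightarrow> inj_on \<phi> U"
  and atlas_chart_open: "smooth_atlas A \<Longrightarrow> (U, \<phi>) \<in> A \<Longrightarrow> open (\<phi> ` U)"
  unfolding smooth_atlas_def by blast+

lemma atlas_transition:
  assumes "smooth_atlas A" "(U, \<phi>) \<in> A" "(V, \<psi>) \<in> A"
  shows "open (\<phi> ` (U \<inter> V))" "smooth_on (\<phi> ` (U \<inter> V)) (\<lambda>z. \<psi> (inv_into U \<phi> z))"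
  using assms unfolding smooth_atlas_def o_def by blast+

lemma smooth_near_transition:
  assumes "smooth_atlas A" "(U, \<phi>) \<in> A" "(V, \<psi>) \<in> A" "p \<in> U" "p \<in> V"
  shows "smooth_near (\<phi> p) (\<lambda>z. \<psi> (inv_into U \<phi> z))"
  unfolding smooth_near_def
  using atlas_transition[OF assms(1-3)] assms(4,5) by blast

lemma chart_inverse:
  assumes "smooth_atlas A" "(U, \<phi>) \<in> A"
  shows "p \<in> U \<Longrightarrow> inv_into U \<phi> (\<phi> p) = p"
    and "z \<in> \<phi> ` U \<Longrightarrow> \<phi> (inv_into U \<phi> z) = z"
    and "z \<in> \<phi> ` U \<Longrightarrow> inv_into U \<phi> z \<in> U"
  using inv_into_f_f[OF atlas_chart_inj[OF assms]] by (auto simp: f_inv_into_f inv_into_into)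

lemma carrier_iff: "p \<in> carrier A \<longleftrightarrow> (\<exists>U \<phi>. (U, \<phi>) \<in> A \<and> p \<in> U)"
  by (auto simp: carrier_def)

lemma openin_chart_preimage:
  assumes A: "smooth_atlas A" and U: "(U, \<phi>) \<in> A" and T: "open T"
  shows "openin (mtop A) {q \<in> U. \<phi> q \<in> T}"
  unfolding openin_mtop[OF A] open_in_atlas_def
proof (intro conjI, use U in \<open>force simp: carrier_def\<close>, clarify)
  fix V \<psi> assume V: "(V, \<psi>) \<in> A"
  note t = atlas_transition[OF A V U]
  have "continuous_on (\<psi> ` (V \<inter> U)) (\<lambda>z. \<phi> (inv_into V \<psi> z))"
    using t(2) unfolding smooth_on_def by (metis Ck_on.simps(1))
  then have "open (\<psi> ` (V \<inter> U) \<inter> (\<lambda>z. \<phi> (inv_into V \<psi> z)) -` T)"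
    using t(1) T by (rule continuous_open_preimage)
  moreover have "\<psi> ` (V \<inter> U) \<inter> (\<lambda>z. \<phi> (inv_into V \<psi> z)) -` T = \<psi> ` (V \<inter> {q \<in> U. \<phi> q \<in> T})"
    using chart_inverse(1)[OF A V] by force
  ultimately show "open (\<psi> ` (V \<inter> {q \<in> U. \<phi> q \<in> T}))" by simp
qed

lemma topspace_mtop:
  assumes A: "smooth_atlas A"
  shows "topspace (mtop A) = carrier A"
proof
  show "topspace (mtop A) \<subseteq> carrier A"
    using openin_topspace[of "mtop A"] unfolding openin_mtop[OF A] open_in_atlas_def by blast
  show "carrier A \<subseteq> topspace (mtop A)"
  proof
    fix p assume "p \<in> carrier A"
    then obtain U \<phi> where U: "(U, \<phi>) \<in> A" "p \<in> U" by (auto simp: carrier_iff)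
    then show "p \<in> topspace (mtop A)"
      using openin_chart_preimage[OF A U(1) open_UNIV] by (auto dest: openin_subset)
  qed
qed

lemma eventually_nhds_chart_range:
  assumes "smooth_atlas A" "(U, \<phi>) \<in> A" "p \<in> U"
  shows "\<forall>\<^sub>F z in nhds (\<phi> p). z \<in> \<phi> ` U"
  using atlas_chart_open[OF assms(1,2)] assms(3) by (auto intro: eventually_nhds_in_open)

text \<open>Neighbourhoods in the manifold topology are the neighbourhoods seen in any one chart.\<close>

lemma eventually_nhdsin_chart:
  assumes A: "smooth_atlas A" and U: "(U, \<phi>) \<in> A" "p \<in> U"
  shows "eventually P (nhdsin (mtop A) p) \<longleftrightarrow> (\<forall>\<^sub>F z in nhds (\<phi> p). P (inv_into U \<phi> z))"
proof
  assume "eventually P (nhdsin (mtop A) p)"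
  then obtain S where S: "openin (mtop A) S" "p \<in> S" "\<forall>q\<in>S. P q"
    using U unfolding eventually_nhdsin topspace_mtop[OF A] by (auto simp: carrier_iff)
  have "open (\<phi> ` (U \<inter> S))"
    using S(1) U(1) unfolding openin_mtop[OF A] open_in_atlas_def by auto
  moreover have "\<phi> p \<in> \<phi> ` (U \<inter> S)" using U S by auto
  moreover have "\<forall>z\<in>\<phi> ` (U \<inter> S). P (inv_into U \<phi> z)"
    using S(3) chart_inverse(1)[OF A U(1)] by auto
  ultimately show "\<forall>\<^sub>F z in nhds (\<phi> p). P (inv_into U \<phi> z)"
    unfolding eventually_nhds by blast
next
  assume "\<forall>\<^sub>F z in nhds (\<phi> p). P (inv_into U \<phi> z)"
  then obtain T where T: "open T" "\<phi> p \<in> T" "\<forall>z\<in>T. P (inv_into U \<phi> z)"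
    unfolding eventually_nhds by blast
  have "\<forall>q\<in>{q \<in> U. \<phi> q \<in> T}. P q"
    using T(3) chart_inverse(1)[OF A U(1)] by force
  then show "eventually P (nhdsin (mtop A) p)"
    unfolding eventually_nhdsin using openin_chart_preimage[OF A U(1) T(1)] U(2) T(2) by blast
qed

lemma eventually_nhdsin_openin:
  "openin X S \<Longrightarrow> p \<in> S \<Longrightarrow> eventually (\<lambda>q. q \<in> S) (nhdsin X p)"
  unfolding eventually_nhdsin by blast

lemma eventually_nhdsin_in_chart:
  assumes "smooth_atlas A" "(U, \<phi>) \<in> A" "p \<in> U"
  shows "eventually (\<lambda>q. q \<in> U) (nhdsin (mtop A) p)"
  using openin_chart_preimage[OF assms(1,2) open_UNIV] assms(3)
  by (auto intro: eventually_nhdsin_openin)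

lemma eventually_nhdsin_self:
  "smooth_atlas A \<Longrightarrow> p \<in> carrier A \<Longrightarrow> eventually P (nhdsin (mtop A) p) \<Longrightarrow> P p"
  unfolding eventually_nhdsin topspace_mtop by blast

lemma eventually_nhdsin_carrier:
  assumes "smooth_atlas A"
  shows "eventually (\<lambda>q. q \<in> carrier A) (nhdsin (mtop A) p)"
  unfolding eventually_nhdsin using openin_topspace topspace_mtop[OF assms] by metis

lemma smooth_at_in_carrier: "smooth_at A B p F \<Longrightarrow> p \<in> carrier A"
  unfolding smooth_at_def carrier_def by auto

text \<open>Smoothness asks for some pair of charts; composing with transition maps shows that every pair of
charts around the point and its image will do.\<close>

lemma smooth_at_chart:
  assumes A: "smooth_atlas A" and B: "smooth_atlas B"
    and U: "(U, \<phi>) \<in> A" "p \<in> U" and V: "(V, \<psi>) \<in> B" "F p \<in> V"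
  shows "smooth_at A B p F \<longleftrightarrow>
    smooth_near (\<phi> p) (\<lambda>z. \<psi> (F (inv_into U \<phi> z))) \<and> (\<forall>\<^sub>F q in nhdsin (mtop A) p. F q \<in> V)"
proof
  assume "smooth_near (\<phi> p) (\<lambda>z. \<psi> (F (inv_into U \<phi> z))) \<and> (\<forall>\<^sub>F q in nhdsin (mtop A) p. F q \<in> V)"
  then obtain S T where S: "open S" "\<phi> p \<in> S" "smooth_on S (\<lambda>z. \<psi> (F (inv_into U \<phi> z)))"
    and T: "open T" "\<phi> p \<in> T" "\<forall>z\<in>T. F (inv_into U \<phi> z) \<in> V"
    unfolding smooth_near_def eventually_nhdsin_chart[OF A U] eventually_nhds by blast
  let ?W = "{q \<in> U. \<phi> q \<in> S \<inter> T}"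
  have "openin (mtop A) ?W" using S(1) T(1) by (intro openin_chart_preimage[OF A U(1)]) auto
  moreover have "p \<in> ?W" using U S T by auto
  moreover have "?W \<subseteq> U" by auto
  moreover have "F ` ?W \<subseteq> V" using T(3) chart_inverse(1)[OF A U(1)] by force
  moreover have "smooth_on (\<phi> ` ?W) (\<psi> \<circ> F \<circ> inv_into U \<phi>)"
    unfolding o_def by (rule smooth_on_subset[OF S(3)]) auto
  ultimately show "smooth_at A B p F"
    unfolding smooth_at_def using U(1) V(1) by blast
next
  assume "smooth_at A B p F"
  then obtain U' \<phi>' V' \<psi>' W where U': "(U', \<phi>') \<in> A" and V': "(V', \<psi>') \<in> B"
    and W: "openin (mtop A) W" "p \<in> W" "W \<subseteq> U'" "F ` W \<subseteq> V'"
      "smooth_on (\<phi>' ` W) (\<lambda>z. \<psi>' (F (inv_into U' \<phi>' z)))"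
    unfolding smooth_at_def o_def by blast
  let ?f = "\<lambda>z. \<psi>' (F (inv_into U' \<phi>' z))"
  have pU': "p \<in> U'" using W by auto
  have FpV': "F p \<in> V'" using W by auto
  have "open (\<phi>' ` (U' \<inter> W))" using W(1) U' unfolding openin_mtop[OF A] open_in_atlas_def by auto
  then have "open (\<phi>' ` W)" using W(3) by (simp add: Int_absorb1)
  then have f: "smooth_near (\<phi>' p) ?f" unfolding smooth_near_def using W(2,5) by blast
  note inv' = chart_inverse[OF A U'] and inv = chart_inverse[OF A U(1)] and invV' = chart_inverse[OF B V']
  have eW: "\<forall>\<^sub>F q in nhdsin (mtop A) p. q \<in> W" by (rule eventually_nhdsin_openin[OF W(1,2)])
  have "open (\<psi>' ` (V' \<inter> V))" by (rule atlas_transition[OF B V' V(1)])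
  moreover have "?f (\<phi>' p) \<in> \<psi>' ` (V' \<inter> V)" using inv'(1)[OF pU'] FpV' V(2) by auto
  ultimately have "\<forall>\<^sub>F y in nhds (?f (\<phi>' p)). y \<in> \<psi>' ` (V' \<inter> V)" by (rule eventually_nhds_in_open)
  moreover have "filterlim ?f (nhds (?f (\<phi>' p))) (nhds (\<phi>' p))"
    using smooth_near_filterlim[OF f] .
  ultimately have "\<forall>\<^sub>F z in nhds (\<phi>' p). ?f z \<in> \<psi>' ` (V' \<inter> V)"
    by (rule eventually_compose_filterlim)
  then have "\<forall>\<^sub>F q in nhdsin (mtop A) p. \<psi>' (F q) \<in> \<psi>' ` (V' \<inter> V)"
    unfolding eventually_nhdsin_chart[OF A U' pU'] .
  with eW have eV: "\<forall>\<^sub>F q in nhdsin (mtop A) p. F q \<in> V"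
  proof eventually_elim
    case (elim q)
    then have "F q \<in> V'" using W(4) by auto
    with elim show ?case using atlas_chart_inj[OF B V'] by (auto dest: inj_onD)
  qed
  have ew: "\<forall>\<^sub>F z in nhds (\<phi> p). inv_into U \<phi> z \<in> W"
    using eW unfolding eventually_nhdsin_chart[OF A U] .
  have "smooth_near (\<phi> p) (\<lambda>z. \<psi> (inv_into V' \<psi>' (?f (\<phi>' (inv_into U \<phi> z)))))"
  proof (rule smooth_near_compose[where g = "\<lambda>y. \<psi> (inv_into V' \<psi>' y)" and f = "\<lambda>z. ?f (\<phi>' (inv_into U \<phi> z))"])
    show "smooth_near (\<phi> p) (\<lambda>z. ?f (\<phi>' (inv_into U \<phi> z)))"
    proof (rule smooth_near_compose[where g = ?f])
      show "smooth_near (\<phi> p) (\<lambda>z. \<phi>' (inv_into U \<phi> z))"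
        by (rule smooth_near_transition[OF A U(1) U' U(2) pU'])
      show "smooth_near (\<phi>' (inv_into U \<phi> (\<phi> p))) ?f" using f inv(1)[OF U(2)] by simp
    qed
    show "smooth_near (?f (\<phi>' (inv_into U \<phi> (\<phi> p)))) (\<lambda>y. \<psi> (inv_into V' \<psi>' y))"
      using smooth_near_transition[OF B V' V(1) FpV' V(2)] inv(1)[OF U(2)] inv'(1)[OF pU'] by simp
  qed
  moreover have "\<forall>\<^sub>F z in nhds (\<phi> p). \<psi> (inv_into V' \<psi>' (?f (\<phi>' (inv_into U \<phi> z)))) = \<psi> (F (inv_into U \<phi> z))"
    using ew
  proof eventually_elim
    case (elim z)
    then have "inv_into U' \<phi>' (\<phi>' (inv_into U \<phi> z)) = inv_into U \<phi> z" using inv'(1) W(3) by auto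
    moreover have "F (inv_into U \<phi> z) \<in> V'" using elim W(4) by auto
    ultimately show ?case using invV'(1) by simp
  qed
  ultimately have "smooth_near (\<phi> p) (\<lambda>z. \<psi> (F (inv_into U \<phi> z)))"
    by (rule smooth_near_cong[rotated])
  with eV show "smooth_near (\<phi> p) (\<lambda>z. \<psi> (F (inv_into U \<phi> z))) \<and> (\<forall>\<^sub>F q in nhdsin (mtop A) p. F q \<in> V)"
    by blast
qed

lemma smooth_atlas_std_atlas: "smooth_atlas std_atlas"
  using Ck_on_bounded_linear[OF bounded_linear_ident]
  by (auto simp: smooth_atlas_def std_atlas_def smooth_on_def o_def inj_on_def id_def)

lemma std_chart: "(UNIV, id) \<in> std_atlas"
  by (simp add: std_atlas_def)

lemma smooth_fun_at_chart:
  assumes A: "smooth_atlas A" and U: "(U, \<phi>) \<in> A" "p \<in> U"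
  shows "smooth_fun_at A p f \<longleftrightarrow> smooth_near (\<phi> p) (\<lambda>z. f (inv_into U \<phi> z))"
  using smooth_at_chart[OF A smooth_atlas_std_atlas U std_chart, of f] by simp

lemma smooth_fun_at_cong:
  assumes A: "smooth_atlas A" and e: "\<forall>\<^sub>F q in nhdsin (mtop A) p. f q = g q"
    and f: "smooth_fun_at A p f"
  shows "smooth_fun_at A p g"
proof -
  obtain U \<phi> where U: "(U, \<phi>) \<in> A" "p \<in> U"
    using smooth_at_in_carrier[OF f] by (auto simp: carrier_iff)
  show ?thesis
    using f e unfolding smooth_fun_at_chart[OF A U] eventually_nhdsin_chart[OF A U]
    by (rule smooth_near_cong[rotated])
qed

lemma smooth_fun_at_eventually:
  assumes A: "smooth_atlas A" and f: "smooth_fun_at A p f"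
  shows "\<forall>\<^sub>F q in nhdsin (mtop A) p. smooth_fun_at A q f"
proof -
  obtain U \<phi> where U: "(U, \<phi>) \<in> A" "p \<in> U"
    using smooth_at_in_carrier[OF f] by (auto simp: carrier_iff)
  have "\<forall>\<^sub>F z in nhds (\<phi> p). smooth_near z (\<lambda>z. f (inv_into U \<phi> z))"
    using f unfolding smooth_fun_at_chart[OF A U] by (rule smooth_near_eventually)
  with eventually_nhds_chart_range[OF A U] show ?thesis
    unfolding eventually_nhdsin_chart[OF A U]
  proof eventually_elim
    case (elim z)
    then show ?case
      using smooth_fun_at_chart[OF A U(1) chart_inverse(3)[OF A U(1)], of z f] chart_inverse(2)[OF A U(1), of z]
      by simp
  qed
qed

lemma smooth_fun_at_const: 
  assumes A: "smooth_atlas A" and "p \<in> carrier A"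
  shows "smooth_fun_at A p (\<lambda>q. c)"
  using assms by (auto simp: carrier_iff smooth_fun_at_chart[OF A])

lemma smooth_fun_at_add:
  assumes A: "smooth_atlas A" and f: "smooth_fun_at A p f" and g: "smooth_fun_at A p g"
  shows "smooth_fun_at A p (\<lambda>q. f q + g q)"
proof -
  obtain U \<phi> where U: "(U, \<phi>) \<in> A" "p \<in> U"
    using smooth_at_in_carrier[OF f] by (auto simp: carrier_iff)
  show ?thesis using f g unfolding smooth_fun_at_chart[OF A U] by (rule smooth_near_add)
qed

lemma smooth_fun_at_cmult:
  assumes A: "smooth_atlas A" and f: "smooth_fun_at A p f"
  shows "smooth_fun_at A p (\<lambda>q. c * f q)"
proof -
  obtain U \<phi> where U: "(U, \<phi>) \<in> A" "p \<in> U"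
    using smooth_at_in_carrier[OF f] by (auto simp: carrier_iff)
  show ?thesis using f unfolding smooth_fun_at_chart[OF A U]
    by (rule smooth_near_linear_comp[OF bounded_linear_mult_right])
qed

lemma smooth_fun_at_diff:
  assumes A: "smooth_atlas A" and f: "smooth_fun_at A p f" and g: "smooth_fun_at A p g"
  shows "smooth_fun_at A p (\<lambda>q. f q - g q)"
  using smooth_fun_at_add[OF A f smooth_fun_at_cmult[OF A g, of "-1"]] by simp

lemma smooth_fun_at_compose:
  assumes A: "smooth_atlas A" and B: "smooth_atlas B"
    and F: "smooth_at A B p F" and g: "smooth_fun_at B (F p) g"
  shows "smooth_fun_at A p (\<lambda>q. g (F q))"
proof -
  obtain U \<phi> where U: "(U, \<phi>) \<in> A" "p \<in> U"
    using smooth_at_in_carrier[OF F] by (auto simp: carrier_iff)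
  obtain V \<psi> where V: "(V, \<psi>) \<in> B" "F p \<in> V"
    using smooth_at_in_carrier[OF g] by (auto simp: carrier_iff)
  have s: "smooth_near (\<phi> p) (\<lambda>z. \<psi> (F (inv_into U \<phi> z)))"
    and e: "\<forall>\<^sub>F z in nhds (\<phi> p). F (inv_into U \<phi> z) \<in> V"
    using F unfolding smooth_at_chart[where F = F and p = p, OF A B U V] eventually_nhdsin_chart[OF A U] by auto
  have "smooth_near (\<phi> p) (\<lambda>z. g (inv_into V \<psi> (\<psi> (F (inv_into U \<phi> z)))))"
    by (rule smooth_near_compose[OF s, where g = "\<lambda>y. g (inv_into V \<psi> y)"])
       (use g in \<open>simp add: smooth_fun_at_chart[OF B V] chart_inverse(1)[OF A U]\<close>)
  moreover have "\<forall>\<^sub>F z in nhds (\<phi> p). g (inv_into V \<psi> (\<psi> (F (inv_into U \<phi> z)))) = g (F (inv_into U \<phi> z))"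
    using e by eventually_elim (simp add: chart_inverse(1)[OF B V(1)])
  ultimately show ?thesis
    unfolding smooth_fun_at_chart[OF A U] by (rule smooth_near_cong[rotated])
qed

lemma smooth_at_id:
  assumes A: "smooth_atlas A" and "p \<in> carrier A"
  shows "smooth_at A A p (\<lambda>q. q)"
proof -
  obtain U \<phi> where U: "(U, \<phi>) \<in> A" "p \<in> U" using assms by (auto simp: carrier_iff)
  show ?thesis
    using smooth_near_transition[OF A U(1) U(1) U(2) U(2)] eventually_nhdsin_in_chart[OF A U]
    by (simp add: smooth_at_chart[where F = "\<lambda>q. q" and p = p, OF A A U U])
qed

section \<open>Tangent vectors in a chart\<close>

text \<open>The tangent vector at \<open>p\<close> with coordinates \<open>w\<close>, written as a functional on functions.\<close>

definition chart_vector ::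
  "('a, 'e::euclidean_space) atlas \<Rightarrow> 'a set \<Rightarrow> ('a \<Rightarrow> 'e) \<Rightarrow> 'a \<Rightarrow> 'e \<Rightarrow> 'a tvec"
  where "chart_vector A U \<phi> p w = (\<lambda>f. if smooth_fun_at A p f
    then frechet_derivative (\<lambda>z. f (inv_into U \<phi> z)) (at (\<phi> p)) w else 0)"

text \<open>The left inverse of \<open>chart_vector\<close>. It does not mention the base point and so applies to a whole section.\<close>

definition components :: "('a \<Rightarrow> 'e::euclidean_space) \<Rightarrow> 'a tvec \<Rightarrow> 'e"
  where "components \<phi> v = (\<Sum>b\<in>Basis. v (\<lambda>q. \<phi> q \<bullet> b) *\<^sub>R b)"

lemma chart_coordinate:
  assumes A: "smooth_atlas A" and U: "(U, \<phi>) \<in> A" "p \<in> U"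
  shows "smooth_fun_at A p (\<lambda>q. \<phi> q \<bullet> b)"
    and "((\<lambda>z. \<phi> (inv_into U \<phi> z) \<bullet> b) has_derivative (\<lambda>w. w \<bullet> b)) (at (\<phi> p))"
proof -
  have e: "\<forall>\<^sub>F z in nhds (\<phi> p). z \<bullet> b = \<phi> (inv_into U \<phi> z) \<bullet> b"
    using eventually_nhds_chart_range[OF A U]
    by eventually_elim (simp add: chart_inverse(2)[OF A U(1)])
  show "smooth_fun_at A p (\<lambda>q. \<phi> q \<bullet> b)"
    unfolding smooth_fun_at_chart[OF A U]
    by (rule smooth_near_cong[OF e smooth_near_bounded_linear[OF bounded_linear_inner_left]])
  obtain S where S: "open S" "\<phi> p \<in> S" "\<And>z. z \<in> S \<Longrightarrow> z \<bullet> b = \<phi> (inv_into U \<phi> z) \<bullet> b"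
    using e unfolding eventually_nhds by blast
  have "((\<lambda>z. z \<bullet> b) has_derivative (\<lambda>w. w \<bullet> b)) (at (\<phi> p))"
    by (intro has_derivative_inner_left has_derivative_ident)
  then show "((\<lambda>z. \<phi> (inv_into U \<phi> z) \<bullet> b) has_derivative (\<lambda>w. w \<bullet> b)) (at (\<phi> p))"
    by (rule has_derivative_transform_within_open[OF _ S])
qed

lemma components_chart_vector:
  assumes "smooth_atlas A" "(U, \<phi>) \<in> A" "p \<in> U"
  shows "components \<phi> (chart_vector A U \<phi> p w) = w"
  unfolding components_def chart_vector_def
  using chart_coordinate[OF assms] frechet_derivative_eq[OF chart_coordinate(2)[OF assms]]
  by (simp add: euclidean_representation)

lemma linear_chart_vector:
  assumes A: "smooth_atlas A" and U: "(U, \<phi>) \<in> A" "p \<in> U"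
  shows "linear (chart_vector A U \<phi> p)"
proof -
  have "linear (frechet_derivative (\<lambda>z. f (inv_into U \<phi> z)) (at (\<phi> p)))" if "smooth_fun_at A p f" for f
    using that unfolding smooth_fun_at_chart[OF A U]
    by (intro linear_frechet_derivative smooth_near_differentiable)
  then show ?thesis
    by (intro linearI) (auto simp: chart_vector_def fun_eq_iff linear_add linear_cmul)
qed

lemma velocity_eq_chart_vector:
  assumes A: "smooth_atlas A" and U: "(U, \<phi>) \<in> A" "c 0 \<in> U" and c: "smooth_at std_atlas A (0::real) c"
  shows "velocity A c = chart_vector A U \<phi> (c 0) (frechet_derivative (\<lambda>t. \<phi> (c t)) (at 0) 1)"
proof
  fix f
  have "smooth_near (id 0) (\<lambda>z. \<phi> (c (inv_into UNIV id z)))"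
    and "\<forall>\<^sub>F q in nhdsin (mtop std_atlas) (0::real). c q \<in> U"
    using c unfolding smooth_at_chart[where F = c and p = 0, OF smooth_atlas_std_atlas A std_chart UNIV_I U] by auto
  then have s: "smooth_near 0 (\<lambda>t. \<phi> (c t))" and e: "\<forall>\<^sub>F t in nhds 0. c t \<in> U"
    unfolding eventually_nhdsin_chart[OF smooth_atlas_std_atlas std_chart UNIV_I] by auto
  show "velocity A c f = chart_vector A U \<phi> (c 0) (frechet_derivative (\<lambda>t. \<phi> (c t)) (at 0) 1) f"
  proof (cases "smooth_fun_at A (c 0) f")
    case True
    let ?f = "\<lambda>z. f (inv_into U \<phi> z)"
    have f: "?f differentiable (at (\<phi> (c 0)))"
      using True unfolding smooth_fun_at_chart[OF A U] by (rule smooth_near_differentiable)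
    let ?w = "frechet_derivative (\<lambda>t. \<phi> (c t)) (at 0)" and ?f' = "frechet_derivative ?f (at (\<phi> (c 0)))"
    have "((\<lambda>t. \<phi> (c t)) has_derivative ?w) (at 0)"
      using smooth_near_differentiable[OF s] by (simp add: frechet_derivative_works)
    moreover have "(?f has_derivative ?f') (at (\<phi> (c 0)))"
      using f by (simp add: frechet_derivative_works)
    ultimately have d: "((\<lambda>t. ?f (\<phi> (c t))) has_derivative (\<lambda>t. ?f' (?w t))) (at 0)"
      using diff_chain_at[of "\<lambda>t. \<phi> (c t)" ?w 0 ?f ?f'] by (simp add: o_def)
    have l: "linear ?w" "linear ?f'"
      using linear_frechet_derivative smooth_near_differentiable[OF s] f by blast+
    have "(\<lambda>t. ?f' (?w t)) = (*) (?f' (?w 1))"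
    proof
      fix t
      show "?f' (?w t) = ?f' (?w 1) * t"
        using linear_cmul[OF l(1), of t 1] linear_cmul[OF l(2), of t "?w 1"] by simp
    qed
    then have d': "((\<lambda>t. ?f (\<phi> (c t))) has_real_derivative ?f' (?w 1)) (at 0)"
      using d unfolding has_field_derivative_def by metis
    obtain S where S: "open S" "0 \<in> S" "\<And>t. t \<in> S \<Longrightarrow> c t \<in> U"
      using e unfolding eventually_nhds by blast
    have "(f \<circ> c has_real_derivative ?f' (?w 1)) (at 0)"
      by (rule has_field_derivative_transform_within_open[OF d' S(1,2)])
         (use S(3) chart_inverse(1)[OF A U(1)] in auto)
    then show ?thesis using True by (simp add: velocity_def chart_vector_def DERIV_imp_deriv)
  qed (simp add: velocity_def chart_vector_def)
qed

text \<open>Curves that are straight lines in a chart. They realise every tangent vector, and in the tangent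
bundle they are the lines along the fibres that define \<open>\<gamma>\<close>.\<close>

lemma smooth_curve:
  assumes A: "smooth_atlas A" and U: "(U, \<phi>) \<in> A" "c 0 \<in> U"
    and e: "\<forall>\<^sub>F t in nhds (0::real). c t \<in> U \<and> \<phi> (c t) = \<phi> (c 0) + t *\<^sub>R w"
  shows "smooth_at std_atlas A 0 c" and "velocity A c = chart_vector A U \<phi> (c 0) w"
proof -
  have bl: "bounded_linear (\<lambda>t::real. t *\<^sub>R w)" by (rule bounded_linear_scaleR_left)
  have "smooth_near 0 (\<lambda>t. \<phi> (c 0) + t *\<^sub>R w)"
    by (intro smooth_near_add smooth_near_const smooth_near_bounded_linear[OF bl])
  moreover have "\<forall>\<^sub>F t in nhds 0. \<phi> (c 0) + t *\<^sub>R w = \<phi> (c t)" using e by eventually_elim simp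
  ultimately have "smooth_near 0 (\<lambda>t. \<phi> (c t))" by (rule smooth_near_cong[rotated])
  moreover have "\<forall>\<^sub>F t in nhds 0. c t \<in> U" using e by eventually_elim simp
  ultimately show s: "smooth_at std_atlas A 0 c"
    unfolding smooth_at_chart[where F = c and p = 0, OF smooth_atlas_std_atlas A std_chart UNIV_I U]
    by (simp add: eventually_nhdsin_chart[OF smooth_atlas_std_atlas std_chart UNIV_I])
  obtain S where S: "open S" "0 \<in> S" "\<forall>t\<in>S. c t \<in> U \<and> \<phi> (c t) = \<phi> (c 0) + t *\<^sub>R w"
    using e unfolding eventually_nhds by blast
  have S': "\<phi> (c 0) + t *\<^sub>R w = \<phi> (c t)" if "t \<in> S" for t
    by (rule sym, rule conjunct2, rule bspec[OF S(3) that])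
  have "((\<lambda>t. \<phi> (c 0) + t *\<^sub>R w) has_derivative (\<lambda>t. t *\<^sub>R w)) (at 0)"
    by (auto intro!: derivative_eq_intros)
  then have "((\<lambda>t. \<phi> (c t)) has_derivative (\<lambda>t. t *\<^sub>R w)) (at 0)"
    by (rule has_derivative_transform_within_open[OF _ S(1,2) S'])
  then show "velocity A c = chart_vector A U \<phi> (c 0) w"
    using velocity_eq_chart_vector[OF A U s] by (simp add: frechet_derivative_eq)
qed

lemma tangent_space_chart:
  assumes A: "smooth_atlas A" and U: "(U, \<phi>) \<in> A" "p \<in> U"
  shows "tangent_space A p = range (chart_vector A U \<phi> p)"
proof
  show "tangent_space A p \<subseteq> range (chart_vector A U \<phi> p)"
    using velocity_eq_chart_vector[OF A U(1)] U(2) unfolding tangent_space_def by blast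
  show "range (chart_vector A U \<phi> p) \<subseteq> tangent_space A p"
  proof clarify
    fix w
    let ?c = "\<lambda>t::real. inv_into U \<phi> (\<phi> p + t *\<^sub>R w)"
    have c0: "?c 0 = p" using chart_inverse(1)[OF A U] by simp
    have "isCont (\<lambda>t::real. \<phi> p + t *\<^sub>R w) 0" by (intro continuous_intros)
    then have "filterlim (\<lambda>t. \<phi> p + t *\<^sub>R w) (nhds (\<phi> p)) (nhds (0::real))"
      using tendsto_at_iff_tendsto_nhds[of "\<lambda>t::real. \<phi> p + t *\<^sub>R w" 0] by (simp add: isCont_def)
    from eventually_compose_filterlim[OF eventually_nhds_chart_range[OF A U] this]
    have "\<forall>\<^sub>F t in nhds 0. \<phi> p + t *\<^sub>R w \<in> \<phi> ` U" .
    then have e: "\<forall>\<^sub>F t in nhds 0. ?c t \<in> U \<and> \<phi> (?c t) = \<phi> (?c 0) + t *\<^sub>R w"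
      unfolding c0 by eventually_elim (auto simp: chart_inverse(2,3)[OF A U(1)])
    have c0U: "?c 0 \<in> U" using c0 U(2) by simp
    show "chart_vector A U \<phi> p w \<in> tangent_space A p"
      unfolding tangent_space_def using smooth_curve[OF A U(1) c0U e] c0
      by (auto intro!: exI[of _ ?c])
  qed
qed

lemma chart_vector_components:
  assumes "smooth_atlas A" "(U, \<phi>) \<in> A" "p \<in> U" "v \<in> tangent_space A p"
  shows "chart_vector A U \<phi> p (components \<phi> v) = v"
  using assms(4) components_chart_vector[OF assms(1-3)]
  unfolding tangent_space_chart[OF assms(1-3)] by auto

lemma tangent_vector_apply:
  assumes "smooth_atlas A" "(U, \<phi>) \<in> A" "p \<in> U" "v \<in> tangent_space A p" "smooth_fun_at A p f"
  shows "v f = frechet_derivative (\<lambda>z. f (inv_into U \<phi> z)) (at (\<phi> p)) (components \<phi> v)"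
  by (subst chart_vector_components[OF assms(1-4), symmetric]) (simp add: chart_vector_def assms(5))

lemma linear_components: "linear (components \<phi>)"
  by (intro linearI)
    (auto simp: components_def scaleR_add_left sum.distrib scaleR_sum_right)

lemma subspace_tangent_space:
  assumes A: "smooth_atlas A" and "p \<in> carrier A"
  shows "subspace (tangent_space A p)"
proof -
  obtain U \<phi> where U: "(U, \<phi>) \<in> A" "p \<in> U" using assms by (auto simp: carrier_iff)
  show ?thesis
    unfolding tangent_space_chart[OF A U]
    by (intro linear_subspace_image linear_chart_vector[OF A U] subspace_UNIV)
qed

lemma tangent_vector_not_smooth:
  assumes "v \<in> tangent_space A p" "\<not> smooth_fun_at A p f"
  shows "v f = 0"
  using assms by (auto simp: tangent_space_def velocity_def)

lemma tangent_vector_cong: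
  assumes A: "smooth_atlas A" and p: "p \<in> carrier A" and v: "v \<in> tangent_space A p"
    and e: "\<forall>\<^sub>F q in nhdsin (mtop A) p. f q = g q"
  shows "v f = v g"
proof -
  obtain U \<phi> where U: "(U, \<phi>) \<in> A" "p \<in> U" using p by (auto simp: carrier_iff)
  have e': "\<forall>\<^sub>F q in nhdsin (mtop A) p. g q = f q" using e by eventually_elim simp
  show ?thesis
  proof (cases "smooth_fun_at A p f")
    case True
    then have g: "smooth_fun_at A p g" using smooth_fun_at_cong[OF A e] by blast
    have "frechet_derivative (\<lambda>z. f (inv_into U \<phi> z)) (at (\<phi> p)) = frechet_derivative (\<lambda>z. g (inv_into U \<phi> z)) (at (\<phi> p))"
      by (rule frechet_derivative_eventually_cong)
        (use True e in \<open>auto simp: smooth_fun_at_chart[OF A U] eventually_nhdsin_chart[OF A U] smooth_near_differentiable\<close>)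
    then show ?thesis using tangent_vector_apply[OF A U v] True g by simp
  next
    case False
    then have "\<not> smooth_fun_at A p g" using smooth_fun_at_cong[OF A e'] by blast
    with False show ?thesis using tangent_vector_not_smooth[OF v] by simp
  qed
qed

lemma tangent_vector_cong_carrier:
  assumes A: "smooth_atlas A" and p: "p \<in> carrier A" and v: "v \<in> tangent_space A p"
    and e: "\<And>q. q \<in> carrier A \<Longrightarrow> f q = g q"
  shows "v f = v g"
  by (rule tangent_vector_cong[OF A p v], use eventually_nhdsin_carrier[OF A] in eventually_elim) (rule e)

lemma tangent_vector_const:
  assumes A: "smooth_atlas A" and v: "v \<in> tangent_space A p" and p: "p \<in> carrier A"
  shows "v (\<lambda>q. c) = 0"
proof -
  obtain U \<phi> where U: "(U, \<phi>) \<in> A" "p \<in> U" using p by (auto simp: carrier_iff)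
  show ?thesis using tangent_vector_apply[OF A U v smooth_fun_at_const[OF A p]] by simp
qed

lemma tangent_vector_add:
  assumes A: "smooth_atlas A" and v: "v \<in> tangent_space A p"
    and f: "smooth_fun_at A p f" and g: "smooth_fun_at A p g"
  shows "v (\<lambda>q. f q + g q) = v f + v g"
proof -
  obtain U \<phi> where U: "(U, \<phi>) \<in> A" "p \<in> U"
    using smooth_at_in_carrier[OF f] by (auto simp: carrier_iff)
  let ?f = "\<lambda>z. f (inv_into U \<phi> z)" and ?g = "\<lambda>z. g (inv_into U \<phi> z)"
  have d: "?f differentiable (at (\<phi> p))" "?g differentiable (at (\<phi> p))"
    using f g smooth_near_differentiable unfolding smooth_fun_at_chart[OF A U] by blast+
  then have "((\<lambda>z. ?f z + ?g z) has_derivative (\<lambda>w. frechet_derivative ?f (at (\<phi> p)) w + frechet_derivative ?g (at (\<phi> p)) w)) (at (\<phi> p))"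
    by (intro has_derivative_add) (auto simp: frechet_derivative_works)
  from frechet_derivative_eq[OF this] show ?thesis
    using tangent_vector_apply[OF A U v] f g smooth_fun_at_add[OF A f g] by simp
qed

lemma tangent_vector_cmult:
  assumes A: "smooth_atlas A" and v: "v \<in> tangent_space A p" and f: "smooth_fun_at A p f"
  shows "v (\<lambda>q. c * f q) = c * v f"
proof -
  obtain U \<phi> where U: "(U, \<phi>) \<in> A" "p \<in> U"
    using smooth_at_in_carrier[OF f] by (auto simp: carrier_iff)
  let ?f = "\<lambda>z. f (inv_into U \<phi> z)"
  have d: "?f differentiable (at (\<phi> p))"
    using f smooth_near_differentiable unfolding smooth_fun_at_chart[OF A U] by blast
  then have "((\<lambda>z. c * ?f z) has_derivative (\<lambda>w. c * frechet_derivative ?f (at (\<phi> p)) w)) (at (\<phi> p))"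
    by (intro has_derivative_mult_right) (auto simp: frechet_derivative_works)
  from frechet_derivative_eq[OF this] show ?thesis
    using tangent_vector_apply[OF A U v] f smooth_fun_at_cmult[OF A f] by simp
qed

lemma tangent_vector_diff:
  assumes A: "smooth_atlas A" and v: "v \<in> tangent_space A p"
    and f: "smooth_fun_at A p f" and g: "smooth_fun_at A p g"
  shows "v (\<lambda>q. f q - g q) = v f - v g"
  using tangent_vector_add[OF A v f smooth_fun_at_cmult[OF A g, of "-1"]]
    tangent_vector_cmult[OF A v g, of "-1"] by simp

text \<open>Tangent vectors vanish on functions that are not smooth at the base point.\<close>

lemma tangent_vector_eqI:
  assumes "v \<in> tangent_space A p" "w \<in> tangent_space A p"
    and "\<And>f. smooth_fun_at A p f \<Longrightarrow> v f = w f"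
  shows "v = w"
  using assms tangent_vector_not_smooth by (metis ext)

section \<open>The tangent bundle and the slit tangent bundle\<close>

text \<open>The domain of the chart of the tangent bundle over a chart with domain \<open>U\<close>; its map is \<open>tb_map\<close> below.\<close>

definition tb_dom :: "('a, 'e::euclidean_space) atlas \<Rightarrow> 'a set \<Rightarrow> ('a \<times> 'a tvec) set"
  where "tb_dom A U = {(p, v). p \<in> U \<and> v \<in> tangent_space A p}"

definition tb_map :: "('a \<Rightarrow> 'e::euclidean_space) \<Rightarrow> 'a \<times> 'a tvec \<Rightarrow> 'e \<times> 'e"
  where "tb_map \<phi> = (\<lambda>(p, v). (\<phi> p, components \<phi> v))"

lemma tangent_bundle_eq: "tangent_bundle A = {(tb_dom A U, tb_map \<phi>) | U \<phi>. (U, \<phi>) \<in> A}"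
  by (force simp: tangent_bundle_def tangent_chart_def tb_dom_def tb_map_def components_def)

lemma tb_chart_mem: "(U, \<phi>) \<in> A \<Longrightarrow> (tb_dom A U, tb_map \<phi>) \<in> tangent_bundle A"
  by (auto simp: tangent_bundle_eq)

lemma tb_map_inj:
  assumes A: "smooth_atlas A" and U: "(U, \<phi>) \<in> A"
  shows "inj_on (tb_map \<phi>) (tb_dom A U)"
proof (rule inj_onI, clarsimp simp: tb_dom_def tb_map_def)
  fix p v q w
  assume *: "p \<in> U" "v \<in> tangent_space A p" "q \<in> U" "w \<in> tangent_space A q" "\<phi> p = \<phi> q"
    "components \<phi> v = components \<phi> w"
  then have "p = q" using atlas_chart_inj[OF A U] by (auto dest: inj_onD)
  with * show "p = q \<and> v = w" using chart_vector_components[OF A U] by metis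
qed

lemma chart_vector_in_tb_dom:
  assumes A: "smooth_atlas A" and U: "(U, \<phi>) \<in> A" and x: "x \<in> \<phi> ` U"
  shows "(inv_into U \<phi> x, chart_vector A U \<phi> (inv_into U \<phi> x) y) \<in> tb_dom A U"
    and "tb_map \<phi> (inv_into U \<phi> x, chart_vector A U \<phi> (inv_into U \<phi> x) y) = (x, y)"
  using chart_inverse(2,3)[OF A U x] tangent_space_chart[OF A U] components_chart_vector[OF A U]
  by (auto simp: tb_dom_def tb_map_def)

lemma tb_map_image_Int:
  fixes A :: "('a, 'e::euclidean_space) atlas"
  assumes A: "smooth_atlas A" and U: "(U, \<phi>) \<in> A"
  shows "tb_map \<phi> ` (tb_dom A U \<inter> tb_dom A V) = \<phi> ` (U \<inter> V) \<times> UNIV"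
proof (intro equalityI subsetI)
  fix z assume "z \<in> \<phi> ` (U \<inter> V) \<times> (UNIV :: 'e set)"
  then obtain p y where z: "z = (\<phi> p, y)" "p \<in> U" "p \<in> V" by auto
  then show "z \<in> tb_map \<phi> ` (tb_dom A U \<inter> tb_dom A V)"
    using chart_vector_in_tb_dom[OF A U, of "\<phi> p" y] chart_inverse(1)[OF A U z(2)]
    by (auto simp: tb_dom_def intro!: rev_image_eqI[of "(p, chart_vector A U \<phi> p y)"])
qed (auto simp: tb_dom_def tb_map_def)

lemma tb_map_image:
  assumes "smooth_atlas A" "(U, \<phi>) \<in> A"
  shows "tb_map \<phi> ` tb_dom A U = \<phi> ` U \<times> UNIV"
  using tb_map_image_Int[OF assms, of U] by simp

lemma inv_tb_map:
  assumes A: "smooth_atlas A" and U: "(U, \<phi>) \<in> A" and x: "x \<in> \<phi> ` U"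
  shows "inv_into (tb_dom A U) (tb_map \<phi>) (x, y) = (inv_into U \<phi> x, chart_vector A U \<phi> (inv_into U \<phi> x) y)"
  using inv_into_f_f[OF tb_map_inj[OF A U] chart_vector_in_tb_dom(1)[OF A U x]]
    chart_vector_in_tb_dom(2)[OF A U x] by metis

lemma components_chart_vector_transition:
  assumes A: "smooth_atlas A" and U: "(U, \<phi>) \<in> A" "p \<in> U" and V: "(V, \<psi>) \<in> A" "p \<in> V"
  shows "components \<psi> (chart_vector A U \<phi> p y) = frechet_derivative (\<lambda>z. \<psi> (inv_into U \<phi> z)) (at (\<phi> p)) y"
proof -
  let ?t = "\<lambda>z. \<psi> (inv_into U \<phi> z)"
  have d: "(?t has_derivative frechet_derivative ?t (at (\<phi> p))) (at (\<phi> p))"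
    using smooth_near_differentiable[OF smooth_near_transition[OF A U(1) V(1) U(2) V(2)]]
    by (simp add: frechet_derivative_works)
  have "chart_vector A U \<phi> p y (\<lambda>q. \<psi> q \<bullet> b) = frechet_derivative ?t (at (\<phi> p)) y \<bullet> b" for b
    using frechet_derivative_eq[OF has_derivative_inner_left[OF d]] chart_coordinate(1)[OF A V]
    by (simp add: chart_vector_def)
  then show ?thesis unfolding components_def by (simp add: euclidean_representation)
qed

text \<open>A transition map \<open>\<tau>\<close> of the base induces \<open>(x, y) \<mapsto> (\<tau> x, D\<tau>(x) y)\<close> on the tangent bundle.\<close>

lemma smooth_atlas_tangent_bundle:
  assumes A: "smooth_atlas A"
  shows "smooth_atlas (tangent_bundle A)"
proof -
  have "smooth_on (tb_map \<phi> ` (tb_dom A U \<inter> tb_dom A V)) (\<lambda>z. tb_map \<psi> (inv_into (tb_dom A U) (tb_map \<phi>) z))"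
    and "open (tb_map \<phi> ` (tb_dom A U \<inter> tb_dom A V))"
    if U: "(U, \<phi>) \<in> A" and V: "(V, \<psi>) \<in> A" for U \<phi> V \<psi>
  proof -
    have o: "open (\<phi> ` (U \<inter> V) \<times> (UNIV :: 'b set))"
      by (intro open_Times atlas_transition(1)[OF A U V] open_UNIV)
    then show "open (tb_map \<phi> ` (tb_dom A U \<inter> tb_dom A V))" by (simp add: tb_map_image_Int[OF A U])
    let ?t = "\<lambda>z. \<psi> (inv_into U \<phi> z)"
    show "smooth_on (tb_map \<phi> ` (tb_dom A U \<inter> tb_dom A V)) (\<lambda>z. tb_map \<psi> (inv_into (tb_dom A U) (tb_map \<phi>) z))"
      unfolding tb_map_image_Int[OF A U] smooth_on_iff_smooth_near[OF o]
    proof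
      fix w assume w: "w \<in> \<phi> ` (U \<inter> V) \<times> (UNIV :: 'b set)"
      then obtain p y where p: "w = (\<phi> p, y)" "p \<in> U" "p \<in> V" by auto
      have t: "smooth_near (fst w) ?t"
        using smooth_near_transition[OF A U V p(2,3)] p(1) by simp
      have "smooth_near w (\<lambda>z. (?t (fst z), frechet_derivative ?t (at (fst z)) (snd z)))"
        by (intro smooth_near_Pair smooth_near_derivative_along smooth_near_compose[where g = ?t and f = fst] t
            smooth_near_bounded_linear bounded_linear_fst bounded_linear_snd)
      moreover have "\<forall>\<^sub>F z in nhds w. (?t (fst z), frechet_derivative ?t (at (fst z)) (snd z))
          = tb_map \<psi> (inv_into (tb_dom A U) (tb_map \<phi>) z)"
        using eventually_nhds_in_open[OF o w]
      proof eventually_elim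
        case (elim z)
        then obtain q y' where q: "z = (\<phi> q, y')" "q \<in> U" "q \<in> V" by auto
        have "inv_into (tb_dom A U) (tb_map \<phi>) z = (q, chart_vector A U \<phi> q y')"
          using q by (simp add: inv_tb_map[OF A U] chart_inverse(1)[OF A U])
        then show ?case
          using components_chart_vector_transition[OF A U q(2) V q(3), of y'] q
          by (simp add: chart_inverse(1)[OF A U] tb_map_def)
      qed
      ultimately show "smooth_near w (\<lambda>z. tb_map \<psi> (inv_into (tb_dom A U) (tb_map \<phi>) z))"
        by (rule smooth_near_cong[rotated])
    qed
  qed
  moreover have "open (tb_map \<phi> ` tb_dom A U)" if U: "(U, \<phi>) \<in> A" for U \<phi>
    unfolding tb_map_image[OF A U] by (intro open_Times atlas_chart_open[OF A U] open_UNIV)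
  ultimately show ?thesis
    using tb_map_inj[OF A] unfolding smooth_atlas_def tangent_bundle_eq o_def by auto
qed

lemma inv_into_restrict:
  assumes "inj_on \<phi> U" "V \<subseteq> U" "z \<in> \<phi> ` V"
  shows "inv_into V \<phi> z = inv_into U \<phi> z"
proof -
  obtain v where v: "v \<in> V" "z = \<phi> v" using assms(3) by blast
  then have "inv_into V \<phi> (\<phi> v) = v" "inv_into U \<phi> (\<phi> v) = v"
    using assms(1,2) by (auto intro!: inv_into_f_f intro: inj_on_subset)
  with v show ?thesis by simp
qed

lemma smooth_atlas_restrict:
  assumes A: "smooth_atlas A" and o: "\<And>U \<phi>. (U, \<phi>) \<in> A \<Longrightarrow> open (\<phi> ` {u \<in> U. P u})"
  shows "smooth_atlas ((\<lambda>(U, \<phi>). ({u \<in> U. P u}, \<phi>)) ` A)"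
proof -
  have "open (\<phi> ` ({u \<in> U. P u} \<inter> {u \<in> V. P u})) \<and>
     smooth_on (\<phi> ` ({u \<in> U. P u} \<inter> {u \<in> V. P u})) (\<lambda>z. \<psi> (inv_into {u \<in> U. P u} \<phi> z))"
    if U: "(U, \<phi>) \<in> A" and V: "(V, \<psi>) \<in> A" for U \<phi> V \<psi>
  proof -
    note t = atlas_transition[OF A U V]
    have e: "\<phi> ` ({u \<in> U. P u} \<inter> {u \<in> V. P u}) = \<phi> ` (U \<inter> V) \<inter> \<phi> ` {u \<in> U. P u}"
      using atlas_chart_inj[OF A U] by (auto dest: inj_onD)
    have op: "open (\<phi> ` ({u \<in> U. P u} \<inter> {u \<in> V. P u}))" unfolding e using t(1) o[OF U] by blast
    have r: "inv_into U \<phi> z = inv_into {u \<in> U. P u} \<phi> z" if "z \<in> \<phi> ` ({u \<in> U. P u} \<inter> {u \<in> V. P u})" for z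
      by (rule inv_into_restrict[OF atlas_chart_inj[OF A U], symmetric]) (use that in auto)
    have "Ck_on k (\<phi> ` ({u \<in> U. P u} \<inter> {u \<in> V. P u})) (\<lambda>z. \<psi> (inv_into {u \<in> U. P u} \<phi> z))" for k
    proof (rule Ck_on_cong[OF op arg_cong[OF r]])
      show "Ck_on k (\<phi> ` ({u \<in> U. P u} \<inter> {u \<in> V. P u})) (\<lambda>z. \<psi> (inv_into U \<phi> z))"
        by (rule Ck_on_subset[of _ "\<phi> ` (U \<inter> V)"]) (use t(2) in \<open>auto simp: smooth_on_def\<close>)
    qed
    then show ?thesis using op by (simp add: smooth_on_def)
  qed
  moreover have "inj_on \<phi> {u \<in> U. P u}" if U: "(U, \<phi>) \<in> A" for U \<phi>
    using atlas_chart_inj[OF A U] by (auto intro: inj_on_subset)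
  ultimately show ?thesis using o unfolding smooth_atlas_def o_def by auto
qed

definition slit_dom :: "('a, 'e::euclidean_space) atlas \<Rightarrow> 'a set \<Rightarrow> ('a \<times> 'a tvec) set"
  where "slit_dom M U = {u \<in> tb_dom M U. snd u \<noteq> 0}"

lemma slit_eq: "slit M = {(slit_dom M U, tb_map \<phi>) | U \<phi>. (U, \<phi>) \<in> M}"
  unfolding slit_def tangent_bundle_eq slit_dom_def by (auto simp: image_iff; blast)

lemma slit_chart_mem: "(U, \<phi>) \<in> M \<Longrightarrow> (slit_dom M U, tb_map \<phi>) \<in> slit M"
  unfolding slit_eq by blast

lemma slit_dom_iff: "u \<in> slit_dom M U \<longleftrightarrow> fst u \<in> U \<and> snd u \<in> tangent_space M (fst u) \<and> snd u \<noteq> 0"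
  by (auto simp: slit_dom_def tb_dom_def)

lemma carrier_slit_iff:
  "u \<in> carrier (slit M) \<longleftrightarrow> fst u \<in> carrier M \<and> snd u \<in> tangent_space M (fst u) \<and> snd u \<noteq> 0"
  unfolding carrier_iff slit_eq using slit_dom_iff[of u M] by blast

lemma slit_chart_obtain:
  assumes "u \<in> carrier (slit M)"
  obtains U \<phi> where "(U, \<phi>) \<in> M" "fst u \<in> U" "u \<in> slit_dom M U"
  using assms unfolding carrier_iff slit_eq by (auto simp: slit_dom_iff)

lemma components_eq_0_iff:
  assumes "smooth_atlas A" "(U, \<phi>) \<in> A" "p \<in> U" "v \<in> tangent_space A p"
  shows "components \<phi> v = 0 \<longleftrightarrow> v = 0"
  using chart_vector_components[OF assms] linear_0[OF linear_chart_vector[OF assms(1-3)]]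
    linear_0[OF linear_components] by metis

lemma slit_map_image:
  fixes A :: "('a, 'e::euclidean_space) atlas"
  assumes A: "smooth_atlas A" and U: "(U, \<phi>) \<in> A"
  shows "tb_map \<phi> ` slit_dom A U = \<phi> ` U \<times> (- {0})"
proof (intro equalityI subsetI)
  fix z assume "z \<in> tb_map \<phi> ` slit_dom A U"
  then show "z \<in> \<phi> ` U \<times> (- {0})"
    using components_eq_0_iff[OF A U] by (auto simp: slit_dom_def tb_dom_def tb_map_def)
next
  fix z assume z: "z \<in> \<phi> ` U \<times> (- {0 :: 'e})"
  then obtain u where u: "u \<in> tb_dom A U" "z = tb_map \<phi> u"
    using tb_map_image[OF A U] by (force elim!: equalityE)
  moreover have "snd u \<noteq> 0" using u z linear_0[OF linear_components, of \<phi>] by (auto simp: tb_map_def split: prod.splits)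
  ultimately show "z \<in> tb_map \<phi> ` slit_dom A U" by (auto simp: slit_dom_def)
qed

lemma smooth_atlas_slit:
  assumes A: "smooth_atlas A"
  shows "smooth_atlas (slit A)"
  unfolding slit_def
proof (rule smooth_atlas_restrict[OF smooth_atlas_tangent_bundle[OF A]])
  fix W \<Phi> assume "(W, \<Phi>) \<in> tangent_bundle A"
  then obtain U \<phi> where U: "(U, \<phi>) \<in> A" "W = tb_dom A U" "\<Phi> = tb_map \<phi>" by (auto simp: tangent_bundle_eq)
  then have "\<Phi> ` {u \<in> W. snd u \<noteq> 0} = \<phi> ` U \<times> (- {0})"
    using slit_map_image[OF A U(1)] by (simp add: slit_dom_def)
  then show "open (\<Phi> ` {u \<in> W. snd u \<noteq> 0})"
    using open_Times[OF atlas_chart_open[OF A U(1)] open_Compl[OF closed_singleton]] by simp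
qed

lemma inv_slit_map:
  assumes A: "smooth_atlas A" and U: "(U, \<phi>) \<in> A" and z: "z \<in> \<phi> ` U \<times> (- {0})"
  shows "inv_into (slit_dom A U) (tb_map \<phi>) z
    = (inv_into U \<phi> (fst z), chart_vector A U \<phi> (inv_into U \<phi> (fst z)) (snd z))"
proof -
  have "slit_dom A U \<subseteq> tb_dom A U" by (auto simp: slit_dom_def)
  then show ?thesis
    using inv_into_restrict[OF tb_map_inj[OF A U], of "slit_dom A U" z] z
      inv_tb_map[OF A U, of "fst z" "snd z"] slit_map_image[OF A U] by (auto simp: prod_eq_iff)
qed

lemma eventually_inv_slit_map:
  assumes A: "smooth_atlas A" and U: "(U, \<phi>) \<in> A" and u: "u \<in> slit_dom A U"
  shows "\<forall>\<^sub>F z in nhds (tb_map \<phi> u). z \<in> \<phi> ` U \<times> (- {0}) \<and> inv_into (slit_dom A U) (tb_map \<phi>) z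
    = (inv_into U \<phi> (fst z), chart_vector A U \<phi> (inv_into U \<phi> (fst z)) (snd z))"
  using eventually_nhds_chart_range[OF smooth_atlas_slit[OF A] slit_chart_mem[OF U] u]
  unfolding slit_map_image[OF A U] by eventually_elim (simp add: inv_slit_map[OF A U])

section \<open>Sections along maps\<close>

lemma smooth_at_tangent_bundle:
  assumes A: "smooth_atlas A" and B: "smooth_atlas B" and p: "p \<in> carrier A"
    and V: "(V, \<psi>) \<in> B" "h p \<in> V"
    and s: "\<forall>\<^sub>F q in nhdsin (mtop A) p. s q \<in> tangent_space B (h q)"
  shows "smooth_at A (tangent_bundle B) p (\<lambda>q. (h q, s q)) \<longleftrightarrow>
    smooth_at A B p h \<and> (\<forall>b\<in>Basis. smooth_fun_at A p (\<lambda>q. s q (\<lambda>x. \<psi> x \<bullet> b)))"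
    (is "?L \<longleftrightarrow> ?R")
proof -
  obtain U \<phi> where U: "(U, \<phi>) \<in> A" "p \<in> U" using p by (auto simp: carrier_iff)
  let ?h = "\<lambda>z. \<psi> (h (inv_into U \<phi> z))" and ?s = "\<lambda>z. components \<psi> (s (inv_into U \<phi> z))"
  have sp: "s p \<in> tangent_space B (h p)" by (rule eventually_nhdsin_self[OF A p s])
  have ev: "(\<forall>\<^sub>F q in nhdsin (mtop A) p. (h q, s q) \<in> tb_dom B V) \<longleftrightarrow> (\<forall>\<^sub>F q in nhdsin (mtop A) p. h q \<in> V)"
    by (rule eventually_subst, use s in eventually_elim) (auto simp: tb_dom_def)
  have "(h p, s p) \<in> tb_dom B V" using V sp by (simp add: tb_dom_def)
  note L = smooth_at_chart[where F = "\<lambda>q. (h q, s q)" and p = p, OF A smooth_atlas_tangent_bundle[OF B] U tb_chart_mem[OF V(1)] this]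
  have L': "?L \<longleftrightarrow> smooth_near (\<phi> p) (\<lambda>z. (?h z, ?s z)) \<and> (\<forall>\<^sub>F q in nhdsin (mtop A) p. h q \<in> V)"
    unfolding L ev by (simp add: tb_map_def)
  have R': "?R \<longleftrightarrow> (smooth_near (\<phi> p) ?h \<and> (\<forall>\<^sub>F q in nhdsin (mtop A) p. h q \<in> V)) \<and>
    (\<forall>b\<in>Basis. smooth_near (\<phi> p) (\<lambda>z. ?s z \<bullet> b))"
    unfolding smooth_at_chart[where F = h and p = p, OF A B U V] smooth_fun_at_chart[OF A U]
    by (simp add: components_def inner_sum_left_Basis)
  have "smooth_near (\<phi> p) ?s \<longleftrightarrow> (\<forall>b\<in>Basis. smooth_near (\<phi> p) (\<lambda>z. ?s z \<bullet> b))"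
  proof
    assume "\<forall>b\<in>Basis. smooth_near (\<phi> p) (\<lambda>z. ?s z \<bullet> b)"
    then have "smooth_near (\<phi> p) (\<lambda>z. \<Sum>b\<in>Basis. (?s z \<bullet> b) *\<^sub>R b)"
      by (intro smooth_near_sum smooth_near_scaleR smooth_near_const) auto
    then show "smooth_near (\<phi> p) ?s" by (simp add: euclidean_representation)
  qed (auto intro: smooth_near_linear_comp[OF bounded_linear_inner_left])
  moreover have "smooth_near (\<phi> p) (\<lambda>z. (?h z, ?s z)) \<longleftrightarrow> smooth_near (\<phi> p) ?h \<and> smooth_near (\<phi> p) ?s"
    using smooth_near_linear_comp[OF bounded_linear_fst, of "\<phi> p" "\<lambda>z. (?h z, ?s z)"]
      smooth_near_linear_comp[OF bounded_linear_snd, of "\<phi> p" "\<lambda>z. (?h z, ?s z)"]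
    by (auto intro: smooth_near_Pair)
  ultimately show ?thesis unfolding L' R' by blast
qed

lemma smooth_components_near:
  assumes A: "smooth_atlas A" and U: "(U, \<phi>) \<in> A" "p \<in> U"
    and s: "\<And>b. b \<in> Basis \<Longrightarrow> smooth_fun_at A p (\<lambda>q. s q (\<lambda>x. \<psi> x \<bullet> b))"
  shows "smooth_near (\<phi> p) (\<lambda>z. components \<psi> (s (inv_into U \<phi> z)))"
  unfolding components_def
  by (intro smooth_near_sum smooth_near_scaleR smooth_near_const)
     (use s in \<open>auto simp: smooth_fun_at_chart[OF A U]\<close>)

text \<open>Components of a section are its values on coordinate functions, and its value on any function is a
smooth expression in its components. Smoothness of vector fields and of sections can thus be proved
through their action on functions.\<close>

lemma smooth_section_iff:
  assumes A: "smooth_atlas A" and B: "smooth_atlas B" and h: "smooth_at A B p h" and hp: "h p \<in> carrier B"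
    and s: "\<forall>\<^sub>F q in nhdsin (mtop A) p. s q \<in> tangent_space B (h q)"
  shows "smooth_at A (tangent_bundle B) p (\<lambda>q. (h q, s q)) \<longleftrightarrow>
    (\<forall>g. smooth_fun_at B (h p) g \<longrightarrow> smooth_fun_at A p (\<lambda>q. s q g))" (is "?L \<longleftrightarrow> ?R")
proof -
  have p: "p \<in> carrier A" using h by (rule smooth_at_in_carrier)
  obtain U \<phi> where U: "(U, \<phi>) \<in> A" "p \<in> U" using p by (auto simp: carrier_iff)
  obtain V \<psi> where V: "(V, \<psi>) \<in> B" "h p \<in> V" using hp by (auto simp: carrier_iff)
  note L = smooth_at_tangent_bundle[OF A B p V s]
  have hs: "smooth_near (\<phi> p) (\<lambda>z. \<psi> (h (inv_into U \<phi> z)))" and hV: "\<forall>\<^sub>F q in nhdsin (mtop A) p. h q \<in> V"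
    using h unfolding smooth_at_chart[where F = h and p = p, OF A B U V] by auto
  have ?R if L': ?L
  proof (intro allI impI)
    fix g assume g: "smooth_fun_at B (h p) g"
    let ?h = "\<lambda>z. \<psi> (h (inv_into U \<phi> z))" and ?g = "\<lambda>y. g (inv_into V \<psi> y)"
      and ?k = "\<lambda>z. components \<psi> (s (inv_into U \<phi> z))"
    have k: "smooth_near (\<phi> p) ?k" using L' L by (intro smooth_components_near[OF A U]) blast
    have gn: "smooth_near (?h (\<phi> p)) ?g"
      using g by (simp add: smooth_fun_at_chart[OF B V] chart_inverse(1)[OF A U])
    have "\<forall>\<^sub>F z in nhds (\<phi> p). smooth_near (?h z) ?g"
      by (rule eventually_compose_filterlim[OF smooth_near_eventually[OF gn] smooth_near_filterlim[OF hs]])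
    then have "\<forall>\<^sub>F z in nhds (\<phi> p). frechet_derivative ?g (at (?h z)) (?k z) = s (inv_into U \<phi> z) g"
      using s hV unfolding eventually_nhdsin_chart[OF A U]
    proof eventually_elim
      case (elim z)
      then show ?case
        using tangent_vector_apply[OF B V(1) _ elim(2)] smooth_fun_at_chart[OF B V(1) elim(3)] by simp
    qed
    then show "smooth_fun_at A p (\<lambda>q. s q g)"
      unfolding smooth_fun_at_chart[OF A U]
      by (rule smooth_near_cong[OF _ smooth_near_derivative_along[OF hs k gn]])
  qed
  moreover have ?L if ?R using that h chart_coordinate(1)[OF B V] unfolding L by blast
  ultimately show ?thesis by blast
qed

lemma vector_field_iff:
  assumes A: "smooth_atlas A"
  shows "vector_field A X \<longleftrightarrow> (\<forall>p\<in>carrier A. X p \<in> tangent_space A p \<and>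
    (\<forall>f. smooth_fun_at A p f \<longrightarrow> smooth_fun_at A p (\<lambda>q. X q f)))"
proof (cases "\<forall>p\<in>carrier A. X p \<in> tangent_space A p")
  case True
  have "\<forall>\<^sub>F q in nhdsin (mtop A) p. X q \<in> tangent_space A q" for p
    using eventually_nhdsin_carrier[OF A] by eventually_elim (use True in auto)
  then show ?thesis
    unfolding vector_field_def using smooth_section_iff[OF A A smooth_at_id[OF A]] by simp
qed (auto simp: vector_field_def)

lemma smooth_at_slit_fst:
  assumes M: "smooth_atlas M" and u: "u \<in> carrier (slit M)"
  shows "smooth_at (slit M) M u fst"
proof -
  obtain U \<phi> where U: "(U, \<phi>) \<in> M" "fst u \<in> U" "u \<in> slit_dom M U" using slit_chart_obtain[OF u] .
  have "smooth_near (tb_map \<phi> u) (\<lambda>z. \<phi> (fst (inv_into (slit_dom M U) (tb_map \<phi>) z)))"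
  proof (rule smooth_near_cong)
    show "smooth_near (tb_map \<phi> u) fst" by (rule smooth_near_bounded_linear[OF bounded_linear_fst])
    show "\<forall>\<^sub>F z in nhds (tb_map \<phi> u). fst z = \<phi> (fst (inv_into (slit_dom M U) (tb_map \<phi>) z))"
      using eventually_inv_slit_map[OF M U(1,3)]
      by eventually_elim (auto simp: chart_inverse(2)[OF M U(1)])
  qed
  moreover have "\<forall>\<^sub>F q in nhdsin (mtop (slit M)) u. fst q \<in> U"
    using eventually_nhdsin_in_chart[OF smooth_atlas_slit[OF M] slit_chart_mem[OF U(1)] U(3)]
    by eventually_elim (simp add: slit_dom_iff)
  ultimately show ?thesis
    using smooth_at_chart[where F = fst and p = u, OF smooth_atlas_slit[OF M] M slit_chart_mem[OF U(1)] U(3) U(1,2)]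
    by blast
qed

lemma smooth_fun_at_slit_fst:
  assumes M: "smooth_atlas M" and u: "u \<in> carrier (slit M)" and g: "smooth_fun_at M (fst u) g"
  shows "smooth_fun_at (slit M) u (\<lambda>w. g (fst w))"
  by (rule smooth_fun_at_compose[OF smooth_atlas_slit[OF M] M smooth_at_slit_fst[OF M u] g])

lemma eventually_smooth_fun_at_fst:
  assumes M: "smooth_atlas M" and u: "u \<in> carrier (slit M)" and g: "smooth_fun_at M (fst u) g"
  shows "\<forall>\<^sub>F w in nhdsin (mtop (slit M)) u. smooth_fun_at M (fst w) g"
proof -
  obtain U \<phi> where U: "(U, \<phi>) \<in> M" "fst u \<in> U" "u \<in> slit_dom M U" using slit_chart_obtain[OF u] .
  let ?g = "\<lambda>z. g (inv_into U \<phi> z)"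
  have "\<forall>\<^sub>F x in nhds (fst (tb_map \<phi> u)). smooth_near x ?g"
    using g U(2) by (intro smooth_near_eventually) (simp add: smooth_fun_at_chart[OF M U(1,2)] tb_map_def split_beta)
  from eventually_compose_filterlim[OF this smooth_near_filterlim[OF smooth_near_bounded_linear[OF bounded_linear_fst]]]
  have "\<forall>\<^sub>F z in nhds (tb_map \<phi> u). smooth_near (fst z) ?g" .
  with eventually_inv_slit_map[OF M U(1,3)] show ?thesis
    unfolding eventually_nhdsin_chart[OF smooth_atlas_slit[OF M] slit_chart_mem[OF U(1)] U(3)]
  proof eventually_elim
    case (elim z)
    then show ?case
      using smooth_fun_at_chart[OF M U(1) chart_inverse(3)[OF M U(1)], of "fst z" g] chart_inverse(2)[OF M U(1), of "fst z"]
      by auto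
  qed
qed

lemma pb_section_iff:
  assumes M: "smooth_atlas M"
  shows "pb_section M s \<longleftrightarrow> (\<forall>u\<in>carrier (slit M). s u \<in> tangent_space M (fst u) \<and>
    (\<forall>g. smooth_fun_at M (fst u) g \<longrightarrow> smooth_fun_at (slit M) u (\<lambda>w. s w g)))"
proof (cases "\<forall>u\<in>carrier (slit M). s u \<in> tangent_space M (fst u)")
  case True
  have "\<forall>\<^sub>F w in nhdsin (mtop (slit M)) u. s w \<in> tangent_space M (fst w)" for u
    using eventually_nhdsin_carrier[OF smooth_atlas_slit[OF M]] by eventually_elim (use True in auto)
  then show ?thesis
    unfolding pb_section_def
    using smooth_section_iff[OF smooth_atlas_slit[OF M] M smooth_at_slit_fst[OF M]]
    by (simp add: carrier_slit_iff)
qed (auto simp: pb_section_def)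

lemma pb_section_cong:
  assumes M: "smooth_atlas M" and s: "pb_section M s" and e: "\<And>u. u \<in> carrier (slit M) \<Longrightarrow> s u = t u"
  shows "pb_section M t"
  unfolding pb_section_iff[OF M]
proof (intro ballI conjI allI impI)
  fix u assume u: "u \<in> carrier (slit M)"
  show "t u \<in> tangent_space M (fst u)" using bspec[OF s[unfolded pb_section_def] u] e[OF u] by simp
  fix g assume g: "smooth_fun_at M (fst u) g"
  have "\<forall>\<^sub>F w in nhdsin (mtop (slit M)) u. s w g = t w g"
    using eventually_nhdsin_carrier[OF smooth_atlas_slit[OF M]] by eventually_elim (simp add: e)
  then show "smooth_fun_at (slit M) u (\<lambda>w. t w g)"
    by (rule smooth_fun_at_cong[OF smooth_atlas_slit[OF M]]) (use s u g in \<open>auto simp: pb_section_iff[OF M]\<close>)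
qed

lemma pb_section_diff:
  assumes M: "smooth_atlas M" and s: "pb_section M s" and t: "pb_section M t"
  shows "pb_section M (\<lambda>u. s u - t u)"
proof -
  have sub: "subspace (tangent_space M (fst u))" if "u \<in> carrier (slit M)" for u
    using that subspace_tangent_space[OF M] by (simp add: carrier_slit_iff)
  show ?thesis
    unfolding pb_section_iff[OF M]
  proof (intro ballI conjI allI impI)
    fix u assume u: "u \<in> carrier (slit M)"
    show "s u - t u \<in> tangent_space M (fst u)"
      using s t u by (intro subspace_diff[OF sub[OF u]]) (auto simp: pb_section_def)
    fix g assume "smooth_fun_at M (fst u) g"
    then show "smooth_fun_at (slit M) u (\<lambda>w. (s w - t w) g)"
      using s t u unfolding pb_section_iff[OF M] fun_diff_def
      by (intro smooth_fun_at_diff[OF smooth_atlas_slit[OF M]]) blast+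
  qed
qed

lemma pb_section_tangent: "pb_section M s \<Longrightarrow> u \<in> carrier (slit M) \<Longrightarrow> s u \<in> tangent_space M (fst u)"
  by (simp add: pb_section_def)

section \<open>Vector fields and the Lie bracket\<close>

lemma vector_field_tangent: "vector_field A X \<Longrightarrow> p \<in> carrier A \<Longrightarrow> X p \<in> tangent_space A p"
  by (simp add: vector_field_def)

lemma vector_field_smooth:
  assumes "smooth_atlas A" "vector_field A X" "smooth_fun_at A p f"
  shows "smooth_fun_at A p (\<lambda>q. X q f)"
  using assms(2,3) smooth_at_in_carrier[OF assms(3)] by (simp add: vector_field_iff[OF assms(1)])

lemma vector_field_diff:
  assumes A: "smooth_atlas A" and "vector_field A X" "vector_field A Y"
  shows "vector_field A (\<lambda>q. X q - Y q)"
  using assms subspace_diff[OF subspace_tangent_space[OF A]]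
  by (auto simp: vector_field_iff[OF A] fun_diff_def intro: smooth_fun_at_diff[OF A])

lemma bracket_apply:
  "smooth_fun_at A p f \<Longrightarrow> bracket A X Y p f = X p (\<lambda>q. Y q f) - Y p (\<lambda>q. X q f)"
  by (simp add: bracket_def)

lemma vector_field_smooth_components:
  assumes A: "smooth_atlas A" and U: "(U, \<phi>) \<in> A" "p \<in> U" and X: "vector_field A X"
  shows "smooth_near (\<phi> p) (\<lambda>z. components \<phi> (X (inv_into U \<phi> z)))"
  by (intro smooth_components_near[OF A U] vector_field_smooth[OF A X] chart_coordinate(1)[OF A U])

text \<open>The chart expression of \<open>v(Yf)\<close>, arranged so that the part symmetric in \<open>v\<close> and \<open>Y\<close> is visible.\<close>

lemma iterated_derivative_chart:
  assumes A: "smooth_atlas A" and U: "(U, \<phi>) \<in> A" "p \<in> U"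
    and v: "v \<in> tangent_space A p" and Y: "vector_field A Y" and f: "smooth_fun_at A p f"
  defines "F \<equiv> \<lambda>z. f (inv_into U \<phi> z)" and "y \<equiv> \<lambda>z. components \<phi> (Y (inv_into U \<phi> z))"
  shows "v (\<lambda>q. Y q f) =
    frechet_derivative (\<lambda>z. frechet_derivative F (at z) (y (\<phi> p))) (at (\<phi> p)) (components \<phi> v)
    + frechet_derivative F (at (\<phi> p)) (frechet_derivative y (at (\<phi> p)) (components \<phi> v))"
proof -
  have F: "smooth_near (\<phi> p) F" using f unfolding smooth_fun_at_chart[OF A U] F_def .
  have y: "smooth_near (\<phi> p) y" unfolding y_def by (rule vector_field_smooth_components[OF A U Y])
  have Yf: "smooth_fun_at A p (\<lambda>q. Y q f)" by (rule vector_field_smooth[OF A Y f])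
  have "\<forall>\<^sub>F z in nhds (\<phi> p). Y (inv_into U \<phi> z) f = frechet_derivative F (at z) (y z)"
    using eventually_nhds_chart_range[OF A U] smooth_near_eventually[OF F]
  proof eventually_elim
    case (elim z)
    let ?q = "inv_into U \<phi> z"
    have q: "?q \<in> U" "\<phi> ?q = z" using elim(1) chart_inverse[OF A U(1)] by auto
    then have "?q \<in> carrier A" using U by (auto simp: carrier_iff)
    then have "Y ?q \<in> tangent_space A ?q" using Y by (auto intro: vector_field_tangent)
    from tangent_vector_apply[OF A U(1) q(1) this, of f] show ?case
      using elim(2) q smooth_fun_at_chart[OF A U(1) q(1), of f] by (simp add: F_def y_def)
  qed
  then have "frechet_derivative (\<lambda>z. Y (inv_into U \<phi> z) f) (at (\<phi> p)) = frechet_derivative (\<lambda>z. frechet_derivative F (at z) (y z)) (at (\<phi> p))"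
    by (intro frechet_derivative_eventually_cong smooth_near_differentiable)
       (use Yf in \<open>auto simp: smooth_fun_at_chart[OF A U]\<close>)
  then show ?thesis
    using tangent_vector_apply[OF A U v Yf] derivative_of_derivative_along[OF F y] by simp
qed

text \<open>The second-order terms of \<open>X(Yf)\<close> and \<open>Y(Xf)\<close> cancel by symmetry, so the commutator is again the
derivative along a tangent vector.\<close>

lemma bracket_chart:
  assumes A: "smooth_atlas A" and U: "(U, \<phi>) \<in> A" "p \<in> U" and X: "vector_field A X" and Y: "vector_field A Y"
  defines "x \<equiv> \<lambda>z. components \<phi> (X (inv_into U \<phi> z))" and "y \<equiv> \<lambda>z. components \<phi> (Y (inv_into U \<phi> z))"
  shows "bracket A X Y p = chart_vector A U \<phi> p
    (frechet_derivative y (at (\<phi> p)) (x (\<phi> p)) - frechet_derivative x (at (\<phi> p)) (y (\<phi> p)))"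
proof
  fix f
  show "bracket A X Y p f = chart_vector A U \<phi> p
    (frechet_derivative y (at (\<phi> p)) (x (\<phi> p)) - frechet_derivative x (at (\<phi> p)) (y (\<phi> p))) f"
  proof (cases "smooth_fun_at A p f")
    case True
    have p: "p \<in> carrier A" using U by (auto simp: carrier_iff)
    let ?F = "\<lambda>z. f (inv_into U \<phi> z)"
    have F: "smooth_near (\<phi> p) ?F" using True unfolding smooth_fun_at_chart[OF A U] .
    have xy: "x (\<phi> p) = components \<phi> (X p)" "y (\<phi> p) = components \<phi> (Y p)"
      by (simp_all add: x_def y_def chart_inverse(1)[OF A U])
    have l: "linear (frechet_derivative ?F (at (\<phi> p)))"
      by (intro linear_frechet_derivative smooth_near_differentiable F)
    let ?D = "\<lambda>F. frechet_derivative F (at (\<phi> p))"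
    have "X p (\<lambda>q. Y q f) = ?D (\<lambda>z. frechet_derivative ?F (at z) (y (\<phi> p))) (x (\<phi> p)) + ?D ?F (?D y (x (\<phi> p)))"
      using iterated_derivative_chart[OF A U vector_field_tangent[OF X p] Y True]
      unfolding x_def y_def chart_inverse(1)[OF A U] .
    moreover have "Y p (\<lambda>q. X q f) = ?D (\<lambda>z. frechet_derivative ?F (at z) (x (\<phi> p))) (y (\<phi> p)) + ?D ?F (?D x (y (\<phi> p)))"
      using iterated_derivative_chart[OF A U vector_field_tangent[OF Y p] X True]
      unfolding x_def y_def chart_inverse(1)[OF A U] .
    ultimately show ?thesis
      using
        second_derivative_symmetric[OF F, of "x (\<phi> p)" "y (\<phi> p)"] linear_diff[OF l] True
      by (simp add: bracket_apply chart_vector_def)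
  qed (simp add: bracket_def chart_vector_def)
qed

lemma vector_field_bracket:
  assumes A: "smooth_atlas A" and X: "vector_field A X" and Y: "vector_field A Y"
  shows "vector_field A (bracket A X Y)"
  unfolding vector_field_iff[OF A]
proof (intro ballI conjI allI impI)
  fix p assume "p \<in> carrier A"
  then obtain U \<phi> where U: "(U, \<phi>) \<in> A" "p \<in> U" by (auto simp: carrier_iff)
  show "bracket A X Y p \<in> tangent_space A p"
    unfolding bracket_chart[OF A U X Y] tangent_space_chart[OF A U] by blast
  fix f assume f: "smooth_fun_at A p f"
  have "\<forall>\<^sub>F q in nhdsin (mtop A) p. X q (\<lambda>q. Y q f) - Y q (\<lambda>q. X q f) = bracket A X Y q f"
    using smooth_fun_at_eventually[OF A f] by eventually_elim (simp add: bracket_apply)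
  then show "smooth_fun_at A p (\<lambda>q. bracket A X Y q f)"
    by (rule smooth_fun_at_cong[OF A])
       (intro smooth_fun_at_diff[OF A] vector_field_smooth[OF A X] vector_field_smooth[OF A Y] f)
qed

lemma bracket_cong:
  assumes A: "smooth_atlas A" and p: "p \<in> carrier A"
    and "X p \<in> tangent_space A p" "Y p \<in> tangent_space A p"
    and e: "\<And>q. q \<in> carrier A \<Longrightarrow> X q = X' q" "\<And>q. q \<in> carrier A \<Longrightarrow> Y q = Y' q"
  shows "bracket A X Y p = bracket A X' Y' p"
proof
  fix f
  have "X p (\<lambda>q. Y q f) = X p (\<lambda>q. Y' q f)" "Y p (\<lambda>q. X q f) = Y p (\<lambda>q. X' q f)"
    by (rule tangent_vector_cong_carrier[OF A p], use assms in simp_all)+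
  then show "bracket A X Y p f = bracket A X' Y' p f" by (simp add: bracket_def e[OF p])
qed

lemma bracket_antisym: "bracket A X Y p = - bracket A Y X p"
  by (rule ext) (simp add: bracket_def)

lemma bracket_add_left:
  assumes A: "smooth_atlas A" and p: "p \<in> carrier A"
    and X: "vector_field A X" "vector_field A X'" and Y: "vector_field A Y"
  shows "bracket A (\<lambda>q. X q + X' q) Y p = bracket A X Y p + bracket A X' Y p"
proof
  fix f
  show "bracket A (\<lambda>q. X q + X' q) Y p f = (bracket A X Y p + bracket A X' Y p) f"
  proof (cases "smooth_fun_at A p f")
    case True
    then show ?thesis
      using tangent_vector_add[OF A vector_field_tangent[OF Y p] vector_field_smooth[OF A X(1) True] vector_field_smooth[OF A X(2) True]]
      by (simp add: bracket_apply)
  qed (simp add: bracket_def)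
qed

lemma bracket_jacobi:
  assumes A: "smooth_atlas A" and p: "p \<in> carrier A"
    and X: "vector_field A X" and Y: "vector_field A Y" and Z: "vector_field A Z"
  shows "bracket A Z (bracket A X Y) p = bracket A (bracket A Z X) Y p + bracket A X (bracket A Z Y) p"
proof
  fix f
  show "bracket A Z (bracket A X Y) p f = (bracket A (bracket A Z X) Y p + bracket A X (bracket A Z Y) p) f"
  proof (cases "smooth_fun_at A p f")
    case True
    have *: "P p (\<lambda>q. bracket A V W q f) = P p (\<lambda>q. V q (\<lambda>q. W q f)) - P p (\<lambda>q. W q (\<lambda>q. V q f))"
      if P: "vector_field A P" and V: "vector_field A V" and W: "vector_field A W" for P V W
    proof -
      note s = vector_field_smooth[OF A V vector_field_smooth[OF A W True]]
        vector_field_smooth[OF A W vector_field_smooth[OF A V True]]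
      have "\<forall>\<^sub>F q in nhdsin (mtop A) p. bracket A V W q f = V q (\<lambda>q. W q f) - W q (\<lambda>q. V q f)"
        using smooth_fun_at_eventually[OF A True] by eventually_elim (simp add: bracket_apply)
      from tangent_vector_cong[OF A p vector_field_tangent[OF P p] this] show ?thesis
        using tangent_vector_diff[OF A vector_field_tangent[OF P p] s] by simp
    qed
    show ?thesis
      using True vector_field_smooth[OF A _ True] X Y Z by (simp add: bracket_apply *)
  qed (simp add: bracket_def)
qed

section \<open>The morphisms \<open>\<rho>\<close> and \<open>\<gamma>\<close>\<close>

context
  fixes M :: "('a, 'e::euclidean_space) atlas"
  assumes M: "smooth_atlas M"
begin

lemma rho_apply: "smooth_fun_at M (fst u) g \<Longrightarrow> rho M u \<xi> g = \<xi> (\<lambda>w. g (fst w))"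
  by (simp add: rho_def differential_def o_def)

lemma linear_rho: "linear (rho M u)"
  by (intro linearI) (auto simp: rho_def differential_def)

text \<open>In the charts of the tangent bundle \<open>\<rho>\<close> keeps the first component of a vector, because functions
pulled back from the base depend on the first coordinate only.\<close>

lemma rho_chart:
  assumes U: "(U, \<phi>) \<in> M" "u \<in> slit_dom M U" and \<xi>: "\<xi> \<in> tangent_space (slit M) u"
  shows "rho M u \<xi> = chart_vector M U \<phi> (fst u) (fst (components (tb_map \<phi>) \<xi>))"
proof
  fix g
  have fu: "fst u \<in> U" using U(2) by (simp add: slit_dom_iff)
  show "rho M u \<xi> g = chart_vector M U \<phi> (fst u) (fst (components (tb_map \<phi>) \<xi>)) g"
  proof (cases "smooth_fun_at M (fst u) g")
    case True
    let ?g = "\<lambda>x. g (inv_into U \<phi> x)" and ?i = "inv_into (slit_dom M U) (tb_map \<phi>)"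
    have u: "u \<in> carrier (slit M)" using U slit_chart_mem[OF U(1)] by (auto simp: carrier_iff)
    have d: "((\<lambda>z. ?g (fst z)) has_derivative (\<lambda>w. frechet_derivative ?g (at (\<phi> (fst u))) (fst w))) (at (tb_map \<phi> u))"
    proof -
      have "(?g has_derivative frechet_derivative ?g (at (\<phi> (fst u)))) (at (fst (tb_map \<phi> u)))"
        using True smooth_near_differentiable unfolding smooth_fun_at_chart[OF M U(1) fu]
        by (auto simp: frechet_derivative_works tb_map_def split_beta)
      from diff_chain_at[OF has_derivative_fst[OF has_derivative_ident] this] show ?thesis by (simp add: o_def)
    qed
    have e: "\<forall>\<^sub>F z in nhds (tb_map \<phi> u). ?g (fst z) = g (fst (?i z))"
      using eventually_inv_slit_map[OF M U] by eventually_elim simp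
    have "frechet_derivative (\<lambda>z. g (fst (?i z))) (at (tb_map \<phi> u))
        = (\<lambda>w. frechet_derivative ?g (at (\<phi> (fst u))) (fst w))"
      using frechet_derivative_eventually_cong[OF differentiableI[OF d] e] frechet_derivative_eq[OF d] by simp
    then show ?thesis
      using tangent_vector_apply[OF smooth_atlas_slit[OF M] slit_chart_mem[OF U(1)] U(2) \<xi> smooth_fun_at_slit_fst[OF M u True]] True
      by (simp add: rho_apply chart_vector_def)
  qed (simp add: rho_def differential_def chart_vector_def)
qed

lemma rho_tangent:
  assumes u: "u \<in> carrier (slit M)" and \<xi>: "\<xi> \<in> tangent_space (slit M) u"
  shows "rho M u \<xi> \<in> tangent_space M (fst u)"
proof -
  obtain U \<phi> where U: "(U, \<phi>) \<in> M" "fst u \<in> U" "u \<in> slit_dom M U" using slit_chart_obtain[OF u] .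
  show ?thesis unfolding rho_chart[OF U(1,3) \<xi>] tangent_space_chart[OF M U(1,2)] by blast
qed

lemma pb_section_rho:
  assumes X: "vector_field (slit M) X"
  shows "pb_section M (\<lambda>u. rho M u (X u))"
  unfolding pb_section_iff[OF M]
proof (intro ballI conjI allI impI)
  fix u assume u: "u \<in> carrier (slit M)"
  show "rho M u (X u) \<in> tangent_space M (fst u)" by (rule rho_tangent[OF u vector_field_tangent[OF X u]])
  fix g assume g: "smooth_fun_at M (fst u) g"
  have "\<forall>\<^sub>F w in nhdsin (mtop (slit M)) u. X w (\<lambda>w. g (fst w)) = rho M w (X w) g"
    using eventually_smooth_fun_at_fst[OF M u g] by eventually_elim (simp add: rho_apply)
  then show "smooth_fun_at (slit M) u (\<lambda>w. rho M w (X w) g)"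
    by (rule smooth_fun_at_cong[OF smooth_atlas_slit[OF M]])
       (rule vector_field_smooth[OF smooth_atlas_slit[OF M] X smooth_fun_at_slit_fst[OF M u g]])
qed

lemma tb_map_vertical_line: "tb_map \<phi> (fst u, snd u + t *\<^sub>R v) = tb_map \<phi> u + t *\<^sub>R (0, components \<phi> v)"
  by (simp add: tb_map_def split_beta linear_add[OF linear_components] linear_cmul[OF linear_components])

lemma eventually_vertical_line:
  assumes U: "(U, \<phi>) \<in> M" "u \<in> slit_dom M U" and v: "v \<in> tangent_space M (fst u)"
  shows "\<forall>\<^sub>F t in nhds (0::real). (fst u, snd u + t *\<^sub>R v) \<in> slit_dom M U"
proof -
  have fu: "fst u \<in> U" and su: "snd u \<in> tangent_space M (fst u)" "snd u \<noteq> 0" using U(2) by (auto simp: slit_dom_iff)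
  have "fst u \<in> carrier M" using U fu by (auto simp: carrier_iff)
  from subspace_tangent_space[OF M this] have sub: "subspace (tangent_space M (fst u))" .
  let ?c = "\<lambda>t::real. components \<phi> (snd u) + t *\<^sub>R components \<phi> v"
  have "components \<phi> (snd u) \<noteq> 0" using components_eq_0_iff[OF M U(1) fu su(1)] su(2) by simp
  then have "\<forall>\<^sub>F y in nhds (?c 0). y \<in> - {0}" by (intro eventually_nhds_in_open) auto
  moreover have "filterlim ?c (nhds (?c 0)) (nhds 0)"
    by (intro smooth_near_filterlim smooth_near_add smooth_near_const smooth_near_scaleR
        smooth_near_bounded_linear bounded_linear_ident)
  ultimately have "\<forall>\<^sub>F t in nhds 0. ?c t \<in> - {0}" by (rule eventually_compose_filterlim)
  then show ?thesis
  proof eventually_elim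
    case (elim t)
    then have "snd u + t *\<^sub>R v \<noteq> 0"
      using linear_0[OF linear_components, of \<phi>] linear_add[OF linear_components, of \<phi> "snd u" "t *\<^sub>R v"]
      by (auto simp: linear_cmul[OF linear_components])
    then show ?case using fu su v sub by (auto simp: slit_dom_iff subspace_add subspace_scale)
  qed
qed

text \<open>The fibres are affine in the charts of the tangent bundle, so \<open>\<gamma>\<close> is the inclusion of the second
component.\<close>

lemma gam_chart:
  assumes U: "(U, \<phi>) \<in> M" "u \<in> slit_dom M U" and v: "v \<in> tangent_space M (fst u)"
  shows "gam M u v = chart_vector (slit M) (slit_dom M U) (tb_map \<phi>) u (0, components \<phi> v)"
proof -
  let ?c = "\<lambda>t. (fst u, snd u + t *\<^sub>R v)"
  have c0: "?c 0 = u" by simp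
  have "\<forall>\<^sub>F t in nhds (0::real). ?c t \<in> slit_dom M U \<and> tb_map \<phi> (?c t) = tb_map \<phi> (?c 0) + t *\<^sub>R (0, components \<phi> v)"
    using eventually_vertical_line[OF U v] unfolding c0 by eventually_elim (simp add: tb_map_vertical_line)
  moreover have "?c 0 \<in> slit_dom M U" using U c0 by simp
  ultimately show ?thesis
    using smooth_curve(2)[OF smooth_atlas_slit[OF M] slit_chart_mem[OF U(1)], of ?c] unfolding gam_def c0 by blast
qed

lemma components_gam:
  assumes U: "(U, \<phi>) \<in> M" "u \<in> slit_dom M U" and v: "v \<in> tangent_space M (fst u)"
  shows "components (tb_map \<phi>) (gam M u v) = (0, components \<phi> v)"
  unfolding gam_chart[OF assms]
  by (rule components_chart_vector[OF smooth_atlas_slit[OF M] slit_chart_mem[OF U(1)] U(2)])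

lemma gam_tangent:
  assumes u: "u \<in> carrier (slit M)" and v: "v \<in> tangent_space M (fst u)"
  shows "gam M u v \<in> tangent_space (slit M) u"
proof -
  obtain U \<phi> where U: "(U, \<phi>) \<in> M" "fst u \<in> U" "u \<in> slit_dom M U" using slit_chart_obtain[OF u] .
  show ?thesis
    unfolding gam_chart[OF U(1,3) v] tangent_space_chart[OF smooth_atlas_slit[OF M] slit_chart_mem[OF U(1)] U(3)] by blast
qed

lemma gam_combine:
  assumes u: "u \<in> carrier (slit M)" and v: "v \<in> tangent_space M (fst u)" and w: "w \<in> tangent_space M (fst u)"
  shows "gam M u (v + w) = gam M u v + gam M u w" "gam M u (v - w) = gam M u v - gam M u w"
proof -
  obtain U \<phi> where U: "(U, \<phi>) \<in> M" "fst u \<in> U" "u \<in> slit_dom M U" using slit_chart_obtain[OF u] .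
  have "fst u \<in> carrier M" using U by (auto simp: carrier_iff)
  note sub = subspace_tangent_space[OF M this]
  note l = linear_chart_vector[OF smooth_atlas_slit[OF M] slit_chart_mem[OF U(1)] U(3)]
  show "gam M u (v + w) = gam M u v + gam M u w"
    unfolding gam_chart[OF U(1,3) v] gam_chart[OF U(1,3) w] gam_chart[OF U(1,3) subspace_add[OF sub v w]]
    by (simp add: linear_add[OF linear_components] linear_add[OF l, symmetric])
  show "gam M u (v - w) = gam M u v - gam M u w"
    unfolding gam_chart[OF U(1,3) v] gam_chart[OF U(1,3) w] gam_chart[OF U(1,3) subspace_diff[OF sub v w]]
    by (simp add: linear_diff[OF linear_components] linear_diff[OF l, symmetric])
qed

lemma rho_gam:
  assumes u: "u \<in> carrier (slit M)" and v: "v \<in> tangent_space M (fst u)"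
  shows "rho M u (gam M u v) = 0"
proof -
  obtain U \<phi> where U: "(U, \<phi>) \<in> M" "fst u \<in> U" "u \<in> slit_dom M U" using slit_chart_obtain[OF u] .
  show ?thesis
    unfolding rho_chart[OF U(1,3) gam_tangent[OF u v]] components_gam[OF U(1,3) v]
    by (simp add: linear_0[OF linear_chart_vector[OF M U(1,2)]])
qed

lemma gam_0: "u \<in> carrier (slit M) \<Longrightarrow> gam M u 0 = 0"
  using gam_combine(2)[of u "snd u" "snd u"] by (simp add: carrier_slit_iff)

lemma gam_apply_chart:
  assumes U: "(U, \<phi>) \<in> M" "u \<in> slit_dom M U" and v: "v \<in> tangent_space M (fst u)"
    and f: "smooth_fun_at (slit M) u f"
  shows "gam M u v f = frechet_derivative (\<lambda>z. f (inv_into (slit_dom M U) (tb_map \<phi>) z)) (at (tb_map \<phi> u)) (0, components \<phi> v)"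
  using f unfolding gam_chart[OF U v] by (simp add: chart_vector_def)

lemma gam_apply_deriv:
  "smooth_fun_at (slit M) u f \<Longrightarrow> gam M u v f = deriv (\<lambda>t. f (fst u, snd u + t *\<^sub>R v)) 0"
  by (simp add: gam_def velocity_def o_def)

lemma pb_section_components:
  assumes U: "(U, \<phi>) \<in> M" "u \<in> slit_dom M U" and s: "pb_section M s"
  shows "smooth_near (tb_map \<phi> u) (\<lambda>z. components \<phi> (s (inv_into (slit_dom M U) (tb_map \<phi>) z)))"
proof (rule smooth_components_near[OF smooth_atlas_slit[OF M] slit_chart_mem[OF U(1)] U(2)])
  fix b :: 'e
  have "u \<in> carrier (slit M)" using U slit_chart_mem[OF U(1)] by (auto simp: carrier_iff)
  moreover have "fst u \<in> U" using U(2) by (simp add: slit_dom_iff)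
  ultimately show "smooth_fun_at (slit M) u (\<lambda>q. s q (\<lambda>x. \<phi> x \<bullet> b))"
    using s chart_coordinate(1)[OF M U(1)] unfolding pb_section_iff[OF M] by blast
qed

lemma eventually_gam_apply:
  assumes U: "(U, \<phi>) \<in> M" "u \<in> slit_dom M U" and s: "pb_section M s" and f: "smooth_fun_at (slit M) u f"
  defines "F \<equiv> \<lambda>z. f (inv_into (slit_dom M U) (tb_map \<phi>) z)"
    and "k \<equiv> \<lambda>z. (0, components \<phi> (s (inv_into (slit_dom M U) (tb_map \<phi>) z)))"
  shows "\<forall>\<^sub>F z in nhds (tb_map \<phi> u). frechet_derivative F (at z) (k z)
    = gam M (inv_into (slit_dom M U) (tb_map \<phi>) z) (s (inv_into (slit_dom M U) (tb_map \<phi>) z)) f"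
    and "smooth_near (tb_map \<phi> u) F" and "smooth_near (tb_map \<phi> u) k"
proof -
  note S = smooth_atlas_slit[OF M] and C = slit_chart_mem[OF U(1)]
  show F: "smooth_near (tb_map \<phi> u) F" using f unfolding smooth_fun_at_chart[OF S C U(2)] F_def .
  show "smooth_near (tb_map \<phi> u) k"
    unfolding k_def by (intro smooth_near_Pair smooth_near_const pb_section_components[OF U s])
  show "\<forall>\<^sub>F z in nhds (tb_map \<phi> u). frechet_derivative F (at z) (k z)
    = gam M (inv_into (slit_dom M U) (tb_map \<phi>) z) (s (inv_into (slit_dom M U) (tb_map \<phi>) z)) f"
    using eventually_nhds_chart_range[OF S C U(2)] smooth_near_eventually[OF F]
  proof eventually_elim
    case (elim z)
    let ?w = "inv_into (slit_dom M U) (tb_map \<phi>) z"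
    have w: "?w \<in> slit_dom M U" "tb_map \<phi> ?w = z" using elim(1) chart_inverse[OF S C] by auto
    then have "?w \<in> carrier (slit M)" using C by (auto simp: carrier_iff)
    then have "s ?w \<in> tangent_space M (fst ?w)" using s by (simp add: pb_section_def)
    from gam_apply_chart[OF U(1) w(1) this, of f] show ?case
      using elim(2) w smooth_fun_at_chart[OF S C w(1), of f] by (simp add: F_def k_def)
  qed
qed

lemma vector_field_gam:
  assumes s: "pb_section M s"
  shows "vector_field (slit M) (\<lambda>w. gam M w (s w))"
  unfolding vector_field_iff[OF smooth_atlas_slit[OF M]]
proof (intro ballI conjI allI impI)
  fix u assume u: "u \<in> carrier (slit M)"
  show "gam M u (s u) \<in> tangent_space (slit M) u"
    using s u by (intro gam_tangent) (auto simp: pb_section_def)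
  obtain U \<phi> where U: "(U, \<phi>) \<in> M" "fst u \<in> U" "u \<in> slit_dom M U" using slit_chart_obtain[OF u] .
  fix f assume f: "smooth_fun_at (slit M) u f"
  note e = eventually_gam_apply[OF U(1,3) s f]
  show "smooth_fun_at (slit M) u (\<lambda>w. gam M w (s w) f)"
    unfolding smooth_fun_at_chart[OF smooth_atlas_slit[OF M] slit_chart_mem[OF U(1)] U(3)]
    by (rule smooth_near_cong[OF e(1) smooth_near_derivative_along[where h = "\<lambda>z. z", OF _ e(3,2)]])
       (rule smooth_near_bounded_linear[OF bounded_linear_ident])
qed

lemma gam_base: "gam M u v (\<lambda>w. g (fst w)) = 0"
  by (simp add: gam_def velocity_def o_def)

text \<open>Vertical fields annihilate functions pulled back from the base, so only one term of the bracket
survives and it sees \<open>Y\<close> only through \<open>\<rho>Y\<close>. This is what gives a meaning to \<open>\<rho>[\<gamma>X,\<beta>Y]\<close> while the smoothness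
of \<open>\<beta>Y\<close> is still unknown.\<close>

lemma rho_bracket_gam:
  assumes u: "u \<in> carrier (slit M)" and X: "X u \<in> tangent_space M (fst u)" and Y: "Y u \<in> tangent_space (slit M) u"
    and g: "smooth_fun_at M (fst u) g"
  shows "rho M u (bracket (slit M) (\<lambda>w. gam M w (X w)) Y u) g = gam M u (X u) (\<lambda>w. rho M w (Y w) g)"
proof -
  note S = smooth_atlas_slit[OF M]
  have "\<forall>\<^sub>F w in nhdsin (mtop (slit M)) u. Y w (\<lambda>w. g (fst w)) = rho M w (Y w) g"
    using eventually_smooth_fun_at_fst[OF M u g] by eventually_elim (simp add: rho_apply)
  then have "gam M u (X u) (\<lambda>w. Y w (\<lambda>w. g (fst w))) = gam M u (X u) (\<lambda>w. rho M w (Y w) g)"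
    by (rule tangent_vector_cong[OF S u gam_tangent[OF u X]])
  then show ?thesis
    by (simp add: rho_apply[OF g] bracket_apply[OF smooth_fun_at_slit_fst[OF M u g]] gam_base
        tangent_vector_const[OF S Y u])
qed

lemma pb_section_fundamental: "pb_section M fundamental"
  unfolding pb_section_iff[OF M]
proof (intro ballI conjI allI impI)
  fix u assume u: "u \<in> carrier (slit M)"
  then show "fundamental u \<in> tangent_space M (fst u)" by (simp add: fundamental_def carrier_slit_iff)
  obtain U \<phi> where U: "(U, \<phi>) \<in> M" "fst u \<in> U" "u \<in> slit_dom M U" using slit_chart_obtain[OF u] .
  fix g assume g: "smooth_fun_at M (fst u) g"
  let ?g = "\<lambda>x. g (inv_into U \<phi> x)"
  have fu: "fst (tb_map \<phi> u) = \<phi> (fst u)" by (simp add: tb_map_def split_beta)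
  have gs: "smooth_near (fst (tb_map \<phi> u)) ?g" using g unfolding fu smooth_fun_at_chart[OF M U(1,2)] .
  show "smooth_fun_at (slit M) u (\<lambda>w. fundamental w g)"
    unfolding smooth_fun_at_chart[OF smooth_atlas_slit[OF M] slit_chart_mem[OF U(1)] U(3)]
  proof (rule smooth_near_cong)
    show "smooth_near (tb_map \<phi> u) (\<lambda>z. frechet_derivative ?g (at (fst z)) (snd z))"
      by (intro smooth_near_derivative_along gs smooth_near_bounded_linear bounded_linear_fst bounded_linear_snd)
    have "\<forall>\<^sub>F z in nhds (tb_map \<phi> u). smooth_near (fst z) ?g"
      by (rule eventually_compose_filterlim[OF smooth_near_eventually[OF gs]
            smooth_near_filterlim[OF smooth_near_bounded_linear[OF bounded_linear_fst]]])
    then show "\<forall>\<^sub>F z in nhds (tb_map \<phi> u). frechet_derivative ?g (at (fst z)) (snd z)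
      = fundamental (inv_into (slit_dom M U) (tb_map \<phi>) z) g"
      using eventually_inv_slit_map[OF M U(1,3)]
    proof eventually_elim
      case (elim z)
      let ?p = "inv_into U \<phi> (fst z)"
      have p: "?p \<in> U" "\<phi> ?p = fst z" using elim(2) chart_inverse(2,3)[OF M U(1), of "fst z"] by auto
      then have "smooth_fun_at M ?p g" using elim(1) by (simp add: smooth_fun_at_chart[OF M U(1) p(1)])
      then show ?case using elim(2) p by (simp add: fundamental_def chart_vector_def)
    qed
  qed
qed

text \<open>The fundamental section is the identity on each fibre, so its derivative along the fibre in the
direction \<open>v\<close> is \<open>v\<close>.\<close>

lemma gam_fundamental:
  assumes u: "u \<in> carrier (slit M)" and g: "smooth_fun_at M (fst u) g"
  shows "gam M u v (\<lambda>w. fundamental w g) = v g"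
proof -
  have "smooth_fun_at (slit M) u (\<lambda>w. fundamental w g)"
    using pb_section_fundamental u g unfolding pb_section_iff[OF M] by blast
  then have "gam M u v (\<lambda>w. fundamental w g) = deriv (\<lambda>t. snd u g + t * v g) 0"
    by (simp add: gam_apply_deriv fundamental_def)
  also have "\<dots> = v g"
    by (rule DERIV_imp_deriv) (auto intro!: derivative_eq_intros)
  finally show ?thesis .
qed

section \<open>The energy and its fibrewise Hessian\<close>

lemma smooth_energy:
  assumes L: "smooth_fun (slit M) L" and u: "u \<in> carrier (slit M)"
  shows "smooth_fun_at (slit M) u (energy L)"
proof -
  obtain U \<phi> where U: "(U, \<phi>) \<in> M" "fst u \<in> U" "u \<in> slit_dom M U" using slit_chart_obtain[OF u] .
  note C = smooth_fun_at_chart[OF smooth_atlas_slit[OF M] slit_chart_mem[OF U(1)] U(3)]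
  have "smooth_near (tb_map \<phi> u) (\<lambda>z. L (inv_into (slit_dom M U) (tb_map \<phi>) z))"
    using bspec[OF L[unfolded smooth_fun_def] u] unfolding C .
  from smooth_near_linear_comp[OF bounded_linear_divide smooth_near_bilinear[OF bounded_bilinear_mult this this], of 2]
  show ?thesis unfolding C energy_def by (simp add: power2_eq_square)
qed

context
  fixes L :: "'a tpt \<Rightarrow> real"
  assumes L: "smooth_fun (slit M) L"
begin

text \<open>Bilinearity and symmetry of the Finsler metric come from this description as a second
derivative of one function.\<close>

lemma finsler_metric_chart:
  assumes U: "(U, \<phi>) \<in> M" "u \<in> slit_dom M U"
    and v: "v \<in> tangent_space M (fst u)" and w: "w \<in> tangent_space M (fst u)"
  defines "F \<equiv> \<lambda>z. energy L (inv_into (slit_dom M U) (tb_map \<phi>) z)"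
  shows "finsler_metric L u v w =
    frechet_derivative (\<lambda>z. frechet_derivative F (at z) (0, components \<phi> w)) (at (tb_map \<phi> u)) (0, components \<phi> v)"
    and "smooth_near (tb_map \<phi> u) F"
proof -
  note S = smooth_atlas_slit[OF M] and C = slit_chart_mem[OF U(1)]
  have u: "u \<in> carrier (slit M)" using U C by (auto simp: carrier_iff)
  show F: "smooth_near (tb_map \<phi> u) F"
    using smooth_energy[OF L u] unfolding smooth_fun_at_chart[OF S C U(2)] F_def .
  let ?v = "(0, components \<phi> v) :: 'e \<times> 'e" and ?w = "(0, components \<phi> w) :: 'e \<times> 'e"
  have "\<forall>\<^sub>F s in nhds 0. deriv (\<lambda>t. energy L (fst u, snd u + s *\<^sub>R v + t *\<^sub>R w)) 0
      = frechet_derivative F (at (tb_map \<phi> u + s *\<^sub>R ?v)) ?w"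
    using eventually_vertical_line[OF U v]
  proof eventually_elim
    case (elim s)
    let ?u = "(fst u, snd u + s *\<^sub>R v)"
    have us: "?u \<in> carrier (slit M)" using elim C by (auto simp: carrier_iff)
    have "deriv (\<lambda>t. energy L (fst u, snd u + s *\<^sub>R v + t *\<^sub>R w)) 0 = gam M ?u w (energy L)"
      by (simp add: gam_apply_deriv[OF smooth_energy[OF L us]])
    also have "\<dots> = frechet_derivative F (at (tb_map \<phi> ?u)) ?w"
      unfolding F_def by (rule gam_apply_chart[OF U(1) elim _ smooth_energy[OF L us]]) (simp add: w)
    finally show ?case by (simp only: tb_map_vertical_line)
  qed
  then have "finsler_metric L u v w = deriv (\<lambda>s. frechet_derivative F (at (tb_map \<phi> u + s *\<^sub>R ?v)) ?w) 0"
    unfolding finsler_metric_def by (rule deriv_cong_ev) simp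
  also have "\<dots> = frechet_derivative (\<lambda>z. frechet_derivative F (at z) ?w) (at (tb_map \<phi> u)) ?v"
    by (intro DERIV_imp_deriv has_real_derivative_along_line_0[of "\<lambda>z. frechet_derivative F (at z) ?w"]
        smooth_near_differentiable smooth_near_frechet_derivative F)
  finally show "finsler_metric L u v w =
    frechet_derivative (\<lambda>z. frechet_derivative F (at z) ?w) (at (tb_map \<phi> u)) ?v" .
qed

lemma finsler_metric_commute:
  assumes u: "u \<in> carrier (slit M)" and v: "v \<in> tangent_space M (fst u)" and w: "w \<in> tangent_space M (fst u)"
  shows "finsler_metric L u v w = finsler_metric L u w v"
proof -
  obtain U \<phi> where U: "(U, \<phi>) \<in> M" "fst u \<in> U" "u \<in> slit_dom M U" using slit_chart_obtain[OF u] .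
  show ?thesis
    unfolding finsler_metric_chart(1)[OF U(1,3) v w] finsler_metric_chart(1)[OF U(1,3) w v]
    by (rule second_derivative_symmetric[OF finsler_metric_chart(2)[OF U(1,3) v w]])
qed

lemma finsler_metric_linear:
  assumes u: "u \<in> carrier (slit M)" and v: "v \<in> tangent_space M (fst u)" and w: "w \<in> tangent_space M (fst u)"
    and x: "x \<in> tangent_space M (fst u)"
  shows "finsler_metric L u (v + w) x = finsler_metric L u v x + finsler_metric L u w x"
    and "finsler_metric L u (v - w) x = finsler_metric L u v x - finsler_metric L u w x"
proof -
  obtain U \<phi> where U: "(U, \<phi>) \<in> M" "fst u \<in> U" "u \<in> slit_dom M U" using slit_chart_obtain[OF u] .
  have "fst u \<in> carrier M" using U by (auto simp: carrier_iff)
  note sub = subspace_tangent_space[OF M this]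
  note c = finsler_metric_chart[OF U(1,3) _ x]
  let ?F = "\<lambda>z. energy L (inv_into (slit_dom M U) (tb_map \<phi>) z)"
  have l: "linear (frechet_derivative (\<lambda>z. frechet_derivative ?F (at z) (0, components \<phi> x)) (at (tb_map \<phi> u)))"
    by (intro linear_frechet_derivative smooth_near_differentiable smooth_near_frechet_derivative c(2)[OF v])
  show "finsler_metric L u (v + w) x = finsler_metric L u v x + finsler_metric L u w x"
    unfolding c(1)[OF v] c(1)[OF w] c(1)[OF subspace_add[OF sub v w]]
    by (simp add: linear_add[OF linear_components] linear_add[OF l, symmetric])
  show "finsler_metric L u (v - w) x = finsler_metric L u v x - finsler_metric L u w x"
    unfolding c(1)[OF v] c(1)[OF w] c(1)[OF subspace_diff[OF sub v w]]
    by (simp add: linear_diff[OF linear_components] linear_diff[OF l, symmetric])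
qed

lemma finsler_metric_0:
  assumes u: "u \<in> carrier (slit M)" and x: "x \<in> tangent_space M (fst u)"
  shows "finsler_metric L u 0 x = 0" "finsler_metric L u x 0 = 0"
proof -
  show "finsler_metric L u 0 x = 0" using finsler_metric_linear(2)[OF u x x x] by simp
  moreover have "(0 :: 'a tvec) \<in> tangent_space M (fst u)"
    using u subspace_0[OF subspace_tangent_space[OF M]] by (auto simp: carrier_slit_iff)
  ultimately show "finsler_metric L u x 0 = 0" using finsler_metric_commute[OF u x] by simp
qed

text \<open>The Hessian formula. The vector \<open>V\<close> is the derivative of the section \<open>Z\<close> along the fibre in the
direction \<open>x\<close>; it accounts for the term in which \<open>Z\<close> is differentiated.\<close>

lemma iterated_vertical_derivative_energy:
  assumes u: "u \<in> carrier (slit M)" and Z: "pb_section M Z"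
    and x: "x \<in> tangent_space M (fst u)" and V: "V \<in> tangent_space M (fst u)"
    and VZ: "\<And>g. smooth_fun_at M (fst u) g \<Longrightarrow> V g = gam M u x (\<lambda>w. Z w g)"
  shows "gam M u x (\<lambda>w. gam M w (Z w) (energy L)) = finsler_metric L u x (Z u) + gam M u V (energy L)"
proof -
  obtain U \<phi> where U: "(U, \<phi>) \<in> M" "fst u \<in> U" "u \<in> slit_dom M U" using slit_chart_obtain[OF u] .
  note S = smooth_atlas_slit[OF M] and C = slit_chart_mem[OF U(1)]
  let ?i = "inv_into (slit_dom M U) (tb_map \<phi>)" and ?z = "tb_map \<phi> u"
  let ?D = "\<lambda>f. frechet_derivative f (at ?z)"
  define F where "F = (\<lambda>z. energy L (?i z))"
  define c where "c = (\<lambda>z. components \<phi> (Z (?i z)))"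
  have Zu: "Z u \<in> tangent_space M (fst u)" using Z u by (simp add: pb_section_def)
  have E: "smooth_fun_at (slit M) u (energy L)" by (rule smooth_energy[OF L u])
  have e: "\<forall>\<^sub>F z in nhds ?z. frechet_derivative F (at z) (0, c z) = gam M (?i z) (Z (?i z)) (energy L)"
    and F: "smooth_near ?z F" and k: "smooth_near ?z (\<lambda>z. (0 :: 'e, c z))"
    unfolding F_def c_def by (rule eventually_gam_apply[OF U(1,3) Z E])+
  have cs: "smooth_near ?z c" unfolding c_def by (rule pb_section_components[OF U(1,3) Z])
  have dc: "(c has_derivative ?D c) (at ?z)"
    using smooth_near_differentiable[OF cs] by (simp add: frechet_derivative_works)
  let ?x = "(0, components \<phi> x) :: 'e \<times> 'e"
  have iz: "?i ?z = u" by (rule chart_inverse(1)[OF S C U(3)])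
  have sm: "smooth_fun_at (slit M) u (\<lambda>w. gam M w (Z w) (energy L))"
    by (rule vector_field_smooth[OF S vector_field_gam[OF Z] E])
  have "gam M u x (\<lambda>w. gam M w (Z w) (energy L)) = ?D (\<lambda>z. gam M (?i z) (Z (?i z)) (energy L)) ?x"
    by (rule gam_apply_chart[OF U(1,3) x sm])
  also have "\<dots> = ?D (\<lambda>z. frechet_derivative F (at z) (0, c z)) ?x"
    using smooth_near_derivative_along[OF smooth_near_bounded_linear[OF bounded_linear_ident] k F]
    by (subst frechet_derivative_eventually_cong[OF _ e]) (auto intro: smooth_near_differentiable)
  also have "\<dots> = ?D (\<lambda>z. frechet_derivative F (at z) (0, c ?z)) ?x + ?D F (?D (\<lambda>z. (0, c z)) ?x)"
    by (rule derivative_of_derivative_along[OF F k])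
  also have "?D (\<lambda>z. (0, c z)) ?x = (0, ?D c ?x)"
    unfolding frechet_derivative_eq[OF has_derivative_Pair[OF has_derivative_const dc]] by (rule refl)
  also have "?D c ?x = components \<phi> V"
  proof -
    have "V (\<lambda>q. \<phi> q \<bullet> b) = ?D c ?x \<bullet> b" if b: "b \<in> Basis" for b
    proof -
      note cb = chart_coordinate(1)[OF M U(1,2), of b]
      have s: "smooth_fun_at (slit M) u (\<lambda>w. Z w (\<lambda>q. \<phi> q \<bullet> b))"
        using Z u cb unfolding pb_section_iff[OF M] by blast
      have "V (\<lambda>q. \<phi> q \<bullet> b) = ?D (\<lambda>z. c z \<bullet> b) ?x"
        unfolding VZ[OF cb] gam_apply_chart[OF U(1,3) x s] c_def components_def
        using b by (simp add: inner_sum_left_Basis)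
      then show ?thesis using frechet_derivative_eq[OF has_derivative_inner_left[OF dc]] by simp
    qed
    then show ?thesis by (simp add: components_def euclidean_representation)
  qed
  also have "?D F (0, components \<phi> V) = gam M u V (energy L)"
    unfolding F_def by (rule gam_apply_chart[OF U(1,3) V E, symmetric])
  also have "?D (\<lambda>z. frechet_derivative F (at z) (0, c ?z)) ?x = finsler_metric L u x (Z u)"
    unfolding finsler_metric_chart(1)[OF U(1,3) x Zu] by (simp add: F_def c_def iz)
  finally show ?thesis .
qed

context
  assumes hom: "\<And>p v c. (p, v) \<in> carrier (tangent_bundle M) \<Longrightarrow> c > 0 \<Longrightarrow> L (p, c *\<^sub>R v) = c * L (p, v)"
begin

lemma energy_homogeneous:
  assumes "p \<in> carrier M" "v \<in> tangent_space M p" "c > 0"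
  shows "energy L (p, c *\<^sub>R v) = c\<^sup>2 * energy L (p, v)"
proof -
  have "(p, v) \<in> carrier (tangent_bundle M)"
    using assms(1,2) unfolding carrier_iff tangent_bundle_eq tb_dom_def by blast
  from hom[OF this assms(3)] show ?thesis by (simp add: energy_def power_mult_distrib)
qed

text \<open>Along the ray \<open>t \<mapsto> (1 + t) u\<close> the energy is \<open>(1 + t)\<^sup>2 E(u)\<close>.\<close>

lemma euler_energy:
  assumes u: "u \<in> carrier (slit M)"
  shows "gam M u (snd u) (energy L) = 2 * energy L u"
proof -
  have "\<forall>\<^sub>F t in nhds (0::real). t \<in> {-1<..}" by (rule eventually_nhds_in_open) auto
  then have e: "\<forall>\<^sub>F t in nhds (0::real). energy L (fst u, snd u + t *\<^sub>R snd u) = (1 + t)\<^sup>2 * energy L u"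
  proof eventually_elim
    case (elim t)
    then show ?case
      using energy_homogeneous[of "fst u" "snd u" "1 + t"] u by (simp add: carrier_slit_iff scaleR_add_left)
  qed
  have "gam M u (snd u) (energy L) = deriv (\<lambda>t. energy L (fst u, snd u + t *\<^sub>R snd u)) 0"
    by (rule gam_apply_deriv[OF smooth_energy[OF L u]])
  also have "\<dots> = deriv (\<lambda>t. (1 + t)\<^sup>2 * energy L u) 0"
    by (rule deriv_cong_ev[OF e]) simp
  also have "\<dots> = 2 * energy L u"
    by (rule DERIV_imp_deriv) (auto intro!: derivative_eq_intros)
  finally show ?thesis .
qed

text \<open>Homogeneity of degree 2 makes the fibre derivative of \<open>E\<close> homogeneous of degree 1:
\<open>E((1 + s) u + t w) = (1 + s)\<^sup>2 E(u + t/(1 + s) w)\<close>.\<close>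

lemma finsler_metric_fundamental:
  assumes u: "u \<in> carrier (slit M)" and w: "w \<in> tangent_space M (fst u)"
  shows "finsler_metric L u (snd u) w = gam M u w (energy L)"
proof -
  have fu: "fst u \<in> carrier M" and su: "snd u \<in> tangent_space M (fst u)" using u by (auto simp: carrier_slit_iff)
  note sub = subspace_tangent_space[OF M fu]
  have "\<forall>\<^sub>F s in nhds (0::real). s \<in> {-1<..}" by (rule eventually_nhds_in_open) auto
  then have e: "\<forall>\<^sub>F s in nhds (0::real). deriv (\<lambda>t. energy L (fst u, snd u + s *\<^sub>R snd u + t *\<^sub>R w)) 0
      = (1 + s) * gam M u w (energy L)"
  proof eventually_elim
    case (elim s)
    then have s: "1 + s > 0" by simp
    obtain U \<phi> where U: "(U, \<phi>) \<in> M" "fst u \<in> U" "u \<in> slit_dom M U" using slit_chart_obtain[OF u] .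
    have "((\<lambda>t. energy L (fst u, snd u + t *\<^sub>R w)) has_real_derivative gam M u w (energy L)) (at 0)"
    proof -
      let ?F = "\<lambda>z. energy L (inv_into (slit_dom M U) (tb_map \<phi>) z)"
      have d: "((\<lambda>t. ?F (tb_map \<phi> u + t *\<^sub>R (0, components \<phi> w))) has_real_derivative gam M u w (energy L)) (at 0)"
        unfolding gam_apply_chart[OF U(1,3) w smooth_energy[OF L u]]
        by (intro has_real_derivative_along_line_0[of ?F] smooth_near_differentiable finsler_metric_chart(2)[OF U(1,3) w w])
      obtain T where T: "open T" "0 \<in> T" "\<forall>t\<in>T. (fst u, snd u + t *\<^sub>R w) \<in> slit_dom M U"
        using eventually_vertical_line[OF U(1,3) w] unfolding eventually_nhds by blast
      have eq: "?F (tb_map \<phi> u + t *\<^sub>R (0, components \<phi> w)) = energy L (fst u, snd u + t *\<^sub>R w)" if "t \<in> T" for t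
        using chart_inverse(1)[OF smooth_atlas_slit[OF M] slit_chart_mem[OF U(1)] bspec[OF T(3) that]]
        by (simp only: tb_map_vertical_line)
      show ?thesis by (rule has_field_derivative_transform_within_open[OF d T(1,2) eq])
    qed
    then have d: "((\<lambda>t. energy L (fst u, snd u + t *\<^sub>R w)) has_real_derivative gam M u w (energy L)) (at (0 / (1 + s)))"
      by simp
    have "((\<lambda>t. t / (1 + s)) has_real_derivative 1 / (1 + s)) (at 0)"
      by (intro DERIV_cdivide DERIV_ident)
    from DERIV_chain2[OF d this]
    have "((\<lambda>t. (1 + s)\<^sup>2 * energy L (fst u, snd u + (t / (1 + s)) *\<^sub>R w)) has_real_derivative
        (1 + s)\<^sup>2 * (gam M u w (energy L) * (1 / (1 + s)))) (at 0)"
      by (rule DERIV_cmult)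
    moreover have "(1 + s)\<^sup>2 * energy L (fst u, snd u + (t / (1 + s)) *\<^sub>R w)
        = energy L (fst u, snd u + s *\<^sub>R snd u + t *\<^sub>R w)" for t
    proof -
      have v: "snd u + (t / (1 + s)) *\<^sub>R w \<in> tangent_space M (fst u)"
        using su w by (intro subspace_add[OF sub] subspace_scale[OF sub])
      have "(1 + s) *\<^sub>R (snd u + (t / (1 + s)) *\<^sub>R w) = snd u + s *\<^sub>R snd u + t *\<^sub>R w"
        using s by (simp add: scaleR_add_right scaleR_add_left)
      then show ?thesis using energy_homogeneous[OF fu v s] by simp
    qed
    moreover have "(1 + s)\<^sup>2 * (gam M u w (energy L) * (1 / (1 + s))) = (1 + s) * gam M u w (energy L)"
      using s by (simp add: power2_eq_square)
    ultimately show ?case by (auto intro: DERIV_imp_deriv)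
  qed
  have "finsler_metric L u (snd u) w = deriv (\<lambda>s. (1 + s) * gam M u w (energy L)) 0"
    unfolding finsler_metric_def by (rule deriv_cong_ev[OF e]) simp
  also have "\<dots> = gam M u w (energy L)"
    by (rule DERIV_imp_deriv) (auto intro!: derivative_eq_intros)
  finally show ?thesis .
qed

end
end
end

section \<open>Linear connections\<close>

lemma linear_connection_combine:
  assumes D: "linear_connection M D" and u: "u \<in> carrier (slit M)" and Y: "pb_section M Y"
    and \<xi>: "\<xi> \<in> tangent_space (slit M) u" and \<zeta>: "\<zeta> \<in> tangent_space (slit M) u"
  shows "D u (\<xi> + \<zeta>) Y = D u \<xi> Y + D u \<zeta> Y" and "D u (\<xi> - \<zeta>) Y = D u \<xi> Y - D u \<zeta> Y"
proof -
  have "D u (a *\<^sub>R \<xi> + b *\<^sub>R \<zeta>) Y = a *\<^sub>R D u \<xi> Y + b *\<^sub>R D u \<zeta> Y" for a b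
    using assms unfolding linear_connection_def by blast
  from this[of 1 1] this[of 1 "-1"] show "D u (\<xi> + \<zeta>) Y = D u \<xi> Y + D u \<zeta> Y" "D u (\<xi> - \<zeta>) Y = D u \<xi> Y - D u \<zeta> Y"
    by simp_all
qed

lemma linear_connection_leibniz:
  assumes "linear_connection M D" "u \<in> carrier (slit M)" "pb_section M Y"
    "\<xi> \<in> tangent_space (slit M) u" "smooth_fun (slit M) f"
  shows "D u \<xi> (\<lambda>w. f w *\<^sub>R Y w) = \<xi> f *\<^sub>R Y u + f u *\<^sub>R D u \<xi> Y"
  using assms unfolding linear_connection_def by blast

lemma linear_connection_section:
  assumes "linear_connection M D" "vector_field (slit M) X" "pb_section M Y"
  shows "pb_section M (\<lambda>u. D u (X u) Y)"
  using assms unfolding linear_connection_def by blast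

text \<open>Two sections that agree on the slit tangent bundle have the same product with its
indicator function, which is smooth with vanishing derivatives.\<close>

lemma linear_connection_cong:
  assumes M: "smooth_atlas M" and D: "linear_connection M D" and u: "u \<in> carrier (slit M)" and Y: "pb_section M Y"
    and \<xi>: "\<xi> \<in> tangent_space (slit M) u" and e: "\<And>w. w \<in> carrier (slit M) \<Longrightarrow> Y w = Z w"
  shows "D u \<xi> Y = D u \<xi> Z"
proof -
  note S = smooth_atlas_slit[OF M]
  \<comment> \<open>multiplication by the indicator function makes the two sections equal as functions\<close>
  define f :: "'a tpt \<Rightarrow> real" where "f = (\<lambda>w. if w \<in> carrier (slit M) then 1 else 0)"
  have ev: "\<forall>\<^sub>F w in nhdsin (mtop (slit M)) v. 1 = f w" for v
    using eventually_nhdsin_carrier[OF S] by eventually_elim (simp add: f_def)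
  have f: "smooth_fun (slit M) f"
    unfolding smooth_fun_def using smooth_fun_at_cong[OF S ev smooth_fun_at_const[OF S]] by blast
  have "\<xi> f = \<xi> (\<lambda>w. 1)" by (rule tangent_vector_cong_carrier[OF S u \<xi>]) (simp add: f_def)
  then have "\<xi> f = 0" using tangent_vector_const[OF S \<xi> u] by simp
  moreover have "f u = 1" using u by (simp add: f_def)
  moreover have "(\<lambda>w. f w *\<^sub>R Y w) = (\<lambda>w. f w *\<^sub>R Z w)" by (rule ext) (simp add: f_def e)
  ultimately show ?thesis
    using linear_connection_leibniz[OF D u Y \<xi> f]
      linear_connection_leibniz[OF D u pb_section_cong[OF M Y e] \<xi> f] by simp
qed

lemma linear_connection_zero:
  assumes M: "smooth_atlas M" and D: "linear_connection M D" and u: "u \<in> carrier (slit M)"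
    and \<xi>: "\<xi> \<in> tangent_space (slit M) u" and e: "\<And>w. w \<in> carrier (slit M) \<Longrightarrow> Z w = 0"
  shows "D u \<xi> Z = 0"
proof -
  have z: "pb_section M (\<lambda>w. 0)"
    using pb_section_diff[OF M pb_section_fundamental[OF M] pb_section_fundamental[OF M]] by simp
  have "smooth_fun (slit M) (\<lambda>w. 0)"
    unfolding smooth_fun_def using smooth_fun_at_const[OF smooth_atlas_slit[OF M]] by blast
  from linear_connection_leibniz[OF D u z \<xi> this] have "D u \<xi> (\<lambda>w. 0) = 0" by simp
  then show ?thesis using linear_connection_cong[OF M D u z \<xi>, of Z] e by simp
qed

section \<open>The 2-form \<open>\<Omega>\<close> and the canonical spray\<close>

text \<open>The data of the theorem, fixed once for the coordinate-free part of the proof.\<close>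

locale barthel_setting =
  fixes M :: "('a, 'e::euclidean_space) atlas"
    and L :: "'a tpt \<Rightarrow> real"
    and D :: "'a conn"
    and G :: "'a tpt \<Rightarrow> 'a tpt tvec"
  assumes finsler: "finsler_manifold M L"
    and spray: "canonical_spray M L G"
    and regular: "regular_connection M D"
    and metric: "metric_connection M L D"
    and Q_zero: "\<And>X Y u. pb_section M X \<Longrightarrow> pb_section M Y \<Longrightarrow> u \<in> carrier (slit M) \<Longrightarrow>
                   h_torsion M D X Y u = 0"
    and T_sym: "\<And>X Y Z u. pb_section M X \<Longrightarrow> pb_section M Y \<Longrightarrow> pb_section M Z \<Longrightarrow>
                   u \<in> carrier (slit M) \<Longrightarrow>
                   finsler_metric L u (mixed_torsion M D X Y u) (Z u) =
                   finsler_metric L u (mixed_torsion M D X Z u) (Y u)"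
begin

abbreviation "S \<equiv> slit M"
abbreviation "C \<equiv> carrier S"
abbreviation "E \<equiv> energy L"
abbreviation "g \<equiv> finsler_metric L"
abbreviation "sec \<equiv> pb_section M"
abbreviation "vf \<equiv> vector_field S"
abbreviation "br \<equiv> bracket S"
abbreviation "T u \<equiv> tangent_space M (fst u)"
abbreviation "TS \<equiv> tangent_space S"
abbreviation "gam_field s \<equiv> \<lambda>w. gam M w (s w)"
abbreviation "rho_field X \<equiv> \<lambda>w. rho M w (X w)"
abbreviation "K \<equiv> conn_map D"

lemma atlas_M: "smooth_atlas M"
  using finsler by (simp add: finsler_manifold_def smooth_manifold_def)

lemma smooth_L: "smooth_fun S L"
  using finsler by (simp add: finsler_manifold_def)

lemma L_homogeneous: "(p, v) \<in> carrier (tangent_bundle M) \<Longrightarrow> c > 0 \<Longrightarrow> L (p, c *\<^sub>R v) = c * L (p, v)"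
  using finsler unfolding finsler_manifold_def by blast

lemma atlas_slit: "smooth_atlas S" by (rule smooth_atlas_slit[OF atlas_M])

lemma linear_D: "linear_connection M D" using regular by (simp add: regular_connection_def)

lemma vf_G: "vf G" using spray by (simp add: canonical_spray_def)

lemma sec_fundamental: "sec fundamental" by (rule pb_section_fundamental[OF atlas_M])

lemma subspace_T: "u \<in> C \<Longrightarrow> subspace (T u)"
  using subspace_tangent_space[OF atlas_M] by (simp add: carrier_slit_iff)

lemma sec_tangent: "sec s \<Longrightarrow> u \<in> C \<Longrightarrow> s u \<in> T u" by (rule pb_section_tangent)

lemma vf_tangent: "vf X \<Longrightarrow> u \<in> C \<Longrightarrow> X u \<in> TS u" by (rule vector_field_tangent)

lemma E_smooth: "u \<in> C \<Longrightarrow> smooth_fun_at S u E" by (rule smooth_energy[OF atlas_M smooth_L])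

lemma metric_nondegenerate:
  assumes "u \<in> C" "v \<in> T u" "g u v v = 0"
  shows "v = 0"
proof (rule ccontr)
  assume "v \<noteq> 0"
  then have "g u v v > 0" using finsler assms(1,2) unfolding finsler_manifold_def by blast
  with assms(3) show False by simp
qed

lemma metric_fundamental: "u \<in> C \<Longrightarrow> w \<in> T u \<Longrightarrow> g u (fundamental u) w = gam M u w E"
  using finsler_metric_fundamental[OF atlas_M smooth_L L_homogeneous] by (simp add: fundamental_def)

lemma euler: "u \<in> C \<Longrightarrow> gam M u (fundamental u) E = 2 * E u"
  using euler_energy[OF atlas_M smooth_L L_homogeneous] by (simp add: fundamental_def)

lemma metric_rule:
  assumes "sec Y" "sec Z" "u \<in> C" "\<xi> \<in> TS u"
  shows "\<xi> (\<lambda>w. g w (Y w) (Z w)) = g u (D u \<xi> Y) (Z u) + g u (Y u) (D u \<xi> Z)"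
  using metric assms unfolding metric_connection_def by blast

lemma dJE_eq: "dJE M L w \<xi> = gam M w (rho M w \<xi>) E"
  by (simp add: dJE_def Jmap_def)

lemma dJE_metric: "w \<in> C \<Longrightarrow> \<xi> \<in> TS w \<Longrightarrow> dJE M L w \<xi> = g w (fundamental w) (rho M w \<xi>)"
  by (simp add: dJE_eq metric_fundamental rho_tangent[OF atlas_M])

lemma dJE_gam: "w \<in> C \<Longrightarrow> v \<in> T w \<Longrightarrow> dJE M L w (gam M w v) = 0"
  by (simp add: dJE_eq rho_gam[OF atlas_M] gam_0[OF atlas_M])

lemma dJE_add: "w \<in> C \<Longrightarrow> \<xi> \<in> TS w \<Longrightarrow> \<zeta> \<in> TS w \<Longrightarrow> dJE M L w (\<xi> + \<zeta>) = dJE M L w \<xi> + dJE M L w \<zeta>"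
  by (simp add: dJE_eq linear_add[OF linear_rho[OF atlas_M]] gam_combine[OF atlas_M] rho_tangent[OF atlas_M])

lemma dJE_uminus:
  assumes w: "w \<in> C" and \<xi>: "\<xi> \<in> TS w"
  shows "dJE M L w (- \<xi>) = - dJE M L w \<xi>"
proof -
  have "0 \<in> T w" by (rule subspace_0[OF subspace_T[OF w]])
  from gam_combine(2)[OF atlas_M w this rho_tangent[OF atlas_M w \<xi>]] show ?thesis
    by (simp add: dJE_eq linear_neg[OF linear_rho[OF atlas_M]] gam_0[OF atlas_M w])
qed

lemma dJE_smooth: "vf X \<Longrightarrow> u \<in> C \<Longrightarrow> smooth_fun_at S u (\<lambda>w. dJE M L w (X w))"
  unfolding dJE_eq by (rule vector_field_smooth[OF atlas_slit vector_field_gam[OF atlas_M pb_section_rho[OF atlas_M]] E_smooth])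

lemma vf_bracket: "vf X \<Longrightarrow> vf Y \<Longrightarrow> vf (br X Y)" by (rule vector_field_bracket[OF atlas_slit])

lemma vf_gam: "sec s \<Longrightarrow> vf (gam_field s)" by (rule vector_field_gam[OF atlas_M])

lemma sec_rho: "vf X \<Longrightarrow> sec (rho_field X)" by (rule pb_section_rho[OF atlas_M])

lemma cong_TS: "u \<in> C \<Longrightarrow> \<xi> \<in> TS u \<Longrightarrow> (\<And>w. w \<in> C \<Longrightarrow> f w = h w) \<Longrightarrow> \<xi> f = \<xi> h"
  by (rule tangent_vector_cong_carrier[OF atlas_slit])

lemma Omega_eq:
  "Omega M L X Y u = X u (\<lambda>q. dJE M L q (Y q)) - Y u (\<lambda>q. dJE M L q (X q)) - dJE M L u (br X Y u)"
  by (simp add: Omega_def ext_deriv_def)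

lemma Omega_antisym:
  assumes u: "u \<in> C" and X: "vf X" and Y: "vf Y"
  shows "Omega M L X Y u = - Omega M L Y X u"
  using bracket_antisym[of S X Y u] dJE_uminus[OF u vf_tangent[OF vf_bracket[OF Y X] u]]
  by (simp add: Omega_eq)

lemma Omega_add_left:
  assumes u: "u \<in> C" and X: "vf X" "vf X'" and Y: "vf Y"
  shows "Omega M L (\<lambda>w. X w + X' w) Y u = Omega M L X Y u + Omega M L X' Y u"
proof -
  have "Y u (\<lambda>q. dJE M L q (X q + X' q)) = Y u (\<lambda>q. dJE M L q (X q) + dJE M L q (X' q))"
    by (rule cong_TS[OF u vf_tangent[OF Y u]]) (simp add: dJE_add vf_tangent X)
  also have "\<dots> = Y u (\<lambda>q. dJE M L q (X q)) + Y u (\<lambda>q. dJE M L q (X' q))"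
    by (rule tangent_vector_add[OF atlas_slit vf_tangent[OF Y u] dJE_smooth[OF X(1) u] dJE_smooth[OF X(2) u]])
  finally show ?thesis
    using dJE_add[OF u vf_tangent[OF vf_bracket[OF X(1) Y] u] vf_tangent[OF vf_bracket[OF X(2) Y] u]]
    by (simp add: Omega_eq bracket_add_left[OF atlas_slit u X Y])
qed

lemma Omega_cong:
  assumes u: "u \<in> C" and X: "vf X" and Y: "vf Y" and e: "\<And>w. w \<in> C \<Longrightarrow> X w = X' w" "\<And>w. w \<in> C \<Longrightarrow> Y w = Y' w"
  shows "Omega M L X Y u = Omega M L X' Y' u"
proof -
  have "X u (\<lambda>q. dJE M L q (Y q)) = X u (\<lambda>q. dJE M L q (Y' q))"
    by (rule cong_TS[OF u vf_tangent[OF X u]]) (simp add: e)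
  moreover have "Y u (\<lambda>q. dJE M L q (X q)) = Y u (\<lambda>q. dJE M L q (X' q))"
    by (rule cong_TS[OF u vf_tangent[OF Y u]]) (simp add: e)
  moreover have "br X Y u = br X' Y' u" by (rule bracket_cong[where X = X and Y = Y, OF atlas_slit u vf_tangent[OF X u] vf_tangent[OF Y u] e])
  ultimately show ?thesis by (simp add: Omega_eq e[OF u])
qed

text \<open>Here \<open>\<theta>(\<gamma>W) = 0\<close>, so \<open>\<Omega>(\<gamma>W,Y)\<close> is \<open>\<gamma>W(\<theta>(Y)) - \<theta>([\<gamma>W,Y])\<close>, which is exactly the
Hessian term in the iterated vertical derivative of \<open>E\<close>.\<close>

lemma Omega_gam:
  assumes u: "u \<in> C" and W: "sec W" and Y: "vf Y"
  shows "Omega M L (gam_field W) Y u = g u (W u) (rho M u (Y u))"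
proof -
  let ?V = "rho M u (br (gam_field W) Y u)"
  have "gam M u (W u) (\<lambda>q. dJE M L q (Y q)) = g u (W u) (rho M u (Y u)) + gam M u ?V E"
    unfolding dJE_eq
    by (rule iterated_vertical_derivative_energy[OF atlas_M smooth_L u sec_rho[OF Y] sec_tangent[OF W u]
          rho_tangent[OF atlas_M u vf_tangent[OF vf_bracket[OF vf_gam[OF W] Y] u]]
          rho_bracket_gam[where X = W and Y = Y, OF atlas_M u sec_tangent[OF W u] vf_tangent[OF Y u]]])
  moreover have "Y u (\<lambda>q. dJE M L q (gam M q (W q))) = Y u (\<lambda>q. 0)"
    by (rule cong_TS[OF u vf_tangent[OF Y u]]) (simp add: dJE_gam sec_tangent W)
  ultimately show ?thesis by (simp add: Omega_eq tangent_vector_const[OF atlas_slit vf_tangent[OF Y u] u] dJE_eq)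
qed

lemma spray_rule: "vf X \<Longrightarrow> u \<in> C \<Longrightarrow> Omega M L G X u = - X u E"
  using spray by (simp add: canonical_spray_def)

lemma metric_diff_eq_0:
  assumes u: "u \<in> C" and v: "v \<in> T u" and w: "w \<in> T u" and e: "g u v (v - w) = g u w (v - w)"
  shows "v = w"
proof -
  have d: "v - w \<in> T u" by (rule subspace_diff[OF subspace_T[OF u] v w])
  have "g u (v - w) (v - w) = 0" using finsler_metric_linear(2)[OF atlas_M smooth_L u v w d] e by simp
  from metric_nondegenerate[OF u d this] show ?thesis by simp
qed

text \<open>The equation of the spray, evaluated on vertical fields, reads \<open>g(W,\<rho>G) = \<gamma>W E = g(W,\<eta>)\<close>.\<close>

lemma rho_spray:
  assumes u: "u \<in> C"
  shows "rho M u (G u) = fundamental u"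
proof -
  \<comment> \<open>the test section: the difference of the two sides\<close>
  let ?W = "\<lambda>w. rho M w (G w) - fundamental w"
  have W: "sec ?W" by (rule pb_section_diff[OF atlas_M sec_rho[OF vf_G] sec_fundamental])
  have "g u (?W u) (rho M u (G u)) = gam M u (?W u) E"
    using Omega_gam[OF u W vf_G] Omega_antisym[OF u vf_G vf_gam[OF W]] spray_rule[OF vf_gam[OF W] u] by simp
  also have "\<dots> = g u (fundamental u) (?W u)" using metric_fundamental[OF u sec_tangent[OF W u]] by simp
  finally have "g u (rho M u (G u)) (?W u) = g u (fundamental u) (?W u)"
    using finsler_metric_commute[OF atlas_M smooth_L u sec_tangent[OF W u] sec_tangent[OF sec_rho[OF vf_G] u]] by simp
  then show ?thesis
    by (rule metric_diff_eq_0[OF u sec_tangent[OF sec_rho[OF vf_G] u] sec_tangent[OF sec_fundamental u]])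
qed

text \<open>Since \<open>\<rho>G\<close> is the fundamental section, the bracket with \<open>G\<close> turns the vertical field of a section into
a smooth field that projects to this section.\<close>

definition lift :: "('a tpt \<Rightarrow> 'a tvec) \<Rightarrow> 'a tpt \<Rightarrow> 'a tpt tvec"
  where "lift Z = br (gam_field Z) G"

lemma vf_lift: "sec Z \<Longrightarrow> vf (lift Z)"
  unfolding lift_def by (intro vf_bracket vf_gam vf_G)

lemma rho_lift:
  assumes u: "u \<in> C" and Z: "sec Z"
  shows "rho M u (lift Z u) = Z u"
proof (rule tangent_vector_eqI)
  show "rho M u (lift Z u) \<in> T u" by (rule rho_tangent[OF atlas_M u vf_tangent[OF vf_lift[OF Z] u]])
  show "Z u \<in> T u" by (rule sec_tangent[OF Z u])
  fix f assume f: "smooth_fun_at M (fst u) f"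
  have "rho M u (lift Z u) f = gam M u (Z u) (\<lambda>w. rho M w (G w) f)"
    unfolding lift_def by (rule rho_bracket_gam[where X = Z and Y = G, OF atlas_M u sec_tangent[OF Z u] vf_tangent[OF vf_G u] f])
  also have "\<dots> = gam M u (Z u) (\<lambda>w. fundamental w f)"
    by (rule cong_TS[OF u gam_tangent[OF atlas_M u sec_tangent[OF Z u]]]) (simp add: rho_spray)
  also have "\<dots> = Z u f" by (rule gam_fundamental[OF atlas_M u f])
  finally show "rho M u (lift Z u) f = Z u f" .
qed

section \<open>The connection map on vertical vectors\<close>

lemma beta_unique:
  assumes u: "u \<in> C" and x: "\<xi> \<in> TS u" and K: "K u \<xi> = 0"
  shows "beta M D u (rho M u \<xi>) = \<xi>"
proof -
  have h: "\<xi> \<in> horizontal M D u" using x K by (simp add: horizontal_def)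
  have "inj_on (rho M u) (horizontal M D u)"
  proof (rule inj_onI)
    fix a b assume a: "a \<in> horizontal M D u" and b: "b \<in> horizontal M D u" and e: "rho M u a = rho M u b"
    have ab: "a - b \<in> TS u"
      using a b subspace_diff[OF subspace_tangent_space[OF atlas_slit u]] by (auto simp: horizontal_def)
    moreover have "rho M u (a - b) = 0" using e by (simp add: linear_diff[OF linear_rho[OF atlas_M]])
    moreover have "K u (a - b) = 0"
      using a b linear_connection_combine(2)[OF linear_D u sec_fundamental] by (auto simp: horizontal_def conn_map_def)
    ultimately have "a - b \<in> vertical M u \<inter> horizontal M D u" by (simp add: vertical_def horizontal_def)
    then show "a = b" using regular u unfolding regular_connection_def by auto
  qed
  then show ?thesis unfolding beta_def using h by (rule inv_into_f_f)
qed

text \<open>Regularity splits the lift of \<open>Z\<close>; its horizontal part is \<open>\<beta>Z\<close>. At this stage \<open>\<beta>Z\<close> is only known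
pointwise.\<close>

lemma beta_section:
  assumes u: "u \<in> C" and Z: "sec Z"
  shows "beta M D u (Z u) \<in> TS u" "rho M u (beta M D u (Z u)) = Z u"
proof -
  obtain Y H where "Y \<in> vertical M u" and H: "H \<in> horizontal M D u" "lift Z u = Y + H"
    using regular u vf_tangent[OF vf_lift[OF Z] u] unfolding regular_connection_def by blast
  then have "rho M u H = Z u"
    using rho_lift[OF u Z] linear_add[OF linear_rho[OF atlas_M]] by (simp add: vertical_def)
  moreover have "beta M D u (rho M u H) = H" using H by (intro beta_unique[OF u]) (auto simp: horizontal_def)
  ultimately show "beta M D u (Z u) \<in> TS u" "rho M u (beta M D u (Z u)) = Z u"
    using H(1) by (auto simp: horizontal_def)
qed

text \<open>The derivative \<open>\<nabla>\<^sub>X Y\<close> along the fibres. Writing it with the lift of \<open>Y\<close> makes its smoothness obvious;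
any other field over \<open>Y\<close> gives the same result.\<close>

definition fibre_deriv :: "('a tpt \<Rightarrow> 'a tvec) \<Rightarrow> ('a tpt \<Rightarrow> 'a tvec) \<Rightarrow> 'a tpt \<Rightarrow> 'a tvec"
  where "fibre_deriv X Y = rho_field (br (gam_field X) (lift Y))"

lemma sec_fibre_deriv: "sec X \<Longrightarrow> sec Y \<Longrightarrow> sec (fibre_deriv X Y)"
  unfolding fibre_deriv_def by (intro sec_rho vf_bracket vf_gam vf_lift)

lemma rho_bracket_fibre_deriv:
  assumes u: "u \<in> C" and X: "sec X" and Y: "sec Y" and Z: "Z u \<in> TS u"
    and e: "\<And>w. w \<in> C \<Longrightarrow> rho M w (Z w) = Y w"
  shows "rho M u (br (gam_field X) Z u) = fibre_deriv X Y u"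
proof
  fix f
  show "rho M u (br (gam_field X) Z u) f = fibre_deriv X Y u f"
  proof (cases "smooth_fun_at M (fst u) f")
    case True
    have "gam M u (X u) (\<lambda>w. rho M w (Z w) f) = gam M u (X u) (\<lambda>w. rho M w (lift Y w) f)"
      by (rule cong_TS[OF u gam_tangent[OF atlas_M u sec_tangent[OF X u]]]) (simp add: e rho_lift[OF _ Y])
    then show ?thesis
      using rho_bracket_gam[where X = X and Y = Z, OF atlas_M u sec_tangent[OF X u] Z True] rho_bracket_gam[where X = X and Y = "lift Y", OF atlas_M u sec_tangent[OF X u] vf_tangent[OF vf_lift[OF Y] u] True]
      by (simp add: fibre_deriv_def)
  qed (simp add: fibre_deriv_def rho_def differential_def)
qed

lemma fibre_deriv_fundamental:
  assumes u: "u \<in> C" and X: "sec X"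
  shows "fibre_deriv X fundamental u = X u"
  using rho_bracket_fibre_deriv[where Z = G, OF u X sec_fundamental vf_tangent[OF vf_G u] rho_spray] rho_lift[OF u X] by (simp add: lift_def)

lemma iterated_vertical_derivative:
  assumes u: "u \<in> C" and X: "sec X" and Z: "sec Z"
  shows "gam M u (X u) (\<lambda>w. gam M w (Z w) E) = g u (X u) (Z u) + gam M u (fibre_deriv X Z u) E"
proof (rule iterated_vertical_derivative_energy[OF atlas_M smooth_L u Z sec_tangent[OF X u] sec_tangent[OF sec_fibre_deriv[OF X Z] u]])
  fix f assume f: "smooth_fun_at M (fst u) f"
  have "fibre_deriv X Z u f = gam M u (X u) (\<lambda>w. rho M w (lift Z w) f)"
    unfolding fibre_deriv_def by (rule rho_bracket_gam[where X = X and Y = "lift Z", OF atlas_M u sec_tangent[OF X u] vf_tangent[OF vf_lift[OF Z] u] f])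
  also have "\<dots> = gam M u (X u) (\<lambda>w. Z w f)"
    by (rule cong_TS[OF u gam_tangent[OF atlas_M u sec_tangent[OF X u]]]) (simp add: rho_lift[OF _ Z])
  finally show "fibre_deriv X Z u f = gam M u (X u) (\<lambda>w. Z w f)" .
qed

lemma mixed_torsion_eq:
  assumes u: "u \<in> C" and X: "sec X" and Y: "sec Y"
  shows "mixed_torsion M D X Y u = D u (gam M u (X u)) Y - fibre_deriv X Y u"
proof -
  have "D u (gam M u (X u)) Y = D u (gam M u (X u)) (\<lambda>w. rho M w (beta M D w (Y w)))"
    by (rule linear_connection_cong[OF atlas_M linear_D u Y gam_tangent[OF atlas_M u sec_tangent[OF X u]]]) (simp add: beta_section Y)
  moreover have "D u (beta M D u (Y u)) (\<lambda>w. rho M w (gam M w (X w))) = 0"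
    by (rule linear_connection_zero[OF atlas_M linear_D u beta_section(1)[OF u Y]]) (simp add: rho_gam[OF atlas_M] sec_tangent X)
  moreover have "rho M u (br (gam_field X) (\<lambda>w. beta M D w (Y w)) u) = fibre_deriv X Y u"
    by (rule rho_bracket_fibre_deriv[where Z = "\<lambda>w. beta M D w (Y w)", OF u X Y beta_section(1)[OF u Y]]) (simp add: beta_section Y)
  ultimately show ?thesis by (simp add: mixed_torsion_def torsion_def)
qed

text \<open>The identity \<open>K \<circ> \<gamma> = id\<close>, that is \<open>T(X,\<eta>) = 0\<close>. Differentiating \<open>g(\<eta>,Z) = \<gamma>Z E\<close> along \<open>\<gamma>X\<close>, once
by the Hessian formula and once by the metric condition, leaves
\<open>g(T(X,\<eta>),Z) + g(\<eta>,T(X,Z)) = 0\<close>, and by the symmetry of \<open>T\<close> both summands are equal.\<close>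

lemma conn_map_gam:
  assumes u: "u \<in> C" and X: "sec X"
  shows "K u (gam M u (X u)) = X u"
proof -
  \<comment> \<open>the test section is \<open>T(X,\<eta>)\<close> itself, written so that its smoothness is visible\<close>
  define Z where "Z = (\<lambda>w. D w (gam M w (X w)) fundamental - X w)"
  have Z: "sec Z"
    unfolding Z_def by (intro pb_section_diff[OF atlas_M] linear_connection_section[OF linear_D] vf_gam X sec_fundamental)
  have Teta: "mixed_torsion M D X fundamental u = Z u"
    by (simp add: mixed_torsion_eq[OF u X sec_fundamental] fibre_deriv_fundamental[OF u X] Z_def)
  have DZ: "D u (gam M u (X u)) Z = mixed_torsion M D X Z u + fibre_deriv X Z u"
    by (simp add: mixed_torsion_eq[OF u X Z])
  have Deta: "D u (gam M u (X u)) fundamental = Z u + X u" by (simp add: Z_def)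
  have DZT: "D u (gam M u (X u)) Z \<in> T u" by (rule sec_tangent[OF linear_connection_section[OF linear_D vf_gam[OF X] Z] u])
  have FT: "fibre_deriv X Z u \<in> T u" by (rule sec_tangent[OF sec_fibre_deriv[OF X Z] u])
  have TT: "mixed_torsion M D X Z u \<in> T u"
    unfolding mixed_torsion_eq[OF u X Z] by (rule subspace_diff[OF subspace_T[OF u] DZT FT])
  have eta_T: "fundamental u \<in> T u" by (rule sec_tangent[OF sec_fundamental u])
  note lin = finsler_metric_linear(1)[OF atlas_M smooth_L u] and com = finsler_metric_commute[OF atlas_M smooth_L u]
  have ZT: "Z u \<in> T u" and XT: "X u \<in> T u" using sec_tangent[OF _ u] Z X by auto
  have "g u (X u) (Z u) + gam M u (fibre_deriv X Z u) E = gam M u (X u) (\<lambda>w. gam M w (Z w) E)"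
    by (rule iterated_vertical_derivative[OF u X Z, symmetric])
  also have "\<dots> = gam M u (X u) (\<lambda>w. g w (fundamental w) (Z w))"
    by (rule cong_TS[OF u gam_tangent[OF atlas_M u XT]]) (simp add: metric_fundamental sec_tangent Z)
  also have "\<dots> = g u (Z u + X u) (Z u) + g u (fundamental u) (mixed_torsion M D X Z u + fibre_deriv X Z u)"
    using metric_rule[OF sec_fundamental Z u gam_tangent[OF atlas_M u XT]] by (simp add: Deta DZ)
  also have "\<dots> = g u (Z u) (Z u) + g u (X u) (Z u) + (g u (mixed_torsion M D X Z u) (fundamental u)
      + gam M u (fibre_deriv X Z u) E)"
    using lin[OF ZT XT ZT] lin[OF TT FT eta_T] com[OF eta_T subspace_add[OF subspace_T[OF u] TT FT]]
      com[OF eta_T FT] metric_fundamental[OF u FT] by simp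
  also have "g u (mixed_torsion M D X Z u) (fundamental u) = g u (Z u) (Z u)"
    using T_sym[OF X sec_fundamental Z u] by (simp add: Teta)
  finally have "g u (Z u) (Z u) = 0" by simp
  from metric_nondegenerate[OF u ZT this] show ?thesis by (simp add: Z_def conn_map_def)
qed

lemma sec_K: "vf X \<Longrightarrow> sec (\<lambda>w. K w (X w))"
  unfolding conn_map_def by (rule linear_connection_section[OF linear_D _ sec_fundamental])

section \<open>Horizontal fields\<close>

text \<open>The horizontal part of a vector field: smooth by construction, and horizontal because \<open>K \<circ> \<gamma>\<close> is the
identity.\<close>

definition hor :: "('a tpt \<Rightarrow> 'a tpt tvec) \<Rightarrow> 'a tpt \<Rightarrow> 'a tpt tvec"
  where "hor X = (\<lambda>w. X w - gam M w (K w (X w)))"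

lemma vf_hor: "vf X \<Longrightarrow> vf (hor X)"
  unfolding hor_def by (intro vector_field_diff[OF atlas_slit] vf_gam sec_K)

lemma hor_props:
  assumes u: "u \<in> C" and X: "vf X"
  shows "K u (hor X u) = 0" "rho M u (hor X u) = rho M u (X u)" "beta M D u (rho M u (X u)) = hor X u"
proof -
  note g = gam_tangent[OF atlas_M u sec_tangent[OF sec_K[OF X] u]]
  show k: "K u (hor X u) = 0"
    using linear_connection_combine(2)[OF linear_D u sec_fundamental vf_tangent[OF X u] g] conn_map_gam[OF u sec_K[OF X]]
    by (simp add: hor_def conn_map_def zero_fun_def)
  show r: "rho M u (hor X u) = rho M u (X u)"
    by (simp add: hor_def linear_diff[OF linear_rho[OF atlas_M]] rho_gam[OF atlas_M u sec_tangent[OF sec_K[OF X] u]])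
  show "beta M D u (rho M u (X u)) = hor X u"
    using beta_unique[OF u vf_tangent[OF vf_hor[OF X] u] k] r by simp
qed

text \<open>A vector field that equals \<open>\<beta>Z\<close> on the slit tangent bundle and is visibly smooth.\<close>

definition beta_field :: "('a tpt \<Rightarrow> 'a tvec) \<Rightarrow> 'a tpt \<Rightarrow> 'a tpt tvec"
  where "beta_field Z = hor (lift Z)"

lemma vf_beta_field: "sec Z \<Longrightarrow> vf (beta_field Z)"
  unfolding beta_field_def by (intro vf_hor vf_lift)

lemma beta_field_props:
  assumes u: "u \<in> C" and Z: "sec Z"
  shows "beta M D u (Z u) = beta_field Z u" "K u (beta_field Z u) = 0" "rho M u (beta_field Z u) = Z u"
  using hor_props[OF u vf_lift[OF Z]] rho_lift[OF u Z] by (simp_all add: beta_field_def)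

lemma decomposition:
  assumes u: "u \<in> C" and X: "vf X"
  shows "beta_field (rho_field X) u = hor X u" "X u = beta_field (rho_field X) u + gam M u (K u (X u))"
proof -
  show "beta_field (rho_field X) u = hor X u"
    using beta_field_props(1)[OF u sec_rho[OF X]] hor_props(3)[OF u X] by (rule trans[OF sym])
  then show "X u = beta_field (rho_field X) u + gam M u (K u (X u))" by (simp add: hor_def)
qed

lemma rho_bracket_beta:
  assumes u: "u \<in> C" and X: "sec X" and Y: "sec Y"
  shows "rho M u (br (beta_field X) (beta_field Y) u) = D u (beta_field X u) Y - D u (beta_field Y u) X"
proof -
  have b: "br (\<lambda>w. beta M D w (X w)) (\<lambda>w. beta M D w (Y w)) u = br (beta_field X) (beta_field Y) u"
    by (rule bracket_cong[OF atlas_slit u]) (use beta_section u X Y beta_field_props(1) in auto)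
  have "D u (beta_field X u) (\<lambda>w. rho M w (beta M D w (Y w))) = D u (beta_field X u) Y"
    by (rule linear_connection_cong[OF atlas_M linear_D u Y vf_tangent[OF vf_beta_field[OF X] u], symmetric]) (simp add: beta_section Y)
  moreover have "D u (beta_field Y u) (\<lambda>w. rho M w (beta M D w (X w))) = D u (beta_field Y u) X"
    by (rule linear_connection_cong[OF atlas_M linear_D u X vf_tangent[OF vf_beta_field[OF Y] u], symmetric]) (simp add: beta_section X)
  ultimately show ?thesis
    using Q_zero[OF X Y u] by (simp add: h_torsion_def torsion_def b beta_field_props(1)[OF u X] beta_field_props(1)[OF u Y])
qed

lemma beta_field_dJE:
  assumes u: "u \<in> C" and X: "sec X" and Y: "sec Y"
  shows "beta_field X u (\<lambda>q. dJE M L q (beta_field Y q)) = g u (fundamental u) (D u (beta_field X u) Y)"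
proof -
  have "beta_field X u (\<lambda>q. dJE M L q (beta_field Y q)) = beta_field X u (\<lambda>q. g q (fundamental q) (Y q))"
    by (rule cong_TS[OF u vf_tangent[OF vf_beta_field[OF X] u]]) (simp add: dJE_metric vf_tangent vf_beta_field Y beta_field_props)
  also have "\<dots> = g u (D u (beta_field X u) fundamental) (Y u) + g u (fundamental u) (D u (beta_field X u) Y)"
    by (rule metric_rule[OF sec_fundamental Y u vf_tangent[OF vf_beta_field[OF X] u]])
  also have "D u (beta_field X u) fundamental = 0" using beta_field_props(2)[OF u X] by (simp add: conn_map_def)
  finally show ?thesis using finsler_metric_0(1)[OF atlas_M smooth_L u sec_tangent[OF Y u]] by (simp add: zero_fun_def)
qed

text \<open>As \<open>D\<^bsub>\<beta>X\<^esub> \<eta> = 0\<close>, the metric condition turns \<open>\<Omega>(\<beta>X,\<beta>Y)\<close> into \<open>g(\<eta>,Q(X,Y))\<close>.\<close>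

lemma Omega_beta_beta:
  assumes u: "u \<in> C" and X: "sec X" and Y: "sec Y"
  shows "Omega M L (beta_field X) (beta_field Y) u = 0"
proof -
  have DX: "D u (beta_field Y u) X \<in> T u" and DY: "D u (beta_field X u) Y \<in> T u"
    using sec_tangent[OF linear_connection_section[OF linear_D] u] vf_beta_field X Y by blast+
  note eta_T = sec_tangent[OF sec_fundamental u]
  have "g u (fundamental u) (D u (beta_field X u) Y - D u (beta_field Y u) X)
      = g u (fundamental u) (D u (beta_field X u) Y) - g u (fundamental u) (D u (beta_field Y u) X)"
    using finsler_metric_linear(2)[OF atlas_M smooth_L u DY DX eta_T] finsler_metric_commute[OF atlas_M smooth_L u eta_T] DX DY
      subspace_diff[OF subspace_T[OF u] DY DX] by simp
  then show ?thesis
    using beta_field_dJE[OF u X Y] beta_field_dJE[OF u Y X]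
      dJE_metric[OF u vf_tangent[OF vf_bracket[OF vf_beta_field[OF X] vf_beta_field[OF Y]] u]] rho_bracket_beta[OF u X Y]
    by (simp add: Omega_eq)
qed

lemma Omega_beta:
  assumes u: "u \<in> C" and Y: "vf Y" and Z: "sec Z"
  shows "Omega M L Y (beta_field Z) u = g u (K u (Y u)) (Z u)"
proof -
  have "Omega M L Y (beta_field Z) u = Omega M L (\<lambda>w. beta_field (rho_field Y) w + gam M w (K w (Y w))) (beta_field Z) u"
    by (rule Omega_cong[OF u Y vf_beta_field[OF Z]]) (simp_all only: decomposition(2)[OF _ Y, symmetric])
  also have "\<dots> = g u (K u (Y u)) (Z u)"
    using Omega_add_left[OF u vf_beta_field[OF sec_rho[OF Y]] vf_gam[OF sec_K[OF Y]] vf_beta_field[OF Z]]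
      Omega_beta_beta[OF u sec_rho[OF Y] Z] Omega_gam[OF u sec_K[OF Y] vf_beta_field[OF Z]] beta_field_props(3)[OF u Z]
    by simp
  finally show ?thesis .
qed

text \<open>Euler's relation gives \<open>2E = g(\<eta>,\<eta>)\<close>, and \<open>\<eta>\<close> is parallel along horizontal fields.\<close>

lemma beta_field_energy:
  assumes u: "u \<in> C" and Z: "sec Z"
  shows "beta_field Z u E = 0"
proof -
  note b = vf_tangent[OF vf_beta_field[OF Z] u]
  have "2 * beta_field Z u E = beta_field Z u (\<lambda>w. 2 * E w)"
    by (rule tangent_vector_cmult[OF atlas_slit b E_smooth[OF u], symmetric])
  also have "\<dots> = beta_field Z u (\<lambda>w. g w (fundamental w) (fundamental w))"
    by (rule cong_TS[OF u b]) (simp add: metric_fundamental sec_tangent sec_fundamental euler)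
  also have "\<dots> = 0"
    using metric_rule[OF sec_fundamental sec_fundamental u b] beta_field_props(2)[OF u Z] finsler_metric_0[OF atlas_M smooth_L u sec_tangent[OF sec_fundamental u]]
    by (simp add: conn_map_def)
  finally show ?thesis by simp
qed

text \<open>Evaluating the equation of the spray on the horizontal field over \<open>KG\<close> gives \<open>g(KG,KG) = 0\<close>.\<close>

lemma spray_horizontal:
  assumes u: "u \<in> C"
  shows "K u (G u) = 0"
proof -
  have "g u (K u (G u)) (K u (G u)) = 0"
    using Omega_beta[OF u vf_G sec_K[OF vf_G]] spray_rule[OF vf_beta_field[OF sec_K[OF vf_G]] u] beta_field_energy[OF u sec_K[OF vf_G]]
    by simp
  then show ?thesis by (rule metric_nondegenerate[OF u sec_tangent[OF sec_K[OF vf_G] u]])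
qed

lemma beta_field_fundamental: "u \<in> C \<Longrightarrow> beta_field fundamental u = G u"
  using beta_unique[of u "G u"] beta_field_props(1)[of u fundamental] sec_fundamental spray_horizontal rho_spray vf_tangent[OF vf_G] by simp

section \<open>Invariance under the spray\<close>

text \<open>The identity \<open>L\<^sub>G \<theta> = dE\<close>: by Cartan's formula \<open>L\<^sub>G \<theta> = i\<^sub>G \<Omega> + d(\<theta>(G))\<close>, where \<open>i\<^sub>G \<Omega> = -dE\<close>, and
\<open>\<theta>(G) = \<gamma>\<eta> E = 2E\<close>.\<close>

lemma lie_dJE:
  assumes u: "u \<in> C" and X: "vf X"
  shows "dJE M L u (br G X u) = G u (\<lambda>q. dJE M L q (X q)) - X u E"
proof -
  have "X u (\<lambda>q. dJE M L q (G q)) = X u (\<lambda>q. 2 * E q)"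
    by (rule cong_TS[OF u vf_tangent[OF X u]]) (simp add: dJE_eq rho_spray euler)
  also have "\<dots> = 2 * X u E" by (rule tangent_vector_cmult[OF atlas_slit vf_tangent[OF X u] E_smooth[OF u]])
  finally show ?thesis using spray_rule[OF X u] by (simp add: Omega_eq)
qed

text \<open>The identity \<open>L\<^sub>G \<Omega> = d(L\<^sub>G \<theta>) = ddE = 0\<close>, spelt out on two vector fields with the Jacobi identity.\<close>

lemma lie_Omega:
  assumes u: "u \<in> C" and X: "vf X" and Y: "vf Y"
  shows "G u (\<lambda>w. Omega M L X Y w) = Omega M L (br G X) Y u + Omega M L X (br G Y) u"
proof -
  let ?\<theta> = "\<lambda>Z q. dJE M L q (Z q)"
  have lie: "P u (?\<theta> (br G Z)) = P u (\<lambda>q. G q (?\<theta> Z)) - P u (\<lambda>q. Z q E)"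
    if P: "vf P" and Z: "vf Z" for P Z
  proof -
    have "P u (?\<theta> (br G Z)) = P u (\<lambda>q. G q (?\<theta> Z) - Z q E)"
      by (rule cong_TS[OF u vf_tangent[OF P u]]) (rule lie_dJE[OF _ Z])
    also have "\<dots> = P u (\<lambda>q. G q (?\<theta> Z)) - P u (\<lambda>q. Z q E)"
      by (intro tangent_vector_diff[OF atlas_slit vf_tangent[OF P u]] vector_field_smooth[OF atlas_slit vf_G] vector_field_smooth[OF atlas_slit Z]
          dJE_smooth[OF Z u] E_smooth[OF u])
    finally show ?thesis .
  qed
  note s = vector_field_smooth[OF atlas_slit X dJE_smooth[OF Y u]] vector_field_smooth[OF atlas_slit Y dJE_smooth[OF X u]]
  have "G u (\<lambda>w. Omega M L X Y w) = G u (\<lambda>w. X w (?\<theta> Y) - Y w (?\<theta> X)) - G u (?\<theta> (br X Y))"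
    unfolding Omega_eq
    by (rule tangent_vector_diff[OF atlas_slit vf_tangent[OF vf_G u] smooth_fun_at_diff[OF atlas_slit s] dJE_smooth[OF vf_bracket[OF X Y] u]])
  also have "\<dots> = G u (\<lambda>w. X w (?\<theta> Y)) - G u (\<lambda>w. Y w (?\<theta> X)) - G u (?\<theta> (br X Y))"
    using tangent_vector_diff[OF atlas_slit vf_tangent[OF vf_G u] s] by simp
  finally have l: "G u (\<lambda>w. Omega M L X Y w) = G u (\<lambda>w. X w (?\<theta> Y)) - G u (\<lambda>w. Y w (?\<theta> X)) - G u (?\<theta> (br X Y))" .
  have j: "dJE M L u (br G (br X Y) u) = dJE M L u (br (br G X) Y u) + dJE M L u (br X (br G Y) u)"
    unfolding bracket_jacobi[OF atlas_slit u X Y vf_G]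
    by (rule dJE_add[OF u]) (intro vf_tangent[OF _ u] vf_bracket vf_G X Y)+
  show ?thesis
    using l j lie[OF Y X] lie[OF X Y] lie_dJE[OF u vf_bracket[OF X Y]]
      bracket_apply[OF dJE_smooth[OF Y u], of G X] bracket_apply[OF dJE_smooth[OF X u], of G Y]
      bracket_apply[OF E_smooth[OF u], of X Y]
    by (simp add: Omega_eq)
qed

lemma rho_bracket_spray_beta:
  assumes u: "u \<in> C" and Z: "sec Z"
  shows "rho M u (br G (beta_field Z) u) = D u (G u) Z"
proof -
  have "br G (beta_field Z) u = br (beta_field fundamental) (beta_field Z) u"
    by (rule bracket_cong[where X = G and Y = "beta_field Z", OF atlas_slit u vf_tangent[OF vf_G u] vf_tangent[OF vf_beta_field[OF Z] u]]) (simp_all add: beta_field_fundamental)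
  then show ?thesis
    using rho_bracket_beta[OF u sec_fundamental Z] beta_field_props(2)[OF u Z] beta_field_fundamental[OF u] by (simp add: conn_map_def)
qed

text \<open>On the pair \<open>(\<gamma>X,\<beta>Z)\<close> the form \<open>\<Omega>\<close> is \<open>g(X,Z)\<close>, so its invariance under \<open>G\<close> is a product rule for
\<open>G g(X,Z)\<close>; the metric condition is another one, and the two differ only in the derivative of \<open>X\<close>.\<close>

lemma conn_map_bracket_spray_gam:
  assumes u: "u \<in> C" and X: "sec X"
  shows "K u (br G (gam_field X) u) = D u (G u) X"
proof -
  let ?B = "br G (gam_field X)"
  have B: "vf ?B" by (intro vf_bracket vf_G vf_gam X)
  \<comment> \<open>the test section: the difference of the two sides\<close>
  define Z where "Z = (\<lambda>w. K w (?B w) - D w (G w) X)"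
  have DX: "sec (\<lambda>w. D w (G w) X)" by (rule linear_connection_section[OF linear_D vf_G X])
  have Z: "sec Z" unfolding Z_def by (intro pb_section_diff[OF atlas_M] sec_K B DX)
  have "g u (K u (?B u)) (Z u) + g u (X u) (D u (G u) Z) = Omega M L ?B (beta_field Z) u + Omega M L (gam_field X) (br G (beta_field Z)) u"
    using Omega_beta[OF u B Z] Omega_gam[OF u X vf_bracket[OF vf_G vf_beta_field[OF Z]]] rho_bracket_spray_beta[OF u Z] by simp
  also have "\<dots> = G u (\<lambda>w. Omega M L (gam_field X) (beta_field Z) w)"
    by (rule lie_Omega[OF u vf_gam[OF X] vf_beta_field[OF Z], symmetric])
  also have "\<dots> = G u (\<lambda>w. g w (X w) (Z w))"
    by (rule cong_TS[OF u vf_tangent[OF vf_G u]]) (simp add: Omega_gam[OF _ X vf_beta_field[OF Z]] beta_field_props Z)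
  also have "\<dots> = g u (D u (G u) X) (Z u) + g u (X u) (D u (G u) Z)"
    by (rule metric_rule[OF X Z u vf_tangent[OF vf_G u]])
  finally have "g u (K u (?B u)) (Z u) = g u (D u (G u) X) (Z u)" by simp
  then show ?thesis
    unfolding Z_def by (rule metric_diff_eq_0[OF u sec_tangent[OF sec_K[OF B] u] sec_tangent[OF DX u]])
qed

text \<open>Decompose \<open>X = \<beta>Y + \<gamma>N\<close> with \<open>Y = \<rho>X\<close> and \<open>N = KX\<close>. Then \<open>[JX,G] = [\<gamma>Y,G]\<close> is \<open>\<beta>Y - \<gamma>(D\<^sub>G Y)\<close>, while
\<open>\<rho>[X,G] = \<rho>[\<beta>Y,G] + \<rho>[\<gamma>N,G]\<close> is \<open>-D\<^sub>G Y + N\<close>. The difference \<open>[JX,G] - J[X,G]\<close> is therefore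
\<open>\<beta>Y - \<gamma>N = 2\<beta>\<rho>X - X\<close>.\<close>

lemma nonlinear_connection_eq_barthel:
  assumes u: "u \<in> C" and X: "vf X"
  shows "nonlinear_connection M D u (X u) = barthel M G X u"
proof -
  define Y N where "Y = rho_field X" and "N = (\<lambda>w. K w (X w))"
  have Y: "sec Y" unfolding Y_def by (rule sec_rho[OF X])
  have N: "sec N" unfolding N_def by (rule sec_K[OF X])
  have NT: "N u \<in> T u" by (rule sec_tangent[OF N u])
  have DY: "sec (\<lambda>w. D w (G w) Y)" by (rule linear_connection_section[OF linear_D vf_G Y])
  have DT: "D u (G u) Y \<in> T u" by (rule sec_tangent[OF DY u])
  have zT: "0 \<in> T u" by (rule subspace_0[OF subspace_T[OF u]])
  have X_eq: "X w = beta_field Y w + gam M w (N w)" if "w \<in> C" for w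
    unfolding Y_def N_def by (rule decomposition(2)[OF that X])
  have KB: "K u (lift Y u) = - D u (G u) Y"
  proof -
    have "lift Y u = 0 - br G (gam_field Y) u" unfolding lift_def using bracket_antisym[of S "gam_field Y" G u] by simp
    moreover have "K u (0 - br G (gam_field Y) u) = K u 0 - K u (br G (gam_field Y) u)"
      unfolding conn_map_def
      by (rule linear_connection_combine(2)[OF linear_D u sec_fundamental subspace_0[OF subspace_tangent_space[OF atlas_slit u]]
            vf_tangent[OF vf_bracket[OF vf_G vf_gam[OF Y]] u]])
    moreover have "K u 0 = 0"
      using linear_connection_combine(2)[OF linear_D u sec_fundamental vf_tangent[OF vf_G u] vf_tangent[OF vf_G u]] by (simp add: conn_map_def zero_fun_def)
    ultimately show ?thesis using conn_map_bracket_spray_gam[OF u Y] by simp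
  qed
  have "gam M u (- D u (G u) Y) = - gam M u (D u (G u) Y)"
    using gam_combine(2)[OF atlas_M u zT DT] gam_0[OF atlas_M u] by simp
  then have lift_eq: "lift Y u = beta_field Y u - gam M u (D u (G u) Y)"
    using KB by (simp add: beta_field_def hor_def)
  have "br X G u = br (\<lambda>w. beta_field Y w + gam M w (N w)) G u"
    by (rule bracket_cong[where X = X and Y = G, OF atlas_slit u vf_tangent[OF X u] vf_tangent[OF vf_G u]]) (simp_all only: X_eq[symmetric])
  also have "\<dots> = br (beta_field Y) G u + lift N u"
    unfolding lift_def by (rule bracket_add_left[OF atlas_slit u vf_beta_field[OF Y] vf_gam[OF N] vf_G])
  also have "br (beta_field Y) G u = - br G (beta_field Y) u" by (rule bracket_antisym)
  finally have "rho M u (br X G u) = N u - D u (G u) Y"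
    by (simp only: uminus_add_conv_diff linear_diff[OF linear_rho[OF atlas_M]] rho_lift[OF u N]
        rho_bracket_spray_beta[OF u Y])
  then have "gam M u (rho M u (br X G u)) = gam M u (N u) - gam M u (D u (G u) Y)"
    using gam_combine(2)[OF atlas_M u NT DT] by simp
  then have "barthel M G X u = beta_field Y u - gam M u (N u)"
    using lift_eq by (simp add: barthel_def Jmap_def lift_def Y_def)
  moreover have "nonlinear_connection M D u (X u) = 2 *\<^sub>R beta_field Y u - X u"
    using beta_field_props(1)[OF u Y] by (simp add: nonlinear_connection_def Y_def)
  ultimately show ?thesis using X_eq[OF u] by (simp add: scaleR_2)
qed

end

theorem theorem3p1:
  fixes M :: "('a, 'e::euclidean_space) atlas"
    and L :: "'a tpt \<Rightarrow> real"
    and D :: "'a conn"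
    and G :: "'a tpt \<Rightarrow> 'a tpt tvec"
  assumes finsler: "finsler_manifold M L"
    and spray: "canonical_spray M L G"
    and regular: "regular_connection M D"
    and metric: "metric_connection M L D"
    and Q_zero: "\<And>X Y u. pb_section M X \<Longrightarrow> pb_section M Y \<Longrightarrow> u \<in> carrier (slit M) \<Longrightarrow>
                   h_torsion M D X Y u = 0"
    and T_sym: "\<And>X Y Z u. pb_section M X \<Longrightarrow> pb_section M Y \<Longrightarrow> pb_section M Z \<Longrightarrow>
                   u \<in> carrier (slit M) \<Longrightarrow>
                   finsler_metric L u (mixed_torsion M D X Y u) (Z u) =
                   finsler_metric L u (mixed_torsion M D X Z u) (Y u)"
  shows "\<forall>X. vector_field (slit M) X \<longrightarrow>
           (\<forall>u\<in>carrier (slit M). nonlinear_connection M D u (X u) = barthel M G X u)"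
proof -
  interpret barthel_setting M L D G by unfold_locales (fact assms)+
  show ?thesis by (simp add: nonlinear_connection_eq_barthel)
qed

end
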